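(* Let $K$ be a field, let $(P,L)$ be a linear space with $\#P=d\ge 2$, let $\Lambda$ be its incidence complex, and let $I_\Delta=I_\Lambda+(x_1^2,\dots,x_d^2)\subset R=K[x_1,\dots,x_d]$. For each integer $k$ let $L_k$ be the number of lines in $L$ with exactly $k$ points. Then the graded Betti numbers of $R/I_\Delta$ are $$\beta_{1,j}(R/I_\Delta)=\begin{cases}\#P & \text{if } j=2,\\ \binom{\#P}{3}-\sum_{k\ge 3}\binom{k}{3}L_k & \text{if } j=3,\\ 0&\text{otherwise,}\end{cases}$$ and, for each integer $i\ge 2$: (a) $\beta_{i,j}(R/I_\Delta)=0$ if $j\le i+1$; (b) if $j=i+2$, then $$\begin{aligned}\beta_{i,i+2}(R/I_\Delta)={}&\binom{\#P}{i+2}-\#P\binom{\#P}{i+1}+\binom{\#P}{2}\binom{\#P-2}{i}\\&+\sum_{k\ge 2}L_k\left[\binom{\#P-k}{i+2}-k\binom{\#P-k}{i}+\binom{k}{2}\binom{\#P-k}{i-2}\right]\\&+\sum_{k\ge 2}L_k\left[-\binom{\#P}{i+2}+k\binom{\#P}{i+1}-\binom{k}{2}\binom{\#P-2}{i}\right];\end{aligned}$$ (c) if $j\ge i+3$, then $$\beta_{i,j}(R/I_\Delta)=\sum_{k\ge j-i}\binom{k}{j-i}\binom{\#P-k}{2i-j}L_k.$$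
   Context: A point-line incidence structure $(P,L)$ consists of a finite set $P$ of points and a finite set $L$ of lines with an incidence relation; lines are identified with the sets of points incident to them. It is a linear space if any two distinct points lie on exactly one common line and every line contains at least two points. The incidence complex $\Lambda$ of $(P,L)$ is the simplicial complex on the vertex set $P$ whose facets are the sets of points on each line of $L$. The variables $x_1,\dots,x_d$ of $R=K[x_1,\dots,x_d]$ (standard grading) are indexed by the points of $P$, and $I_\Lambda\subset R$ is the Stanley-Reisner ideal, generated by the squarefree monomials corresponding to nonfaces of $\Lambda$. For a graded $R$-module $M$, $\beta_{i,j}(M)=\dim_K[\operatorname{Tor}_i^R(K,M)]_j$. Binomial coefficients $\binom{a}{b}$ with $a\ge 0$ are $0$ if $b<0$ or $b>a$. *)

theory Defs
  imports HOL.Vector_Spaces "HOL-Library.Poly_Mapping" "HOL-Library.Function_Algebras"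
    "HOL-Library.Set_Algebras"
begin

text \<open>
  The polynomial ring over \<open>'k\<close> with one variable for each element of \<open>'p\<close>: finitely supported
  maps from exponent vectors to coefficients, with the convolution product.
\<close>

type_synonym ('p, 'k) mpoly = "('p \<Rightarrow>\<^sub>0 nat) \<Rightarrow>\<^sub>0 'k"

definition var :: "'p \<Rightarrow> ('p, 'k::field) mpoly" where
  "var p = Poly_Mapping.single (Poly_Mapping.single p 1) 1"

definition const :: "'k \<Rightarrow> ('p, 'k::field) mpoly" where
  "const c = Poly_Mapping.single 0 c"

definition constant_coeff :: "('p, 'k::field) mpoly \<Rightarrow> 'k" where
  "constant_coeff f = Poly_Mapping.lookup f 0"

definition mon_degree :: "('p::finite \<Rightarrow>\<^sub>0 nat) \<Rightarrow> nat" where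
  "mon_degree m = (\<Sum>p\<in>UNIV. Poly_Mapping.lookup m p)"

text \<open>The component of degree \<open>n\<close> in the standard grading; it is zero for \<open>n < 0\<close>.\<close>

definition homogeneous :: "int \<Rightarrow> ('p::finite, 'k::field) mpoly set" where
  "homogeneous n = {f. \<forall>m\<in>Poly_Mapping.keys f. int (mon_degree m) = n}"

definition ideal_generated :: "('p, 'k::field) mpoly set \<Rightarrow> ('p, 'k) mpoly set" where
  "ideal_generated G = module.span (*) G"

text \<open>Lines are identified with their sets of points.\<close>

definition linear_space :: "'p set \<Rightarrow> 'p set set \<Rightarrow> bool" where
  "linear_space P L \<longleftrightarrow> finite P \<and> L \<subseteq> Pow P \<and> (\<forall>l\<in>L. card l \<ge> 2) \<and>
     (\<forall>p\<in>P. \<forall>q\<in>P. p \<noteq> q \<longrightarrow> (\<exists>!l. l \<in> L \<and> p \<in> l \<and> q \<in> l))"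

definition num_lines :: "'p set set \<Rightarrow> nat \<Rightarrow> nat" where
  "num_lines L k = card {l \<in> L. card l = k}"

text \<open>The faces are the subsets of the lines. In a linear space no line contains another one,
  so the facets are exactly the lines.\<close>

definition incidence_complex :: "'p set set \<Rightarrow> 'p set set" where
  "incidence_complex L = {\<sigma>. \<exists>l\<in>L. \<sigma> \<subseteq> l}"

text \<open>The complex \<open>\<Lambda>\<close> is given by its set of faces, and its vertex set is all of \<open>'p\<close>.\<close>

definition stanley_reisner_ideal :: "'p::finite set set \<Rightarrow> ('p, 'k::field) mpoly set" where
  "stanley_reisner_ideal \<Lambda> = ideal_generated {\<Prod>p\<in>\<sigma>. var p |\<sigma>. \<sigma> \<notin> \<Lambda>}"

definition squares_ideal :: "('p::finite, 'k::field) mpoly set" where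
  "squares_ideal = ideal_generated (range (\<lambda>p. var p ^ 2))"

text \<open>The sum of the two ideals is the elementwise sum of sets.\<close>

definition I_Delta :: "'p::finite set set \<Rightarrow> ('p, 'k::field) mpoly set" where
  "I_Delta L = stanley_reisner_ideal (incidence_complex L) + squares_ideal"

text \<open>
  With \<open>R\<close> the polynomial ring, the data of a complex of finitely generated graded free modules
  \<open>F\<^sub>i = (\<Oplus>b < rank i. R(- shift i b))\<close> and an augmentation from \<open>F\<^sub>0\<close> to \<open>K\<close>. The map
  from \<open>F\<^sub>(\<^sub>i\<^sub>+\<^sub>1\<^sub>)\<close> to \<open>F\<^sub>i\<close> has the matrix \<open>diff i\<close>, with rows \<open>c < rank i\<close> and columns
  \<open>b < rank (Suc i)\<close>; the augmentation sends the basis element \<open>b\<close> to \<open>aug b\<close>.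
\<close>

record (overloaded) ('p, 'k) augmented_complex =
  rank :: "nat \<Rightarrow> nat"
  shift :: "nat \<Rightarrow> nat \<Rightarrow> int"
  diff :: "nat \<Rightarrow> nat \<Rightarrow> nat \<Rightarrow> ('p, 'k) mpoly"
  aug :: "nat \<Rightarrow> 'k"

definition free_module :: "('p, 'k::field) augmented_complex \<Rightarrow> nat \<Rightarrow> (nat \<Rightarrow> ('p, 'k) mpoly) set" where
  "free_module F i = {v. \<forall>b\<ge>rank F i. v b = 0}"

definition free_module_deg ::
    "('p::finite, 'k::field) augmented_complex \<Rightarrow> nat \<Rightarrow> int \<Rightarrow> (nat \<Rightarrow> ('p, 'k) mpoly) set" where
  "free_module_deg F i j =
     {v \<in> free_module F i. \<forall>b<rank F i. v b \<in> homogeneous (j - shift F i b)}"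

text \<open>The differential leaving homological degree \<open>i\<close>; it is zero for \<open>i = 0\<close>.\<close>

fun boundary :: "('p, 'k::field) augmented_complex \<Rightarrow> nat \<Rightarrow>
    (nat \<Rightarrow> ('p, 'k) mpoly) \<Rightarrow> (nat \<Rightarrow> ('p, 'k) mpoly)" where
  "boundary F 0 v = (\<lambda>c. 0)"
| "boundary F (Suc i) v =
     (\<lambda>c. if c < rank F i then \<Sum>b<rank F (Suc i). diff F i c b * v b else 0)"

text \<open>\<open>R\<close> acts on \<open>K\<close> through the constant coefficient.\<close>

definition augmentation :: "('p, 'k::field) augmented_complex \<Rightarrow> (nat \<Rightarrow> ('p, 'k) mpoly) \<Rightarrow> 'k" where
  "augmentation F v = (\<Sum>b<rank F 0. constant_coeff (v b) * aug F b)"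

definition graded_free_resolution :: "('p::finite, 'k::field) augmented_complex \<Rightarrow> bool" where
  "graded_free_resolution F \<longleftrightarrow>
     (\<forall>i. \<forall>c<rank F i. \<forall>b<rank F (Suc i).
        diff F i c b \<in> homogeneous (shift F (Suc i) b - shift F i c)) \<and>
     (\<forall>b<rank F 0. aug F b \<noteq> 0 \<longrightarrow> shift F 0 b = 0) \<and>
     augmentation F ` free_module F 0 = UNIV \<and>
     {v \<in> free_module F 0. augmentation F v = 0} = boundary F 1 ` free_module F 1 \<and>
     (\<forall>i\<ge>1. {v \<in> free_module F i. boundary F i v = (\<lambda>c. 0)} =
        boundary F (Suc i) ` free_module F (Suc i))"

text \<open>
  \<open>Tor\<^sub>i(K, R/I)\<close> is the homology of \<open>F \<otimes> R/I\<close> for a resolution \<open>F\<close> of \<open>K\<close>. As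
  \<open>F\<^sub>i \<otimes> R/I = F\<^sub>i / I F\<^sub>i\<close>, where \<open>I F\<^sub>i\<close> consists of the vectors with entries in \<open>I\<close>, it is
  the quotient of the following two submodules of \<open>F\<^sub>i\<close>, given here in degree \<open>j\<close>. The ideal
  \<open>I\<close> is meant to be homogeneous.
\<close>

definition tor_cycles :: "('p::finite, 'k::field) augmented_complex \<Rightarrow> ('p, 'k) mpoly set \<Rightarrow>
    nat \<Rightarrow> int \<Rightarrow> (nat \<Rightarrow> ('p, 'k) mpoly) set" where
  "tor_cycles F I i j = {v \<in> free_module_deg F i j. \<forall>c. boundary F i v c \<in> I}"

definition tor_boundaries :: "('p::finite, 'k::field) augmented_complex \<Rightarrow> ('p, 'k) mpoly set \<Rightarrow>
    nat \<Rightarrow> int \<Rightarrow> (nat \<Rightarrow> ('p, 'k) mpoly) set" where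
  "tor_boundaries F I i j =
     {\<lambda>b. boundary F (Suc i) w b + u b |w u.
        w \<in> free_module_deg F (Suc i) j \<and> u \<in> free_module_deg F i j \<and> (\<forall>b. u b \<in> I)}"

definition vec_scale :: "'k::field \<Rightarrow> (nat \<Rightarrow> ('p, 'k) mpoly) \<Rightarrow> (nat \<Rightarrow> ('p, 'k) mpoly)" where
  "vec_scale a v = (\<lambda>b. const a * v b)"

lemma vector_space_vec_scale:
  "vector_space (vec_scale :: 'k::field \<Rightarrow> (nat \<Rightarrow> ('p, 'k) mpoly) \<Rightarrow> _)"
  by unfold_locales
    (auto simp: vec_scale_def const_def fun_eq_iff algebra_simps single_add mult_single
      simp flip: mult.assoc)

text \<open>
  Both spaces are finite-dimensional and the second one is contained in the first one, so the
  difference of their dimensions is the dimension of the quotient.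
\<close>

definition tor_dim :: "('p::finite, 'k::field) augmented_complex \<Rightarrow> ('p, 'k) mpoly set \<Rightarrow>
    nat \<Rightarrow> int \<Rightarrow> nat" where
  "tor_dim F I i j =
     vector_space.dim vec_scale (tor_cycles F I i j) -
     vector_space.dim vec_scale (tor_boundaries F I i j)"

text \<open>
  The graded Betti number \<open>\<beta>\<^sub>i\<^sub>,\<^sub>j(R/I)\<close>. As usual for derived functors, one resolution
  is chosen once and for all; the value does not depend on it.
\<close>

definition graded_betti :: "('p::finite, 'k::field) mpoly set \<Rightarrow> nat \<Rightarrow> int \<Rightarrow> nat" where
  "graded_betti I i j = tor_dim (SOME F. graded_free_resolution F) I i j"

definition binom :: "nat \<Rightarrow> int \<Rightarrow> int" where
  "binom a b = (if b < 0 then 0 else int (a choose nat b))"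

end

theory Submission
  imports Defs "HOL-Library.FuncSet" "HOL-Library.Countable" "HOL-Library.Extended_Nat"
    "HOL-Library.Cardinality"
begin

text \<open>
  The graded Betti numbers are the dimensions of the homology of the Koszul complex of \<open>R/I\<close>, where
  \<open>I = I\<^sub>\<Delta>\<close> consists of the polynomials without any of the monomials \<open>x\<^sup>S\<close> with \<open>S\<close> contained
  in a line (\<open>I_Delta_monomial\<close>). A basis of the complex is given by the pairs of a set \<open>T\<close> of
  size \<open>i\<close>, standing for \<open>e\<^sub>T\<close>, and of such a monomial, of degree \<open>s = j - i\<close>.

  Let \<open>I\<close> be replaced by the ideal belonging to a single line \<open>l\<close> with \<open>k\<close> points, generated by
  the \<open>x\<^sub>p\<^sup>2\<close> with \<open>p\<close> in \<open>l\<close> and the \<open>x\<^sub>p\<close> with \<open>p\<close> outside. Then the variables separate.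
  An explicit contraction (\<open>contraction_homotopy\<close>) cancels all pairs in which some variable can
  be moved, and the remaining pairs are a basis of the homology; there are
  \<open>(k choose s) * ((d - k) choose (i - s))\<close> of them. This also determines the dimensions of the
  spaces of cycles, by induction on \<open>s\<close> with rank and nullity.

  A linear space enters by two facts. Two lines share at most one point, so a monomial of degree
  at least 2 belongs to at most one line, and in monomial degrees \<open>s \<ge> 2\<close> the cycles are the
  direct sum of the cycles of the lines (\<open>dim_koszul_cycles_Un\<close>). Any two points are on a line, so
  in monomial degrees at most 2 the complex is the same as for one line containing all \<open>d\<close> points
  (\<open>koszul_cycles_cong_low_degree\<close>). Hence for \<open>s \<ge> 3\<close> the homology is the sum of the homologies
  of the lines, for \<open>s \<le> 1\<close> it is that of one line with \<open>d\<close> points, and for \<open>s = 2\<close> the cycles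
  come from the lines and the boundaries from the line with \<open>d\<close> points.

  The Betti numbers are defined by an unspecified free resolution of the field. Therefore the
  Koszul complex is shown to be a resolution, by the same contraction without a bound on the
  exponents (\<open>koszul_resolution\<close>), and the comparison theorem for graded free resolutions is proved,
  so that the resolution does not matter (\<open>tor_dim_independent\<close>).
\<close>

section \<open>Dimensions of subquotients\<close>

context vector_space
begin

lemma span_Int_of_independent:
  assumes "independent B" "C \<subseteq> B" "D \<subseteq> B" "C \<inter> D = {}" "x \<in> span C" "x \<in> span D"
  shows "x = 0"
proof -
  have "representation B x = representation C x" "representation B x = representation D x"
    using assms by (auto intro: representation_extend)
  then have "representation B x b = 0" for b
    using assms(4) representation_ne_zero[of C x b] representation_ne_zero[of D x b] by fastforce
  moreover have "x \<in> span B"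
    using assms(2,5) span_mono by blast
  ultimately show ?thesis
    using sum_nonzero_representation_eq[OF assms(1)] by fastforce
qed

end

context vector_space_pair
begin

lemma rank_nullity:
  assumes lin: "Vector_Spaces.linear s1 s2 f" and V: "vs1.subspace V" and fin: "V \<subseteq> vs1.span S" "finite S"
  shows "vs1.dim V = vs2.dim (f ` V) + vs1.dim {v \<in> V. f v = 0}"
proof -
  interpret f: Vector_Spaces.linear s1 s2 f by fact
  define K where "K = {v \<in> V. f v = 0}"
  obtain B0 where B0: "B0 \<subseteq> K" "vs1.independent B0" "K \<subseteq> vs1.span B0" "card B0 = vs1.dim K"
    by (rule vs1.basis_exists)
  obtain B where B: "B0 \<subseteq> B" "B \<subseteq> V" "vs1.independent B" "V \<subseteq> vs1.span B"
    using vs1.maximal_independent_subset_extend[of B0 V] B0 K_def by blast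
  have finB: "finite B"
    using vs1.independent_span_bound[OF fin(2) B(3)] B(2) fin(1) by blast
  define E where "E = B - B0"
  have spE: "vs1.span E \<subseteq> V"
    using B(2) V by (intro vs1.span_minimal) (auto simp: E_def)
  have inj: "inj_on f (vs1.span E)"
    unfolding f.inj_on_iff_eq_0[OF vs1.subspace_span]
  proof (intro ballI impI)
    fix x assume x: "x \<in> vs1.span E" "f x = 0"
    then have "x \<in> vs1.span B0"
      using spE B0(3) by (auto simp: K_def)
    with x(1) show "x = 0"
      by (intro vs1.span_Int_of_independent[OF B(3), of E B0]) (use B(1) in \<open>auto simp: E_def\<close>)
  qed
  have "vs2.dim (f ` V) = card E"
  proof (rule vs2.dim_unique)
    show "f ` E \<subseteq> f ` V"
      using B(2) by (auto simp: E_def)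
    have "f ` V \<subseteq> f ` vs1.span B"
      using B(4) by blast
    also have "\<dots> = vs2.span (f ` B)"
      by (simp add: f.span_image)
    also have "\<dots> \<subseteq> vs2.span (f ` E)"
    proof (rule vs2.span_minimal)
      show "f ` B \<subseteq> vs2.span (f ` E)"
      proof (rule image_subsetI)
        fix b assume "b \<in> B"
        show "f b \<in> vs2.span (f ` E)"
        proof (cases "b \<in> B0")
          case True
          then have "f b = 0"
            using B0(1) by (auto simp: K_def)
          then show ?thesis
            by (simp add: vs2.span_zero)
        next
          case False
          with \<open>b \<in> B\<close> show ?thesis
            by (auto simp: E_def intro: vs2.span_base)
        qed
      qed
    qed (rule vs2.subspace_span)
    finally show "f ` V \<subseteq> vs2.span (f ` E)" .
    show "vs2.independent (f ` E)"
      using B(3) vs1.independent_mono[of B E] inj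
      by (intro f.independent_injective_image) (auto simp: E_def)
    show "card (f ` E) = card E"
      by (meson card_image inj inj_on_subset vs1.span_superset)
  qed
  moreover have "vs1.dim V = card B"
    using B by (metis vs1.basis_card_eq_dim)
  moreover have "card B = card E + card B0"
    using B(1) finB by (simp add: E_def card_Diff_subset finite_subset card_mono)
  ultimately show ?thesis
    using B0(4) by (simp add: K_def)
qed

end

lemma (in vector_space) dim_mono_of_finite_span:
  assumes "U \<subseteq> V" "V \<subseteq> span S" "finite S"
  shows "dim U \<le> dim V"
proof -
  obtain B where B: "B \<subseteq> V" "independent B" "V \<subseteq> span B" "card B = dim V"
    by (rule basis_exists)
  have "finite B"
    using independent_span_bound[OF assms(3) B(2)] B(1) assms(2) by auto
  then have "dim U \<le> card B"
    using assms(1) B(3) by (intro dim_le_card) auto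
  with B(4) show ?thesis
    by simp
qed

text \<open>
  Finite dimensionality of the graded pieces of a free module is read off from coefficients,
  which embed a piece into the functions with support in a finite set.
\<close>

lemma (in vector_space_pair) finite_span_of_inj_on:
  assumes lin: "Vector_Spaces.linear s1 s2 f" and V: "vs1.subspace V" and inj: "inj_on f V"
    and fin: "f ` V \<subseteq> vs2.span S" "finite S"
  obtains T where "finite T" "V \<subseteq> vs1.span T"
proof -
  interpret f: Vector_Spaces.linear s1 s2 f by fact
  obtain B where B: "B \<subseteq> V" "vs1.independent B" "V \<subseteq> vs1.span B"
    by (rule vs1.basis_exists)
  have "vs1.span B \<subseteq> V"
    using B(1) V by (rule vs1.span_minimal)
  then have inj': "inj_on f (vs1.span B)"
    by (rule inj_on_subset[OF inj])
  then have "vs2.independent (f ` B)"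
    by (rule f.independent_injective_image[OF B(2)])
  moreover have "inj_on f B"
    using inj B(1) by (rule inj_on_subset)
  moreover have "finite (f ` B)"
    using vs2.independent_span_bound[OF fin(2) \<open>vs2.independent (f ` B)\<close>]
      image_mono[OF B(1), of f] fin(1) by (meson order_trans)
  ultimately show thesis
    by (intro that[OF _ B(3)]) (rule finite_imageD)
qed

text \<open>
  A substitute for the projection to a quotient space: the identity minus a projection onto \<open>U\<close>.
\<close>

lemma (in vector_space) exists_linear_map_with_kernel:
  assumes "subspace U"
  obtains g where "Vector_Spaces.linear scale scale g" "\<And>x. g x = 0 \<longleftrightarrow> x \<in> U"
proof -
  interpret self: vector_space_pair scale scale ..
  obtain p where p: "range p \<subseteq> U" "Vector_Spaces.linear scale scale p" "\<forall>v\<in>U. p v = v"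
    using self.linear_exists_left_inverse_on[OF linear_ident assms inj_on_id2] by blast
  interpret p: Vector_Spaces.linear scale scale p by fact
  show thesis
  proof
    show "Vector_Spaces.linear scale scale (\<lambda>x. x - p x)"
      by (intro self.linear_compose_sub linear_ident p(2))
    show "x - p x = 0 \<longleftrightarrow> x \<in> U" for x
      using p(1,3) by (metis eq_iff_diff_eq_0 rangeI subsetD)
  qed
qed

text \<open>
  A linear map inducing an isomorphism \<open>Z/B \<rightarrow> Z'/B'\<close> preserves the difference of the
  dimensions. No quotient space has to be formed: after composing with a map whose kernel is
  \<open>B'\<close>, both differences become the dimension of the same image.
\<close>

lemma (in vector_space_pair) dim_subquotient_eq:
  assumes lin: "Vector_Spaces.linear s1 s2 f"
    and Z: "vs1.subspace Z" "Z \<subseteq> vs1.span S" "finite S"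
    and Z': "vs2.subspace Z'" "Z' \<subseteq> vs2.span S'" "finite S'"
    and B': "vs2.subspace B'" "B' \<subseteq> Z'"
    and f: "f ` Z \<subseteq> Z'"
    and B: "{z \<in> Z. f z \<in> B'} = B"
    and surj: "\<And>z'. z' \<in> Z' \<Longrightarrow> \<exists>z\<in>Z. z' - f z \<in> B'"
  shows "vs1.dim Z - vs1.dim B = vs2.dim Z' - vs2.dim B'"
proof -
  obtain g where g: "Vector_Spaces.linear s2 s2 g" and ker: "\<And>x. g x = 0 \<longleftrightarrow> x \<in> B'"
    using vs2.exists_linear_map_with_kernel[OF B'(1)] by blast
  interpret g: Vector_Spaces.linear s2 s2 g by fact
  interpret self: vector_space_pair s2 s2 ..
  have gf: "Vector_Spaces.linear s1 s2 (g \<circ> f)"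
    using lin g by (rule Vector_Spaces.linear_compose)
  have 1: "vs1.dim Z = vs2.dim ((g \<circ> f) ` Z) + vs1.dim B"
    using rank_nullity[OF gf Z] B by (simp add: ker)
  have "{z \<in> Z'. g z = 0} = B'"
    using B'(2) ker by auto
  then have 2: "vs2.dim Z' = vs2.dim (g ` Z') + vs2.dim B'"
    using self.rank_nullity[OF g Z'] by simp
  have "g ` Z' = (g \<circ> f) ` Z"
  proof
    show "(g \<circ> f) ` Z \<subseteq> g ` Z'"
      using f by auto
    show "g ` Z' \<subseteq> (g \<circ> f) ` Z"
    proof (rule image_subsetI)
      fix z' assume "z' \<in> Z'"
      then obtain z where "z \<in> Z" "z' - f z \<in> B'"
        using surj by blast
      then have "g z' = g (f z)"
        by (metis ker g.diff eq_iff_diff_eq_0)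
      with \<open>z \<in> Z\<close> show "g z' \<in> (g \<circ> f) ` Z"
        by auto
    qed
  qed
  with 1 2 show "vs1.dim Z - vs1.dim B = vs2.dim Z' - vs2.dim B'"
    by simp
qed

section \<open>Spaces of finitely supported functions\<close>

definition fun_scale :: "'k::field \<Rightarrow> ('a \<Rightarrow> 'k) \<Rightarrow> ('a \<Rightarrow> 'k)" where
  "fun_scale c f = (\<lambda>x. c * f x)"

lemma vector_space_fun_scale: "vector_space (fun_scale :: 'k::field \<Rightarrow> ('a \<Rightarrow> 'k) \<Rightarrow> _)"
  by unfold_locales (simp_all add: fun_scale_def fun_eq_iff distrib_left distrib_right)

interpretation fun_vs: vector_space "fun_scale :: 'k::field \<Rightarrow> ('a \<Rightarrow> 'k) \<Rightarrow> _"
  by (rule vector_space_fun_scale)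

interpretation vec_vs: vector_space "vec_scale :: 'k::field \<Rightarrow> (nat \<Rightarrow> ('p, 'k) mpoly) \<Rightarrow> _"
  by (rule vector_space_vec_scale)

definition supported :: "'a set \<Rightarrow> ('a \<Rightarrow> 'k::field) set" where
  "supported S = {f. \<forall>x. x \<notin> S \<longrightarrow> f x = 0}"

text \<open>
  The basis of the functions with support in a finite set.
\<close>

definition point_mass :: "'a \<Rightarrow> 'a \<Rightarrow> 'k::field" where
  "point_mass s = (\<lambda>x. if x = s then 1 else 0)"

lemma subspace_supported: "fun_vs.subspace (supported S)"
  unfolding fun_vs.subspace_def by (simp add: supported_def fun_scale_def)

lemma sum_fun_apply: "(\<Sum>a\<in>A. f a) x = (\<Sum>a\<in>A. f a x :: 'b::comm_monoid_add)"
  by (induction A rule: infinite_finite_induct) auto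

lemma sum_point_mass:
  assumes "finite S"
  shows "(\<Sum>s\<in>S. fun_scale (c s) (point_mass s)) x = (if x \<in> S then c x else 0)"
proof -
  have "fun_scale (c s) (point_mass s) x = (if x = s then c s else 0)" for s
    by (simp add: fun_scale_def point_mass_def)
  then show ?thesis
    using assms by (simp add: sum_fun_apply)
qed

lemma supported_subset_span:
  assumes "finite S"
  shows "supported S \<subseteq> fun_vs.span (point_mass ` S)"
proof
  fix f :: "'a \<Rightarrow> 'b" assume "f \<in> supported S"
  then have "f = (\<Sum>s\<in>S. fun_scale (f s) (point_mass s))"
    using assms by (auto simp: fun_eq_iff sum_point_mass supported_def)
  then show "f \<in> fun_vs.span (point_mass ` S)"
    by (metis (no_types, lifting) fun_vs.span_base fun_vs.span_scale fun_vs.span_sum imageI)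
qed

lemma dim_supported:
  assumes "finite S"
  shows "fun_vs.dim (supported S :: ('a \<Rightarrow> 'k::field) set) = card S"
proof (rule fun_vs.dim_unique[OF _ supported_subset_span[OF assms]])
  have inj: "inj_on (point_mass :: 'a \<Rightarrow> 'a \<Rightarrow> 'k) S"
    by (auto simp: inj_on_def point_mass_def fun_eq_iff split: if_splits)
  show "point_mass ` S \<subseteq> (supported S :: ('a \<Rightarrow> 'k) set)"
    by (auto simp: supported_def point_mass_def)
  show "fun_vs.independent (point_mass ` S :: ('a \<Rightarrow> 'k) set)"
  proof (rule fun_vs.independent_if_scalars_zero)
    fix c :: "('a \<Rightarrow> 'k) \<Rightarrow> 'k" and x :: "'a \<Rightarrow> 'k"
    assume sum: "(\<Sum>x\<in>point_mass ` S. fun_scale (c x) x) = 0" and "x \<in> point_mass ` S"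
    then obtain s where s: "s \<in> S" "x = point_mass s"
      by blast
    have "(\<Sum>s\<in>S. fun_scale (c (point_mass s)) (point_mass s)) s = 0"
      using fun_cong[OF sum, of s] unfolding sum.reindex[OF inj] o_def by simp
    then show "c x = 0"
      using s assms by (simp add: sum_point_mass)
  qed (use assms in simp)
  show "card (point_mass ` S :: ('a \<Rightarrow> 'k) set) = card S"
    using inj by (rule card_image)
qed

section \<open>Graded pieces of the polynomial ring\<close>

abbreviation (input) lookup :: "('a \<Rightarrow>\<^sub>0 'b::zero) \<Rightarrow> 'a \<Rightarrow> 'b" where
  "lookup \<equiv> Poly_Mapping.lookup"

abbreviation (input) keys :: "('a \<Rightarrow>\<^sub>0 'b::zero) \<Rightarrow> 'a set" where
  "keys \<equiv> Poly_Mapping.keys"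

abbreviation (input) single :: "'a \<Rightarrow> 'b::zero \<Rightarrow> 'a \<Rightarrow>\<^sub>0 'b" where
  "single \<equiv> Poly_Mapping.single"

lemma lookup_const_mult [simp]: "lookup (const c * f) m = c * lookup f m"
  unfolding const_def mult_map_scale_conv_mult[symmetric] by (simp add: map.rep_eq when_def)

lemma mon_degree_add [simp]: "mon_degree (m + n) = mon_degree m + mon_degree n"
  by (simp add: mon_degree_def lookup_add sum.distrib)

lemma mon_degree_zero [simp]: "mon_degree 0 = 0"
  by (simp add: mon_degree_def)

lemma mon_degree_single [simp]: "mon_degree (single p n) = n"
  by (simp add: mon_degree_def lookup_single when_def)

lemma finite_mon_degree: "finite {m :: 'p::finite \<Rightarrow>\<^sub>0 nat. mon_degree m = n}"
proof (rule finite_imageD)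
  show "inj_on lookup {m :: 'p \<Rightarrow>\<^sub>0 nat. mon_degree m = n}"
    by (rule inj_onI) (simp only: poly_mapping_eq_iff)
  have "lookup m p \<le> mon_degree m" for m :: "'p \<Rightarrow>\<^sub>0 nat" and p
    unfolding mon_degree_def by (rule member_le_sum) auto
  then have "lookup ` {m :: 'p \<Rightarrow>\<^sub>0 nat. mon_degree m = n} \<subseteq> (UNIV :: 'p set) \<rightarrow>\<^sub>E {..n}"
    by auto
  then show "finite (lookup ` {m :: 'p \<Rightarrow>\<^sub>0 nat. mon_degree m = n})"
    by (rule finite_subset) (simp add: finite_PiE)
qed

lemma homogeneous_0 [simp]: "0 \<in> homogeneous n"
  by (simp add: homogeneous_def)

lemma homogeneous_1: "1 \<in> homogeneous 0"
  by (simp add: homogeneous_def)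

lemma homogeneous_const: "const c \<in> homogeneous 0"
  by (simp add: homogeneous_def const_def)

lemma homogeneous_var: "var p \<in> homogeneous 1"
  by (simp add: homogeneous_def var_def)

lemma homogeneous_add: "f \<in> homogeneous n \<Longrightarrow> g \<in> homogeneous n \<Longrightarrow> f + g \<in> homogeneous n"
  using keys_add[of f g] by (auto simp: homogeneous_def)

lemma homogeneous_diff: "f \<in> homogeneous n \<Longrightarrow> g \<in> homogeneous n \<Longrightarrow> f - g \<in> homogeneous n"
  using keys_diff[of f g] by (auto simp: homogeneous_def)

lemma homogeneous_sum: "(\<And>a. a \<in> A \<Longrightarrow> f a \<in> homogeneous n) \<Longrightarrow> sum f A \<in> homogeneous n"
  by (induction A rule: infinite_finite_induct) (auto intro: homogeneous_add)

lemma homogeneous_mult: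
  "f \<in> homogeneous m \<Longrightarrow> g \<in> homogeneous n \<Longrightarrow> f * g \<in> homogeneous (m + n)"
  using keys_mult[of f g] by (fastforce simp: homogeneous_def)

text \<open>
  The component of degree \<open>n\<close>. Exactness of a resolution is given for whole modules; taking
  components turns it into exactness in every single degree.
\<close>

definition hcomp :: "int \<Rightarrow> ('p::finite, 'k::field) mpoly \<Rightarrow> ('p, 'k) mpoly" where
  "hcomp n f = Abs_poly_mapping (\<lambda>m. if int (mon_degree m) = n then lookup f m else 0)"

lemma lookup_hcomp: "lookup (hcomp n f) m = (if int (mon_degree m) = n then lookup f m else 0)"
proof -
  have "finite {m. (if int (mon_degree m) = n then lookup f m else 0) \<noteq> 0}"
    by (rule finite_subset[of _ "{m. lookup f m \<noteq> 0}"]) auto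
  then show ?thesis
    unfolding hcomp_def by simp
qed

lemma hcomp_homogeneous: "hcomp n f \<in> homogeneous n"
  by (auto simp: homogeneous_def in_keys_iff lookup_hcomp split: if_splits)

lemma hcomp_of_homogeneous: "f \<in> homogeneous n \<Longrightarrow> hcomp n f = f"
  by (intro poly_mapping_eqI) (auto simp: homogeneous_def in_keys_iff lookup_hcomp)

lemma hcomp_0 [simp]: "hcomp n 0 = 0"
  by (intro poly_mapping_eqI) (simp add: lookup_hcomp)

lemma hcomp_add: "hcomp n (f + g) = hcomp n f + hcomp n g"
  by (intro poly_mapping_eqI) (simp add: lookup_hcomp lookup_add)

lemma hcomp_sum: "hcomp n (sum f A) = (\<Sum>a\<in>A. hcomp n (f a))"
  by (induction A rule: infinite_finite_induct) (auto simp: hcomp_add)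

lemma hcomp_mult:
  assumes "f \<in> homogeneous m"
  shows "hcomp (m + n) (f * g) = f * hcomp n g"
proof -
  define r where "r = g - hcomp n g"
  \<comment> \<open>Splitting off the part of degree n leaves no product in degree m + n.\<close>
  have r: "int (mon_degree k) \<noteq> n" if "k \<in> keys r" for k
    using that by (auto simp: r_def in_keys_iff lookup_minus lookup_hcomp split: if_splits)
  have "hcomp (m + n) (f * r) = 0"
  proof (rule poly_mapping_eqI)
    fix k
    have "k \<notin> keys (f * r)" if "int (mon_degree k) = m + n"
      using keys_mult[of f r] r assms that by (fastforce simp: homogeneous_def)
    then show "lookup (hcomp (m + n) (f * r)) k = lookup 0 k"
      by (simp add: lookup_hcomp in_keys_iff)
  qed
  moreover have "f * g = f * hcomp n g + f * r"
    by (simp add: r_def algebra_simps)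
  ultimately show ?thesis
    by (simp add: hcomp_add hcomp_of_homogeneous homogeneous_mult[OF assms hcomp_homogeneous])
qed

lemma constant_coeff_hcomp [simp]: "constant_coeff (hcomp 0 f) = constant_coeff f"
  by (simp add: constant_coeff_def lookup_hcomp)

lemma constant_coeff_add: "constant_coeff (f + g) = constant_coeff f + constant_coeff g"
  by (simp add: constant_coeff_def lookup_add)

section \<open>Graded free modules and their homomorphisms\<close>

definition vec_mult :: "('p, 'k::field) mpoly \<Rightarrow> (nat \<Rightarrow> ('p, 'k) mpoly) \<Rightarrow> (nat \<Rightarrow> ('p, 'k) mpoly)" where
  "vec_mult r v = (\<lambda>b. r * v b)"

definition unit_vec :: "nat \<Rightarrow> nat \<Rightarrow> ('p, 'k::field) mpoly" where
  "unit_vec b = (\<lambda>c. if c = b then 1 else 0)"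

text \<open>
  Homomorphisms of degree 0 between two of the free modules, as total functions on all vectors:
  requiring linearity everywhere and values in the target everywhere makes composition and
  difference unconditional. As a price, the identity has to be replaced by a truncation.
\<close>

definition graded_hom ::
    "('p::finite, 'k::field) augmented_complex \<Rightarrow> nat \<Rightarrow> ('p, 'k) augmented_complex \<Rightarrow> nat \<Rightarrow>
      ((nat \<Rightarrow> ('p, 'k) mpoly) \<Rightarrow> (nat \<Rightarrow> ('p, 'k) mpoly)) \<Rightarrow> bool" where
  "graded_hom F i G k h \<longleftrightarrow>
     (\<forall>u v. h (u + v) = h u + h v) \<and> (\<forall>r v. h (vec_mult r v) = vec_mult r (h v)) \<and>
     (\<forall>v. h v \<in> free_module G k) \<and>
     (\<forall>j. \<forall>v\<in>free_module_deg F i j. h v \<in> free_module_deg G k j)"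

lemma vec_scale_eq: "vec_scale a v = vec_mult (const a) v"
  by (simp add: vec_scale_def vec_mult_def)

context
  fixes F :: "('p::finite, 'k::field) augmented_complex" and i
    and G :: "('p, 'k) augmented_complex" and k and h
  assumes hom: "graded_hom F i G k h"
begin

lemma graded_hom_add: "h (u + v) = h u + h v"
  using hom by (simp add: graded_hom_def)

lemma graded_hom_mult: "h (vec_mult r v) = vec_mult r (h v)"
  using hom by (simp add: graded_hom_def)

lemma graded_hom_scale: "h (vec_scale a v) = vec_scale a (h v)"
  by (simp add: vec_scale_eq graded_hom_mult)

lemma graded_hom_zero: "h 0 = 0"
proof -
  have "h 0 = h 0 + h 0"
    using graded_hom_add[of 0 0] by simp
  then show ?thesis
    by (simp only: add_cancel_right_right)
qed

lemma graded_hom_diff: "h (u - v) = h u - h v"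
  using graded_hom_add[of "u - v" v] by (simp add: eq_diff_eq)

lemma graded_hom_sum: "h (\<Sum>a\<in>A. f a) = (\<Sum>a\<in>A. h (f a))"
  by (induction A rule: infinite_finite_induct)
    (simp_all only: sum.infinite sum.empty sum.insert not_False_eq_True graded_hom_zero graded_hom_add)

lemma graded_hom_in_free_module: "h v \<in> free_module G k"
  using hom by (simp add: graded_hom_def)

lemma graded_hom_in_deg: "v \<in> free_module_deg F i j \<Longrightarrow> h v \<in> free_module_deg G k j"
  using hom by (simp add: graded_hom_def)

lemma linear_graded_hom: "Vector_Spaces.linear vec_scale vec_scale h"
  by (simp add: Vector_Spaces.linear_iff vector_space_vec_scale graded_hom_add graded_hom_scale)

lemma graded_hom_expand:
  assumes "v \<in> free_module F i"
  shows "h v = (\<Sum>b<rank F i. vec_mult (v b) (h (unit_vec b)))"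
proof -
  have "v = (\<Sum>b<rank F i. vec_mult (v b) (unit_vec b))"
  proof
    fix c
    have "vec_mult (v b) (unit_vec b) c = (if b = c then v b else 0)" for b
      by (simp add: vec_mult_def unit_vec_def)
    then show "v c = (\<Sum>b<rank F i. vec_mult (v b) (unit_vec b)) c"
      using assms by (simp add: sum_fun_apply free_module_def)
  qed
  then have "h v = h (\<Sum>b<rank F i. vec_mult (v b) (unit_vec b))"
    by (rule arg_cong)
  then show ?thesis
    by (simp only: graded_hom_sum graded_hom_mult)
qed

end

lemma graded_hom_comp:
  assumes "graded_hom F i G k f" "graded_hom G k H l g"
  shows "graded_hom F i H l (\<lambda>v. g (f v))"
  using assms by (simp add: graded_hom_def)

lemma free_module_deg_diff:
  "u \<in> free_module_deg F i j \<Longrightarrow> v \<in> free_module_deg F i j \<Longrightarrow> u - v \<in> free_module_deg F i j"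
  by (simp add: free_module_deg_def free_module_def homogeneous_diff)

lemma free_module_deg_add:
  "u \<in> free_module_deg F i j \<Longrightarrow> v \<in> free_module_deg F i j \<Longrightarrow> u + v \<in> free_module_deg F i j"
  by (simp add: free_module_deg_def free_module_def homogeneous_add)

lemma free_module_deg_scale:
  "v \<in> free_module_deg F i j \<Longrightarrow> vec_scale a v \<in> free_module_deg F i j"
  using homogeneous_mult[OF homogeneous_const]
  by (fastforce simp add: free_module_deg_def free_module_def vec_scale_def)

lemma free_module_deg_0: "0 \<in> free_module_deg F i j"
  by (simp add: free_module_deg_def free_module_def)

lemma free_module_degD: "v \<in> free_module_deg F i j \<Longrightarrow> v \<in> free_module F i"
  by (simp add: free_module_deg_def)

lemma graded_hom_sub:
  assumes "graded_hom F i G k f" "graded_hom F i G k g"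
  shows "graded_hom F i G k (\<lambda>v. f v - g v)"
  using assms unfolding graded_hom_def
  by (auto simp: free_module_deg_diff vec_mult_def fun_eq_iff algebra_simps free_module_def)

lemma graded_hom_unit_ext:
  assumes "graded_hom F i G k f" "graded_hom F i G k g"
    and "\<And>b. b < rank F i \<Longrightarrow> f (unit_vec b) = g (unit_vec b)" and "v \<in> free_module F i"
  shows "f v = g v"
  using assms by (simp add: graded_hom_expand)

lemma unit_vec_in_deg: "b < rank F i \<Longrightarrow> unit_vec b \<in> free_module_deg F i (shift F i b)"
  by (simp add: unit_vec_def free_module_deg_def free_module_def homogeneous_1)

text \<open>
  A homomorphism may be prescribed freely on the basis, subject only to the degrees.
\<close>

lemma graded_hom_extend:
  assumes "\<And>b. b < rank F i \<Longrightarrow> w b \<in> free_module_deg G k (shift F i b)"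
  obtains h where "graded_hom F i G k h" "\<And>b. b < rank F i \<Longrightarrow> h (unit_vec b) = w b"
proof
  define h where "h v = (\<Sum>b<rank F i. vec_mult (v b) (w b))" for v
  have h: "h v c = (\<Sum>b<rank F i. v b * w b c)" for v c
    by (simp add: h_def sum_fun_apply vec_mult_def)
  show "graded_hom F i G k h"
    unfolding graded_hom_def
  proof (intro conjI allI ballI)
    show "h (u + v) = h u + h v" for u v
      by (simp add: fun_eq_iff h distrib_right sum.distrib)
    show "h (vec_mult r v) = vec_mult r (h v)" for r v
      by (simp add: fun_eq_iff h vec_mult_def sum_distrib_left mult.assoc)
    show "h v \<in> free_module G k" for v
      using assms by (simp add: free_module_def free_module_deg_def h)
    then show "h v \<in> free_module_deg G k j" if v: "v \<in> free_module_deg F i j" for j v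
    proof -
      have "v b * w b c \<in> homogeneous (j - shift G k c)" if "b < rank F i" "c < rank G k" for b c
        using homogeneous_mult[of "v b" "j - shift F i b" "w b c" "shift F i b - shift G k c"]
          v assms[of b] that by (simp add: free_module_deg_def)
      then show ?thesis
        using \<open>h v \<in> free_module G k\<close> by (auto simp: free_module_deg_def h intro!: homogeneous_sum)
    qed
  qed
  show "h (unit_vec b) = w b" if "b < rank F i" for b
  proof
    fix c
    have "unit_vec b b' * w b' c = (if b' = b then w b' c else 0)" for b'
      by (simp add: unit_vec_def)
    with that show "h (unit_vec b) c = w b c"
      by (simp add: h)
  qed
qed

section \<open>Degreewise exactness of a resolution\<close>

text \<open>
  The cycles of the augmented complex. Reading the augmentation as the differential in
  homological degree 0 lets the constructions below treat all degrees alike.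
\<close>

definition aug_cycles :: "('p::finite, 'k::field) augmented_complex \<Rightarrow> nat \<Rightarrow> (nat \<Rightarrow> ('p, 'k) mpoly) set" where
  "aug_cycles F i = (if i = 0 then {v \<in> free_module F 0. augmentation F v = 0}
     else {v \<in> free_module F i. boundary F i v = 0})"

lemma resolution_exact:
  assumes "graded_free_resolution F"
  shows "aug_cycles F i = boundary F (Suc i) ` free_module F (Suc i)"
  using assms unfolding graded_free_resolution_def aug_cycles_def zero_fun_def
  by (cases "i = 0") auto

lemma graded_hom_boundary:
  assumes "graded_free_resolution F"
  shows "graded_hom F (Suc i) F i (boundary F (Suc i))"
  unfolding graded_hom_def
proof (intro conjI allI ballI)
  show "boundary F (Suc i) (u + v) = boundary F (Suc i) u + boundary F (Suc i) v" for u v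
    by (simp add: fun_eq_iff distrib_left sum.distrib)
  show "boundary F (Suc i) (vec_mult r v) = vec_mult r (boundary F (Suc i) v)" for r v
    by (simp add: fun_eq_iff vec_mult_def sum_distrib_left mult.left_commute)
  show *: "boundary F (Suc i) v \<in> free_module F i" for v
    by (simp add: free_module_def)
  fix j v assume v: "v \<in> free_module_deg F (Suc i) j"
  have "diff F i c b * v b \<in> homogeneous (j - shift F i c)" if "b < rank F (Suc i)" "c < rank F i" for b c
    using homogeneous_mult[of "diff F i c b" "shift F (Suc i) b - shift F i c" "v b" "j - shift F (Suc i) b"]
      v assms that by (simp add: free_module_deg_def graded_free_resolution_def)
  with * show "boundary F (Suc i) v \<in> free_module_deg F i j"
    by (auto simp: free_module_deg_def intro!: homogeneous_sum)
qed

lemma boundary_boundary: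
  assumes "graded_free_resolution F" "v \<in> free_module F (Suc i)"
  shows "boundary F i (boundary F (Suc i) v) = 0"
proof (cases i)
  case 0
  then show ?thesis
    by (simp add: zero_fun_def)
next
  case (Suc n)
  have "boundary F (Suc i) v \<in> aug_cycles F i"
    using assms resolution_exact[of F i] by blast
  then show ?thesis
    using Suc by (simp add: aug_cycles_def)
qed

definition vec_hcomp :: "('p::finite, 'k::field) augmented_complex \<Rightarrow> nat \<Rightarrow> int \<Rightarrow>
    (nat \<Rightarrow> ('p, 'k) mpoly) \<Rightarrow> (nat \<Rightarrow> ('p, 'k) mpoly)" where
  "vec_hcomp F i j v = (\<lambda>b. if b < rank F i then hcomp (j - shift F i b) (v b) else 0)"

lemma vec_hcomp_in_deg: "vec_hcomp F i j v \<in> free_module_deg F i j"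
  by (simp add: vec_hcomp_def free_module_deg_def free_module_def hcomp_homogeneous)

lemma vec_hcomp_of_deg: "v \<in> free_module_deg F i j \<Longrightarrow> vec_hcomp F i j v = v"
  by (auto simp: vec_hcomp_def free_module_deg_def free_module_def hcomp_of_homogeneous fun_eq_iff)

lemma boundary_vec_hcomp:
  assumes "graded_free_resolution F"
  shows "boundary F (Suc i) (vec_hcomp F (Suc i) j v) = vec_hcomp F i j (boundary F (Suc i) v)"
proof
  fix c
  have "diff F i c b * hcomp (j - shift F (Suc i) b) (v b) = hcomp (j - shift F i c) (diff F i c b * v b)"
    if "b < rank F (Suc i)" "c < rank F i" for b
    using hcomp_mult[of "diff F i c b" "shift F (Suc i) b - shift F i c" "j - shift F (Suc i) b" "v b"]
      that assms by (simp add: graded_free_resolution_def)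
  then show "boundary F (Suc i) (vec_hcomp F (Suc i) j v) c = vec_hcomp F i j (boundary F (Suc i) v) c"
    by (simp add: vec_hcomp_def hcomp_sum)
qed

text \<open>
  A homogeneous cycle has a homogeneous preimage, namely a component of any preimage.
\<close>

lemma resolution_exact_deg:
  assumes "graded_free_resolution F" "v \<in> aug_cycles F i" "v \<in> free_module_deg F i j"
  obtains w where "w \<in> free_module_deg F (Suc i) j" "boundary F (Suc i) w = v"
proof -
  obtain w where "v = boundary F (Suc i) w"
    using assms(2) unfolding resolution_exact[OF assms(1)] by blast
  then show thesis
    using assms that[of "vec_hcomp F (Suc i) j w"] vec_hcomp_in_deg[of F "Suc i" j w]
    by (simp only: boundary_vec_hcomp vec_hcomp_of_deg)
qed

section \<open>The comparison theorem for resolutions\<close>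

text \<open>
  Free modules are projective: lift the images of the basis one by one.
\<close>

lemma graded_hom_lift:
  assumes hom: "graded_hom F i G k h" and res: "graded_free_resolution G"
    and cyc: "\<And>v. v \<in> free_module F i \<Longrightarrow> h v \<in> aug_cycles G k"
  obtains h' where "graded_hom F i G (Suc k) h'"
    "\<And>v. v \<in> free_module F i \<Longrightarrow> boundary G (Suc k) (h' v) = h v"
proof -
  have "\<exists>w. w \<in> free_module_deg G (Suc k) (shift F i b) \<and> boundary G (Suc k) w = h (unit_vec b)"
    if "b < rank F i" for b
    using resolution_exact_deg[OF res cyc[OF free_module_degD] graded_hom_in_deg[OF hom]]
      unit_vec_in_deg[OF that] by metis
  then obtain w where w: "\<And>b. b < rank F i \<Longrightarrow> w b \<in> free_module_deg G (Suc k) (shift F i b)"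
      "\<And>b. b < rank F i \<Longrightarrow> boundary G (Suc k) (w b) = h (unit_vec b)"
    by metis
  obtain h' where h': "graded_hom F i G (Suc k) h'" "\<And>b. b < rank F i \<Longrightarrow> h' (unit_vec b) = w b"
    using graded_hom_extend[OF w(1)] by blast
  show thesis
  proof (rule that[OF h'(1)])
    fix v assume v: "v \<in> free_module F i"
    show "boundary G (Suc k) (h' v) = h v"
      by (rule graded_hom_unit_ext[OF graded_hom_comp[OF h'(1) graded_hom_boundary[OF res]] hom _ v])
        (simp only: h'(2) w(2))
  qed
qed

definition chain_map :: "('p::finite, 'k::field) augmented_complex \<Rightarrow> ('p, 'k) augmented_complex \<Rightarrow>
    (nat \<Rightarrow> (nat \<Rightarrow> ('p, 'k) mpoly) \<Rightarrow> (nat \<Rightarrow> ('p, 'k) mpoly)) \<Rightarrow> bool" where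
  "chain_map F G \<phi> \<longleftrightarrow> (\<forall>n. graded_hom F n G n (\<phi> n)) \<and>
     (\<forall>n. \<forall>v\<in>free_module F (Suc n). boundary G (Suc n) (\<phi> (Suc n) v) = \<phi> n (boundary F (Suc n) v)) \<and>
     (\<forall>v\<in>free_module F 0. augmentation G (\<phi> 0 v) = augmentation F v)"

lemma constant_coeff_mult:
  fixes f g :: "('p, 'k::field) mpoly"
  shows "constant_coeff (f * g) = constant_coeff f * constant_coeff g"
proof -
  define f' where "f' = f - const (constant_coeff f)"
  have f': "0 \<notin> keys f'"
    by (simp add: f'_def in_keys_iff lookup_minus const_def constant_coeff_def)
  have "a + b \<noteq> 0" if "a \<in> keys f'" for a b :: "'p \<Rightarrow>\<^sub>0 nat"
  proof
    assume "a + b = 0"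
    then have "lookup a p + lookup b p = 0" for p
      by (metis lookup_add lookup_zero)
    then have "a = 0"
      by (intro poly_mapping_eqI) simp
    with that f' show False
      by simp
  qed
  then have "0 \<notin> keys (f' * g)"
    using keys_mult[of f' g] by fastforce
  moreover have "f * g = const (constant_coeff f) * g + f' * g"
    by (simp add: f'_def algebra_simps)
  ultimately show ?thesis
    by (simp add: constant_coeff_def lookup_add in_keys_iff)
qed

lemma augmentation_sum_mult:
  "augmentation F (\<Sum>b\<in>A. vec_mult (r b) (w b)) = (\<Sum>b\<in>A. constant_coeff (r b) * augmentation F (w b))"
proof (induction A rule: infinite_finite_induct)
  case (insert a A)
  have "augmentation F (vec_mult (r a) (w a) + u) = constant_coeff (r a) * augmentation F (w a) + augmentation F u" for u
    by (simp add: augmentation_def vec_mult_def constant_coeff_add constant_coeff_mult distrib_right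
        sum.distrib sum_distrib_left mult.assoc)
  from this[of "\<Sum>b\<in>A. vec_mult (r b) (w b)"] insert show ?case
    by (simp only: sum.insert not_False_eq_True)
qed (simp_all add: augmentation_def constant_coeff_def)

lemma augmentation_vec_hcomp:
  assumes "graded_free_resolution F"
  shows "augmentation F (vec_hcomp F 0 0 v) = augmentation F v"
proof -
  have "constant_coeff (hcomp (0 - shift F 0 b) (v b)) * aug F b = constant_coeff (v b) * aug F b"
    if "b < rank F 0" for b
    using assms that by (cases "aug F b = 0") (simp_all add: graded_free_resolution_def)
  then have "(\<Sum>b<rank F 0. constant_coeff (hcomp (0 - shift F 0 b) (v b)) * aug F b) =
      (\<Sum>b<rank F 0. constant_coeff (v b) * aug F b)"
    by (intro sum.cong) simp_all
  then show ?thesis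
    by (simp add: augmentation_def vec_hcomp_def)
qed

text \<open>
  The identity of the residue field lifts to a chain map between two resolutions, degree by
  degree. The recursion carries along that cycles go to cycles, which is what makes the next
  lift possible.
\<close>

lemma chain_map_exists:
  assumes F: "graded_free_resolution F" and G: "graded_free_resolution G"
  obtains \<phi> where "chain_map F G \<phi>"
proof -
  have "\<exists>w. w \<in> free_module_deg G 0 (shift F 0 b) \<and> augmentation G w = aug F b" if b: "b < rank F 0" for b
  proof (cases "aug F b = 0")
    case True
    then show ?thesis
      by (intro exI[of _ 0]) (simp add: free_module_deg_0 augmentation_def constant_coeff_def)
  next
    case False
    then have "shift F 0 b = 0"
      using F b by (simp add: graded_free_resolution_def)
    moreover obtain w where "augmentation G w = aug F b"
      using G unfolding graded_free_resolution_def by (metis UNIV_I imageE)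
    ultimately show ?thesis
      using augmentation_vec_hcomp[OF G, of w] vec_hcomp_in_deg[of G 0 0 w] by metis
  qed
  then obtain w where w: "\<And>b. b < rank F 0 \<Longrightarrow> w b \<in> free_module_deg G 0 (shift F 0 b)"
      "\<And>b. b < rank F 0 \<Longrightarrow> augmentation G (w b) = aug F b"
    by metis
  obtain f0 where f0: "graded_hom F 0 G 0 f0" "\<And>b. b < rank F 0 \<Longrightarrow> f0 (unit_vec b) = w b"
    using graded_hom_extend[OF w(1)] by blast
  have aug0: "augmentation G (f0 v) = augmentation F v" if "v \<in> free_module F 0" for v
  proof -
    have "augmentation G (f0 v) = (\<Sum>b<rank F 0. constant_coeff (v b) * augmentation G (f0 (unit_vec b)))"
      unfolding graded_hom_expand[OF f0(1) that] by (rule augmentation_sum_mult)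
    also have "\<dots> = (\<Sum>b<rank F 0. constant_coeff (v b) * aug F b)"
      by (intro sum.cong) (simp_all only: f0(2) w(2) lessThan_iff)
    finally show ?thesis
      by (simp only: augmentation_def)
  qed
  define P where "P n f \<longleftrightarrow> graded_hom F n G n f \<and> f ` aug_cycles F n \<subseteq> aug_cycles G n \<and>
      (n = 0 \<longrightarrow> (\<forall>v\<in>free_module F 0. augmentation G (f v) = augmentation F v))" for n f
  define Q where "Q n f g \<longleftrightarrow>
      (\<forall>v\<in>free_module F (Suc n). boundary G (Suc n) (g v) = f (boundary F (Suc n) v))" for n f g
  have "\<exists>\<phi>. \<forall>n. P n (\<phi> n) \<and> Q n (\<phi> n) (\<phi> (Suc n))"
  proof (rule dependent_nat_choice)
    have "P 0 f0"
      using f0(1) aug0 by (auto simp: P_def aug_cycles_def graded_hom_in_free_module)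
    then show "\<exists>f. P 0 f"
      by blast
    fix f n assume f: "P n f"
    then have f_hom: "graded_hom F n G n f"
      by (simp add: P_def)
    obtain g where g: "graded_hom F (Suc n) G (Suc n) g"
      "\<And>v. v \<in> free_module F (Suc n) \<Longrightarrow> boundary G (Suc n) (g v) = f (boundary F (Suc n) v)"
    proof (rule graded_hom_lift[OF graded_hom_comp[OF graded_hom_boundary[OF F] f_hom] G])
      fix v assume "v \<in> free_module F (Suc n)"
      then have "boundary F (Suc n) v \<in> aug_cycles F n"
        using resolution_exact[OF F] by blast
      then show "f (boundary F (Suc n) v) \<in> aug_cycles G n"
        using f by (auto simp: P_def)
    qed blast
    have "g v \<in> aug_cycles G (Suc n)" if "v \<in> aug_cycles F (Suc n)" for v
      using that g(2)[of v] graded_hom_in_free_module[OF g(1)] graded_hom_zero[OF f_hom]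
      unfolding aug_cycles_def by (simp del: boundary.simps)
    then have "P (Suc n) g"
      using g(1) by (auto simp: P_def)
    with g(2) show "\<exists>g. P (Suc n) g \<and> Q n f g"
      by (auto simp: Q_def)
  qed
  then obtain \<phi> where \<phi>: "\<And>n. P n (\<phi> n)" "\<And>n. Q n (\<phi> n) (\<phi> (Suc n))"
    by blast
  have "chain_map F G \<phi>"
    unfolding chain_map_def using \<phi>(1)[unfolded P_def] \<phi>(2)[unfolded Q_def] by (simp del: boundary.simps)
  then show thesis
    by (rule that)
qed

text \<open>
  A chain map inducing zero on the residue field is null-homotopic. At stage \<open>n\<close> the recursion
  remembers that \<open>\<theta>\<close> agrees with \<open>\<partial>h\<close> on cycles; then the defect
  \<open>\<theta> - h\<partial>\<close> in degree \<open>n + 1\<close> is a cycle and can be lifted.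
\<close>

lemma chain_homotopy:
  assumes F: "graded_free_resolution F" and G: "graded_free_resolution G"
    and hom: "\<And>n. graded_hom F n G n (\<theta> n)"
    and bd: "\<And>n v. v \<in> free_module F (Suc n) \<Longrightarrow>
      boundary G (Suc n) (\<theta> (Suc n) v) = \<theta> n (boundary F (Suc n) v)"
    and aug: "\<And>v. v \<in> free_module F 0 \<Longrightarrow> augmentation G (\<theta> 0 v) = 0"
  obtains h where "\<And>n. graded_hom F n G (Suc n) (h n)"
    "\<And>n v. v \<in> free_module F (Suc n) \<Longrightarrow>
      \<theta> (Suc n) v = boundary G (Suc (Suc n)) (h (Suc n) v) + h n (boundary F (Suc n) v)"
proof -
  define P where "P n f \<longleftrightarrow> graded_hom F n G (Suc n) f \<and>
      (\<forall>v\<in>aug_cycles F n. boundary G (Suc n) (f v) = \<theta> n v)" for n f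
  define Q where "Q n f g \<longleftrightarrow> (\<forall>v\<in>free_module F (Suc n).
      \<theta> (Suc n) v = boundary G (Suc (Suc n)) (g v) + f (boundary F (Suc n) v))" for n f g
  have "\<exists>h. \<forall>n. P n (h n) \<and> Q n (h n) (h (Suc n))"
  proof (rule dependent_nat_choice)
    have "\<theta> 0 v \<in> aug_cycles G 0" if "v \<in> free_module F 0" for v
      using that aug graded_hom_in_free_module[OF hom] by (simp add: aug_cycles_def)
    then obtain f where "graded_hom F 0 G (Suc 0) f"
      "\<And>v. v \<in> free_module F 0 \<Longrightarrow> boundary G (Suc 0) (f v) = \<theta> 0 v"
      by (rule graded_hom_lift[OF hom G]) blast+
    then have "P 0 f"
      unfolding P_def aug_cycles_def by (simp del: boundary.simps)
    then show "\<exists>f. P 0 f"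
      by blast
    fix f n assume f: "P n f"
    then have f_hom: "graded_hom F n G (Suc n) f"
      by (simp add: P_def)
    have cyc: "\<theta> (Suc n) v - f (boundary F (Suc n) v) \<in> aug_cycles G (Suc n)"
      if v: "v \<in> free_module F (Suc n)" for v
    proof -
      have "boundary F (Suc n) v \<in> aug_cycles F n"
        using v resolution_exact[OF F] by blast
      then have "boundary G (Suc n) (f (boundary F (Suc n) v)) = \<theta> n (boundary F (Suc n) v)"
        using f by (simp only: P_def)
      then have "boundary G (Suc n) (\<theta> (Suc n) v - f (boundary F (Suc n) v)) = 0"
        using bd[OF v] by (simp only: graded_hom_diff[OF graded_hom_boundary[OF G]] diff_self)
      moreover have "\<theta> (Suc n) v - f (boundary F (Suc n) v) \<in> free_module G (Suc n)"
        using graded_hom_in_free_module[OF hom] graded_hom_in_free_module[OF f_hom]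
        by (simp add: free_module_def)
      ultimately show ?thesis
        unfolding aug_cycles_def by simp
    qed
    obtain g where g: "graded_hom F (Suc n) G (Suc (Suc n)) g"
      "\<And>v. v \<in> free_module F (Suc n) \<Longrightarrow>
        boundary G (Suc (Suc n)) (g v) = \<theta> (Suc n) v - f (boundary F (Suc n) v)"
      by (rule graded_hom_lift[OF
            graded_hom_sub[OF hom graded_hom_comp[OF graded_hom_boundary[OF F] f_hom]] G cyc]) blast+
    have "P (Suc n) g"
      unfolding P_def
    proof (intro conjI g(1) ballI)
      fix v assume "v \<in> aug_cycles F (Suc n)"
      then have v: "v \<in> free_module F (Suc n)" "boundary F (Suc n) v = 0"
        unfolding aug_cycles_def by simp_all
      show "boundary G (Suc (Suc n)) (g v) = \<theta> (Suc n) v"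
        using g(2)[OF v(1)] unfolding v(2) graded_hom_zero[OF f_hom] by simp
    qed
    moreover have "Q n f g"
      unfolding Q_def using g(2) by simp
    ultimately show "\<exists>g. P (Suc n) g \<and> Q n f g"
      by blast
  qed
  then obtain h where h: "\<And>n. P n (h n)" "\<And>n. Q n (h n) (h (Suc n))"
    by blast
  show thesis
  proof (rule that)
    show "graded_hom F n G (Suc n) (h n)" for n
      using h(1) by (simp add: P_def)
    show "\<theta> (Suc n) v = boundary G (Suc (Suc n)) (h (Suc n) v) + h n (boundary F (Suc n) v)"
      if "v \<in> free_module F (Suc n)" for n v
      using h(2)[unfolded Q_def] that by (rule bspec)
  qed
qed

lemma augmentation_add: "augmentation F (u + v) = augmentation F u + augmentation F v"
  by (simp add: augmentation_def constant_coeff_add distrib_right sum.distrib)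

text \<open>
  The identity of the free module, extended to a homomorphism on all vectors.
\<close>

definition truncate :: "('p, 'k::field) augmented_complex \<Rightarrow> nat \<Rightarrow>
    (nat \<Rightarrow> ('p, 'k) mpoly) \<Rightarrow> (nat \<Rightarrow> ('p, 'k) mpoly)" where
  "truncate F n v = (\<lambda>b. if b < rank F n then v b else 0)"

lemma truncate_free_module: "v \<in> free_module F n \<Longrightarrow> truncate F n v = v"
  by (auto simp: truncate_def free_module_def)

lemma graded_hom_truncate: "graded_hom F n F n (truncate F n)"
  unfolding graded_hom_def
proof (intro conjI allI ballI)
  fix j v assume "v \<in> free_module_deg F n j"
  then show "truncate F n v \<in> free_module_deg F n j"
    by (simp add: truncate_free_module free_module_degD)
qed (auto simp: truncate_def vec_mult_def free_module_def)

text \<open>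
  Both \<open>\<psi>\<phi>\<close> and the identity lift the identity of the residue field, so their difference is
  null-homotopic.
\<close>

lemma chain_map_comp_homotopic_id:
  assumes F: "graded_free_resolution F" and \<phi>: "chain_map F G \<phi>" and \<psi>: "chain_map G F \<psi>"
  obtains h where "\<And>n. graded_hom F n F (Suc n) (h n)"
    "\<And>n v. v \<in> free_module F (Suc n) \<Longrightarrow>
      \<psi> (Suc n) (\<phi> (Suc n) v) - v = boundary F (Suc (Suc n)) (h (Suc n) v) + h n (boundary F (Suc n) v)"
proof -
  define \<theta> where "\<theta> n v = \<psi> n (\<phi> n v) - truncate F n v" for n v
  have hom\<phi>: "graded_hom F n G n (\<phi> n)" and hom\<psi>: "graded_hom G n F n (\<psi> n)" for n
    using \<phi> \<psi> by (simp_all add: chain_map_def)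
  have hom: "graded_hom F n F n (\<theta> n)" for n
    unfolding \<theta>_def by (rule graded_hom_sub[OF graded_hom_comp[OF hom\<phi> hom\<psi>] graded_hom_truncate])
  have "boundary F (Suc n) (\<theta> (Suc n) v) = \<theta> n (boundary F (Suc n) v)"
    if v: "v \<in> free_module F (Suc n)" for n v
  proof -
    have "boundary F (Suc n) (\<psi> (Suc n) (\<phi> (Suc n) v)) = \<psi> n (\<phi> n (boundary F (Suc n) v))"
      using \<phi> \<psi> v graded_hom_in_free_module[OF hom\<phi>] by (simp only: chain_map_def)
    then show ?thesis
      by (simp only: \<theta>_def truncate_free_module[OF v] graded_hom_diff[OF graded_hom_boundary[OF F]]
          truncate_free_module[OF graded_hom_in_free_module[OF graded_hom_boundary[OF F]]])
  qed
  moreover have "augmentation F (\<theta> 0 v) = 0" if v: "v \<in> free_module F 0" for v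
  proof -
    have "augmentation F (\<psi> 0 (\<phi> 0 v)) = augmentation F v"
      using \<phi> \<psi> v graded_hom_in_free_module[OF hom\<phi>] by (simp only: chain_map_def)
    moreover have "augmentation F (\<theta> 0 v) + augmentation F v = augmentation F (\<psi> 0 (\<phi> 0 v))"
      by (simp only: augmentation_add[symmetric] \<theta>_def truncate_free_module[OF v] diff_add_cancel)
    ultimately show ?thesis
      by simp
  qed
  ultimately obtain h where "\<And>n. graded_hom F n F (Suc n) (h n)"
    "\<And>n v. v \<in> free_module F (Suc n) \<Longrightarrow>
      \<theta> (Suc n) v = boundary F (Suc (Suc n)) (h (Suc n) v) + h n (boundary F (Suc n) v)"
    by (rule chain_homotopy[OF F F hom]) blast+
  then show thesis
    by (intro that[of h]) (simp_all only: \<theta>_def truncate_free_module)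
qed

section \<open>Independence of the resolution\<close>

definition is_ideal :: "('p, 'k::field) mpoly set \<Rightarrow> bool" where
  "is_ideal I \<longleftrightarrow> 0 \<in> I \<and> (\<forall>f\<in>I. \<forall>g\<in>I. f + g \<in> I) \<and> (\<forall>r. \<forall>f\<in>I. r * f \<in> I)"

lemma is_ideal_sum: "is_ideal I \<Longrightarrow> (\<And>a. a \<in> A \<Longrightarrow> f a \<in> I) \<Longrightarrow> sum f A \<in> I"
  by (induction A rule: infinite_finite_induct) (auto simp: is_ideal_def)

text \<open>
  This is what makes a homomorphism pass to the tensor product with \<open>R/I\<close>.
\<close>

lemma graded_hom_ideal:
  assumes hom: "graded_hom F i G k h" and I: "is_ideal I"
    and v: "v \<in> free_module F i" "\<And>b. v b \<in> I"
  shows "h v c \<in> I"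
proof -
  have "h v c = (\<Sum>b<rank F i. h (unit_vec b) c * v b)"
    by (simp add: graded_hom_expand[OF hom v(1)] sum_fun_apply vec_mult_def mult.commute)
  with I v(2) show ?thesis
    by (simp add: is_ideal_sum is_ideal_def)
qed

lemma finite_span_free_module_deg:
  fixes F :: "('p::finite, 'k::field) augmented_complex"
  obtains S where "finite S" "free_module_deg F i j \<subseteq> vec_vs.span S"
proof -
  interpret vector_space_pair "vec_scale :: 'k \<Rightarrow> (nat \<Rightarrow> ('p, 'k) mpoly) \<Rightarrow> _"
    "fun_scale :: 'k \<Rightarrow> (nat \<times> ('p \<Rightarrow>\<^sub>0 nat) \<Rightarrow> 'k) \<Rightarrow> _" ..
  define f :: "(nat \<Rightarrow> ('p, 'k) mpoly) \<Rightarrow> nat \<times> ('p \<Rightarrow>\<^sub>0 nat) \<Rightarrow> 'k"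
    where "f v = (\<lambda>(b, m). lookup (v b) m)" for v
  define A where "A = Sigma {..<rank F i} (\<lambda>b. {m :: 'p \<Rightarrow>\<^sub>0 nat. mon_degree m = nat (j - shift F i b)})"
  have A: "finite A"
    unfolding A_def by (intro finite_SigmaI finite_lessThan finite_mon_degree)
  have lin: "Vector_Spaces.linear vec_scale fun_scale f"
    unfolding Vector_Spaces.linear_iff
    by (intro conjI vector_space_vec_scale vector_space_fun_scale)
      (auto simp: f_def fun_scale_def vec_scale_def lookup_add fun_eq_iff)
  have sub: "vec_vs.subspace (free_module_deg F i j)"
    unfolding vec_vs.subspace_def
    by (intro conjI ballI allI free_module_deg_0 free_module_deg_add free_module_deg_scale)
  have inj: "inj_on f (free_module_deg F i j)"
  proof (rule inj_onI)
    fix u v assume "f u = f v"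
    then have "f u (b, m) = f v (b, m)" for b m
      by (rule fun_cong)
    then have "lookup (u b) m = lookup (v b) m" for b m
      by (simp add: f_def)
    then show "u = v"
      by (intro ext poly_mapping_eqI)
  qed
  have img: "f ` free_module_deg F i j \<subseteq> fun_vs.span (point_mass ` A)"
  proof -
    have "f v \<in> supported A" if v: "v \<in> free_module_deg F i j" for v
      unfolding supported_def
    proof (intro CollectI allI impI)
      fix x assume x: "x \<notin> A"
      obtain b m where bm: "x = (b, m)" by (cases x)
      show "f v x = 0"
      proof (rule ccontr)
        assume "f v x \<noteq> 0"
        then have m: "m \<in> keys (v b)"
          by (simp add: f_def bm in_keys_iff)
        then have "v b \<noteq> 0"
          by auto
        then have "b < rank F i"
          using free_module_degD[OF v] unfolding free_module_def by (auto simp flip: not_le)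
        moreover from this m have "int (mon_degree m) = j - shift F i b"
          using v by (simp add: free_module_deg_def homogeneous_def)
        ultimately show False
          using x by (simp add: A_def bm)
      qed
    qed
    then show ?thesis
      using supported_subset_span[OF A] by blast
  qed
  show thesis
    by (rule finite_span_of_inj_on[OF lin sub inj img finite_imageI[OF A]]) (rule that)
qed

lemma tor_boundariesI:
  "w \<in> free_module_deg F (Suc i) j \<Longrightarrow> u \<in> free_module_deg F i j \<Longrightarrow> (\<And>b. u b \<in> I) \<Longrightarrow>
    boundary F (Suc i) w + u \<in> tor_boundaries F I i j"
  unfolding tor_boundaries_def plus_fun_def by blast

lemma tor_boundariesE:
  assumes "v \<in> tor_boundaries F I i j"
  obtains w u where "v = boundary F (Suc i) w + u" "w \<in> free_module_deg F (Suc i) j"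
    "u \<in> free_module_deg F i j" "\<forall>b. u b \<in> I"
  using assms unfolding tor_boundaries_def plus_fun_def by blast

context
  fixes F :: "('p::finite, 'k::field) augmented_complex" and I :: "('p, 'k) mpoly set"
  assumes F: "graded_free_resolution F" and I: "is_ideal I"
begin

lemma subspace_tor_cycles: "vec_vs.subspace (tor_cycles F I (Suc i) j)"
proof -
  note b = graded_hom_boundary[OF F, of i]
  have "boundary F (Suc i) (vec_scale a v) c \<in> I" if "boundary F (Suc i) v c \<in> I" for a v c
    using that I unfolding graded_hom_scale[OF b] by (simp add: vec_scale_def is_ideal_def)
  moreover have "boundary F (Suc i) (u + v) c \<in> I"
    if "boundary F (Suc i) u c \<in> I" "boundary F (Suc i) v c \<in> I" for u v c
    using that I unfolding graded_hom_add[OF b] by (simp add: is_ideal_def)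
  moreover have "boundary F (Suc i) 0 c \<in> I" for c
    using I unfolding graded_hom_zero[OF b] by (simp add: is_ideal_def)
  ultimately show ?thesis
    unfolding vec_vs.subspace_def tor_cycles_def
    by (simp add: free_module_deg_0 free_module_deg_add free_module_deg_scale del: boundary.simps)
qed

lemma subspace_tor_boundaries: "vec_vs.subspace (tor_boundaries F I i j)"
proof -
  note b = graded_hom_boundary[OF F, of i]
  have "boundary F (Suc i) 0 + 0 \<in> tor_boundaries F I i j"
    using I by (intro tor_boundariesI free_module_deg_0) (simp add: is_ideal_def)
  then have "0 \<in> tor_boundaries F I i j"
    by (simp only: graded_hom_zero[OF b] add_0)
  moreover have "x + y \<in> tor_boundaries F I i j"
    if "x \<in> tor_boundaries F I i j" "y \<in> tor_boundaries F I i j" for x y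
  proof -
    obtain w u where x: "x = boundary F (Suc i) w + u" "w \<in> free_module_deg F (Suc i) j"
      "u \<in> free_module_deg F i j" "\<forall>b. u b \<in> I"
      using \<open>x \<in> tor_boundaries F I i j\<close> by (rule tor_boundariesE)
    obtain w' u' where y: "y = boundary F (Suc i) w' + u'"
      "w' \<in> free_module_deg F (Suc i) j" "u' \<in> free_module_deg F i j" "\<forall>b. u' b \<in> I"
      using \<open>y \<in> tor_boundaries F I i j\<close> by (rule tor_boundariesE)
    have "x + y = boundary F (Suc i) (w + w') + (u + u')"
      by (simp only: x y graded_hom_add[OF b] add_ac)
    moreover have "(u + u') b \<in> I" for b
      using x y I by (simp add: is_ideal_def)
    ultimately show ?thesis
      using tor_boundariesI[OF free_module_deg_add[OF x(2) y(2)] free_module_deg_add[OF x(3) y(3)]]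
      by (simp only:)
  qed
  moreover have "vec_scale a x \<in> tor_boundaries F I i j" if "x \<in> tor_boundaries F I i j" for a x
  proof -
    obtain w u where x: "x = boundary F (Suc i) w + u" "w \<in> free_module_deg F (Suc i) j"
      "u \<in> free_module_deg F i j" "\<forall>b. u b \<in> I"
      using \<open>x \<in> tor_boundaries F I i j\<close> by (rule tor_boundariesE)
    have "vec_scale a x = boundary F (Suc i) (vec_scale a w) + vec_scale a u"
      by (simp only: x graded_hom_scale[OF b] vec_vs.scale_right_distrib)
    moreover have "vec_scale a u b \<in> I" for b
      using x I by (simp add: is_ideal_def vec_scale_def)
    ultimately show ?thesis
      using tor_boundariesI[OF free_module_deg_scale[OF x(2)] free_module_deg_scale[OF x(3)]]
      by (simp only:)
  qed
  ultimately show ?thesis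
    unfolding vec_vs.subspace_def by blast
qed

lemma tor_boundaries_subset_cycles: "tor_boundaries F I (Suc i) j \<subseteq> tor_cycles F I (Suc i) j"
proof
  fix v assume "v \<in> tor_boundaries F I (Suc i) j"
  then obtain w u where v: "v = boundary F (Suc (Suc i)) w + u" "w \<in> free_module_deg F (Suc (Suc i)) j"
    "u \<in> free_module_deg F (Suc i) j" "\<forall>b. u b \<in> I"
    by (rule tor_boundariesE)
  have "v \<in> free_module_deg F (Suc i) j"
    unfolding v(1)
    by (rule free_module_deg_add[OF graded_hom_in_deg[OF graded_hom_boundary[OF F] v(2)] v(3)])
  moreover have "boundary F (Suc i) v = boundary F (Suc i) u"
    by (simp only: v(1) graded_hom_add[OF graded_hom_boundary[OF F]]
        boundary_boundary[OF F free_module_degD[OF v(2)]] add_0)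
  then have "boundary F (Suc i) v c \<in> I" for c
    using graded_hom_ideal[OF graded_hom_boundary[OF F] I free_module_degD[OF v(3)]] v(4) by (simp del: boundary.simps)
  ultimately show "v \<in> tor_cycles F I (Suc i) j"
    by (simp add: tor_cycles_def)
qed

lemma finite_span_tor_cycles:
  obtains S where "finite S" "tor_cycles F I i j \<subseteq> vec_vs.span S"
proof -
  obtain S where "finite S" "free_module_deg F i j \<subseteq> vec_vs.span S"
    by (rule finite_span_free_module_deg)
  then show thesis
    by (intro that[of S]) (auto simp: tor_cycles_def)
qed

text \<open>
  On a cycle modulo \<open>I\<close>, the homotopy contributes the boundary of \<open>h v\<close> and the vector
  \<open>h (\<partial>v)\<close>, whose entries lie in \<open>I\<close>.
\<close>

lemma chain_map_comp_id_boundary: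
  assumes \<phi>: "chain_map F G \<phi>" and \<psi>: "chain_map G F \<psi>" and v: "v \<in> tor_cycles F I (Suc i) j"
  shows "\<psi> (Suc i) (\<phi> (Suc i) v) - v \<in> tor_boundaries F I (Suc i) j"
proof -
  obtain h where h: "\<And>n. graded_hom F n F (Suc n) (h n)"
    "\<And>n v. v \<in> free_module F (Suc n) \<Longrightarrow>
      \<psi> (Suc n) (\<phi> (Suc n) v) - v = boundary F (Suc (Suc n)) (h (Suc n) v) + h n (boundary F (Suc n) v)"
    by (rule chain_map_comp_homotopic_id[OF F \<phi> \<psi>]) blast
  have v_deg: "v \<in> free_module_deg F (Suc i) j" and bv: "\<And>c. boundary F (Suc i) v c \<in> I"
    using v by (simp_all add: tor_cycles_def del: boundary.simps)
  have bd: "boundary F (Suc i) v \<in> free_module_deg F i j"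
    by (rule graded_hom_in_deg[OF graded_hom_boundary[OF F] v_deg])
  show ?thesis
    unfolding h(2)[OF free_module_degD[OF v_deg]]
    by (intro tor_boundariesI graded_hom_in_deg[OF h(1)] v_deg bd
        graded_hom_ideal[OF h(1) I free_module_degD[OF bd] bv])
qed

lemma chain_map_tor_cycles:
  assumes \<phi>: "chain_map F G \<phi>" and v: "v \<in> tor_cycles F I (Suc i) j"
  shows "\<phi> (Suc i) v \<in> tor_cycles G I (Suc i) j"
proof -
  have hom: "graded_hom F n G n (\<phi> n)" for n
    using \<phi> by (simp add: chain_map_def)
  have v_deg: "v \<in> free_module_deg F (Suc i) j" and bv: "\<And>c. boundary F (Suc i) v c \<in> I"
    using v by (simp_all add: tor_cycles_def del: boundary.simps)
  have "boundary G (Suc i) (\<phi> (Suc i) v) = \<phi> i (boundary F (Suc i) v)"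
    using \<phi> free_module_degD[OF v_deg] by (simp only: chain_map_def)
  moreover have "\<phi> i (boundary F (Suc i) v) c \<in> I" for c
    by (rule graded_hom_ideal[OF hom I graded_hom_in_free_module[OF graded_hom_boundary[OF F]] bv])
  ultimately show ?thesis
    using graded_hom_in_deg[OF hom v_deg] by (simp add: tor_cycles_def del: boundary.simps)
qed

lemma chain_map_tor_boundaries:
  assumes \<phi>: "chain_map F G \<phi>" and G: "graded_free_resolution G"
    and v: "v \<in> tor_boundaries F I (Suc i) j"
  shows "\<phi> (Suc i) v \<in> tor_boundaries G I (Suc i) j"
proof -
  have hom: "graded_hom F n G n (\<phi> n)" for n
    using \<phi> by (simp add: chain_map_def)
  obtain w u where v: "v = boundary F (Suc (Suc i)) w + u" "w \<in> free_module_deg F (Suc (Suc i)) j"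
    "u \<in> free_module_deg F (Suc i) j" "\<forall>b. u b \<in> I"
    using v by (rule tor_boundariesE[where F=F])
  have "\<phi> (Suc i) v = \<phi> (Suc i) (boundary F (Suc (Suc i)) w) + \<phi> (Suc i) u"
    unfolding v(1) by (rule graded_hom_add[OF hom])
  also have "\<phi> (Suc i) (boundary F (Suc (Suc i)) w) = boundary G (Suc (Suc i)) (\<phi> (Suc (Suc i)) w)"
    using \<phi> free_module_degD[OF v(2)] by (simp only: chain_map_def)
  finally have eq: "\<phi> (Suc i) v = boundary G (Suc (Suc i)) (\<phi> (Suc (Suc i)) w) + \<phi> (Suc i) u" .
  show ?thesis
    unfolding eq
    by (intro tor_boundariesI graded_hom_in_deg[OF hom] v(2,3)
        graded_hom_ideal[OF hom I free_module_degD[OF v(3)]] v(4)[rule_format])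
qed

end

text \<open>
  A chain map in one direction induces the isomorphism on Tor; the chain map in the other
  direction, being its inverse up to homotopy, supplies injectivity and surjectivity.
\<close>

theorem tor_dim_independent:
  fixes F G :: "('p::finite, 'k::field) augmented_complex"
  assumes F: "graded_free_resolution F" and G: "graded_free_resolution G" and I: "is_ideal I"
  shows "tor_dim F I (Suc i) j = tor_dim G I (Suc i) j"
proof -
  interpret vector_space_pair "vec_scale :: 'k \<Rightarrow> (nat \<Rightarrow> ('p, 'k) mpoly) \<Rightarrow> _"
    "vec_scale :: 'k \<Rightarrow> (nat \<Rightarrow> ('p, 'k) mpoly) \<Rightarrow> _" ..
  obtain \<phi> where \<phi>: "chain_map F G \<phi>"
    by (rule chain_map_exists[OF F G])
  obtain \<psi> where \<psi>: "chain_map G F \<psi>"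
    by (rule chain_map_exists[OF G F])
  have lin: "Vector_Spaces.linear vec_scale vec_scale (\<phi> (Suc i))"
    using \<phi> by (intro linear_graded_hom[of F "Suc i" G "Suc i"]) (simp add: chain_map_def)
  obtain S where S: "finite S" "tor_cycles F I (Suc i) j \<subseteq> vec_vs.span S"
    by (rule finite_span_tor_cycles[OF F I])
  obtain S' where S': "finite S'" "tor_cycles G I (Suc i) j \<subseteq> vec_vs.span S'"
    by (rule finite_span_tor_cycles[OF G I])
  have B: "{z \<in> tor_cycles F I (Suc i) j. \<phi> (Suc i) z \<in> tor_boundaries G I (Suc i) j} =
      tor_boundaries F I (Suc i) j" (is "?P = ?B")
  proof
    show "?B \<subseteq> ?P"
      by (intro subsetI CollectI conjI chain_map_tor_boundaries[OF F I \<phi> G]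
          subsetD[OF tor_boundaries_subset_cycles[OF F I]])
    show "?P \<subseteq> ?B"
    proof
      fix z assume z: "z \<in> ?P"
      then have 1: "\<psi> (Suc i) (\<phi> (Suc i) z) \<in> ?B"
        by (intro chain_map_tor_boundaries[OF G I \<psi> F]) simp
      have 2: "\<psi> (Suc i) (\<phi> (Suc i) z) - z \<in> ?B"
        using z by (intro chain_map_comp_id_boundary[OF F I \<phi> \<psi>]) simp
      have "z = \<psi> (Suc i) (\<phi> (Suc i) z) - (\<psi> (Suc i) (\<phi> (Suc i) z) - z)"
        by (simp only: diff_diff_eq2 add_diff_cancel_left')
      then show "z \<in> ?B"
        using vec_vs.subspace_diff[OF subspace_tor_boundaries[OF F I] 1 2] by (simp only:)
    qed
  qed
  have surj: "\<exists>z\<in>tor_cycles F I (Suc i) j. z' - \<phi> (Suc i) z \<in> tor_boundaries G I (Suc i) j"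
    if z': "z' \<in> tor_cycles G I (Suc i) j" for z'
  proof
    show "\<psi> (Suc i) z' \<in> tor_cycles F I (Suc i) j"
      by (rule chain_map_tor_cycles[OF G I \<psi> z'])
    show "z' - \<phi> (Suc i) (\<psi> (Suc i) z') \<in> tor_boundaries G I (Suc i) j"
      using vec_vs.subspace_neg[OF subspace_tor_boundaries[OF G I] chain_map_comp_id_boundary[OF G I \<psi> \<phi> z']]
      by (simp only: minus_diff_eq)
  qed
  have img: "\<phi> (Suc i) ` tor_cycles F I (Suc i) j \<subseteq> tor_cycles G I (Suc i) j"
    by (intro image_subsetI chain_map_tor_cycles[OF F I \<phi>])
  show ?thesis
    unfolding tor_dim_def
    by (rule dim_subquotient_eq[OF lin subspace_tor_cycles[OF F I] S(2,1) subspace_tor_cycles[OF G I]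
          S'(2,1) subspace_tor_boundaries[OF G I] tor_boundaries_subset_cycles[OF G I] img B surj])
qed

section \<open>The Koszul complex of a monomial quotient\<close>

text \<open>
  The type of variables carries no order. The injection into the natural numbers that every
  finite type has serves to choose signs and least elements.
\<close>

definition first :: "'p::finite set \<Rightarrow> 'p" where
  "first A = (ARG_MIN to_nat p. p \<in> A)"

lemma first_in: "A \<noteq> {} \<Longrightarrow> first A \<in> A"
  unfolding first_def by (metis arg_min_natI ex_in_conv)

lemma first_less: "q \<in> A \<Longrightarrow> q \<noteq> first A \<Longrightarrow> to_nat (first A) < to_nat q"
  unfolding first_def using arg_min_nat_le[of "\<lambda>p. p \<in> A" q to_nat]
  by (metis inj_to_nat injD le_neq_implies_less)

definition koszul_sign :: "'p::finite \<Rightarrow> 'p set \<Rightarrow> 'k::field" where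
  "koszul_sign p T = (- 1) ^ card {q \<in> T. to_nat q < to_nat p}"

lemma koszul_sign_insert:
  assumes "q \<notin> T"
  shows "koszul_sign p (insert q T) = (if to_nat q < to_nat p then - koszul_sign p T else koszul_sign p T)"
proof (cases "to_nat q < to_nat p")
  case True
  then have "{q' \<in> insert q T. to_nat q' < to_nat p} = insert q {q' \<in> T. to_nat q' < to_nat p}"
    by auto
  with True assms show ?thesis
    by (simp add: koszul_sign_def)
next
  case False
  then have "{q' \<in> insert q T. to_nat q' < to_nat p} = {q' \<in> T. to_nat q' < to_nat p}"
    by auto
  with False show ?thesis
    by (simp add: koszul_sign_def)
qed

lemma koszul_sign_square: "koszul_sign p T * koszul_sign p T = 1"
  by (simp add: koszul_sign_def flip: power_add mult_2)

lemma koszul_sign_anticommute: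
  assumes "p \<noteq> q" "p \<notin> T" "q \<notin> T"
  shows "koszul_sign p T * koszul_sign q (insert p T) = - (koszul_sign q T * koszul_sign p (insert q T))"
  using assms inj_to_nat[THEN injD, of p q]
  by (auto simp: koszul_sign_insert not_less_iff_gr_or_eq)

text \<open>
  The terms are cancelled in pairs, so that the conclusion also holds in characteristic 2.
\<close>

lemma sum_antisymmetric:
  fixes g :: "'a \<Rightarrow> 'a \<Rightarrow> 'b::ab_group_add"
  assumes "finite A" "\<And>p q. p \<in> A \<Longrightarrow> q \<in> A \<Longrightarrow> p \<noteq> q \<Longrightarrow> g p q = - g q p"
  shows "(\<Sum>p\<in>A. \<Sum>q\<in>A - {p}. g p q) = 0"
  using assms
proof (induction A rule: finite_induct)
  case (insert x A)
  have *: "insert x A - {p} = insert x (A - {p})" if "p \<in> A" for p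
    using insert.hyps(2) that by auto
  have "(\<Sum>p\<in>A. \<Sum>q\<in>insert x A - {p}. g p q) = (\<Sum>p\<in>A. g p x + (\<Sum>q\<in>A - {p}. g p q))"
    using insert.hyps by (intro sum.cong refl) (simp add: *)
  also have "\<dots> = (\<Sum>p\<in>A. g p x) + (\<Sum>p\<in>A. \<Sum>q\<in>A - {p}. g p q)"
    by (rule sum.distrib)
  also have "(\<Sum>p\<in>A. \<Sum>q\<in>A - {p}. g p q) = 0"
    by (intro insert.IH insert.prems) simp_all
  also have "(\<Sum>p\<in>A. g p x) + 0 = (\<Sum>p\<in>A. g p x)"
    by simp
  also have "\<dots> = (\<Sum>p\<in>A. - g x p)"
    using insert.hyps by (intro sum.cong refl insert.prems) auto
  finally show ?case
    using insert.hyps by (simp add: sum_negf)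
qed simp

text \<open>
  A chain gives the coefficient of each basis element \<open>x\<^sup>a e\<^sub>T\<close> of the Koszul complex, encoded as
  the pair \<open>(T, a)\<close>. For a set \<open>Q\<close> of exponents closed under division, only the monomials in \<open>Q\<close>
  survive in the quotient by the ideal of the other monomials. The differential takes
  \<open>x\<^sup>a e\<^sub>T\<close> to the signed sum of \<open>x\<^sup>a\<^sup>+\<^sup>p e\<^sub>T\<^sub>-\<^sub>p\<close> over \<open>p\<close> in \<open>T\<close>; the definition below
  collects the coefficient of \<open>(T, a)\<close> in the image.
\<close>

type_synonym ('p, 'k) chain = "'p set \<times> ('p \<Rightarrow>\<^sub>0 nat) \<Rightarrow> 'k"

definition koszul_diff :: "('p::finite \<Rightarrow>\<^sub>0 nat) set \<Rightarrow> ('p, 'k::field) chain \<Rightarrow> ('p, 'k) chain" where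
  "koszul_diff Q f = (\<lambda>(T, a). if a \<in> Q
     then \<Sum>p | p \<notin> T \<and> 0 < lookup a p. koszul_sign p T * f (insert p T, a - single p 1) else 0)"

definition order_ideal :: "('p \<Rightarrow>\<^sub>0 nat) set \<Rightarrow> bool" where
  "order_ideal Q \<longleftrightarrow> (\<forall>a\<in>Q. \<forall>p. a - single p 1 \<in> Q)"

lemma lookup_minus_single:
  fixes a :: "'p \<Rightarrow>\<^sub>0 nat"
  shows "lookup (a - single p 1) q = (if q = p then lookup a p - 1 else lookup a q)"
  by (simp add: lookup_minus lookup_single when_def)

lemma lookup_add_single:
  fixes a :: "'p \<Rightarrow>\<^sub>0 nat"
  shows "lookup (a + single p 1) q = (if q = p then lookup a p + 1 else lookup a q)"
  by (simp add: lookup_add lookup_single when_def)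

lemmas [simp] = lookup_minus_single[unfolded One_nat_def] lookup_add_single[unfolded One_nat_def]

lemma minus_single_add: "0 < lookup a p \<Longrightarrow> a - single p 1 + single p (1::nat) = a"
  by (intro poly_mapping_eqI) (simp only: lookup_minus_single lookup_add_single, simp)

lemma koszul_diff_square:
  assumes Q: "order_ideal Q"
  shows "koszul_diff Q (koszul_diff Q f) = 0"
proof (rule ext, clarify)
  fix T and a :: "'a \<Rightarrow>\<^sub>0 nat"
  show "koszul_diff Q (koszul_diff Q f) (T, a) = 0 (T, a)"
  proof (cases "a \<in> Q")
    case True
    define A where "A = {p. p \<notin> T \<and> 0 < lookup a p}"
    define g where "g p q = koszul_sign p T * koszul_sign q (insert p T) *
      f (insert q (insert p T), a - single p 1 - single q 1)" for p q
    have "koszul_sign p T * koszul_diff Q f (insert p T, a - single p 1) = (\<Sum>q\<in>A - {p}. g p q)"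
      if "p \<in> A" for p
    proof -
      have "{q. q \<notin> insert p T \<and> 0 < lookup (a - single p 1) q} = A - {p}"
        by (auto simp: A_def lookup_minus_single split: if_splits)
      then show ?thesis
        using True Q unfolding koszul_diff_def order_ideal_def
        by (simp add: g_def sum_distrib_left mult.assoc)
    qed
    then have "koszul_diff Q (koszul_diff Q f) (T, a) = (\<Sum>p\<in>A. \<Sum>q\<in>A - {p}. g p q)"
      using True by (subst koszul_diff_def) (simp add: A_def)
    also have "\<dots> = 0"
    proof (rule sum_antisymmetric)
      fix p q assume *: "p \<in> A" "q \<in> A" "p \<noteq> q"
      have "a - single p 1 - single q 1 = a - single q 1 - single p 1"
        by (simp add: diff_diff_add add.commute)
      then show "g p q = - g q p"
        using koszul_sign_anticommute[of p q T, where ?'b='b] * by (simp add: g_def insert_commute A_def)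
    qed simp
    finally show ?thesis
      by simp
  qed (simp add: koszul_diff_def)
qed

lemma linear_koszul_diff:
  fixes Q :: "('p::finite \<Rightarrow>\<^sub>0 nat) set"
  shows "Vector_Spaces.linear fun_scale fun_scale (koszul_diff Q :: ('p, 'k::field) chain \<Rightarrow> _)"
proof (unfold Vector_Spaces.linear_iff, intro conjI vector_space_fun_scale allI)
  show "koszul_diff Q (f + g) = koszul_diff Q f + koszul_diff Q g" for f g :: "('p, 'k) chain"
    by (auto simp: koszul_diff_def fun_eq_iff distrib_left sum.distrib)
  show "koszul_diff Q (fun_scale c f) = fun_scale c (koszul_diff Q f)" for c and f :: "('p, 'k) chain"
    by (auto simp: koszul_diff_def fun_scale_def fun_eq_iff sum_distrib_left mult.left_commute)
qed

text \<open>
  The exponents bounded by \<open>n\<close> in each variable. The bound \<open>\<infinity>\<close> gives the whole polynomial ring,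
  and the bounds 1 on a line and 0 off it give the quotient belonging to that line alone.
\<close>

definition box :: "('p \<Rightarrow> enat) \<Rightarrow> ('p \<Rightarrow>\<^sub>0 nat) set" where
  "box n = {a. \<forall>p. enat (lookup a p) \<le> n p}"

lemma order_ideal_box: "order_ideal (box n)"
  unfolding order_ideal_def box_def
  by (auto simp: lookup_minus) (meson diff_le_self enat_ord_simps(1) order_trans)

text \<open>
  For a box the Koszul complex is a tensor product over the variables. In the variable \<open>p\<close> a basis
  element either can move (\<open>e\<^sub>p\<close> turns into a further factor \<open>x\<^sub>p\<close>), or is the result of such a
  move, or is inert; it is active in the first two cases.
\<close>

definition active :: "('p \<Rightarrow> enat) \<Rightarrow> 'p set \<Rightarrow> ('p \<Rightarrow>\<^sub>0 nat) \<Rightarrow> 'p set" where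
  "active n T a = {p. if p \<in> T then enat (lookup a p) < n p else 0 < lookup a p}"

lemma active_move_up:
  assumes "p \<notin> T" "0 < lookup a p" "a \<in> box n"
  shows "active n (insert p T) (a - single p 1) = active n T a"
proof -
  have "enat (lookup a p - 1) < enat (lookup a p)"
    using assms(2) by simp
  also have "\<dots> \<le> n p"
    using assms(3) by (simp add: box_def)
  finally show ?thesis
    using assms(1,2) unfolding active_def lookup_minus_single by auto
qed

lemma box_move_down:
  assumes "a \<in> box n" "enat (lookup a p) < n p"
  shows "a + single p 1 \<in> box n"
  using assms ileI1[OF assms(2)] unfolding box_def by (simp add: lookup_add_single eSuc_enat)

text \<open>
  The move in the least active variable, undone. In the coefficient of \<open>(T, a)\<close> only those pairs count
  that arise by putting \<open>p\<close> into \<open>T\<close>.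
\<close>

definition contraction :: "('p::finite \<Rightarrow> enat) \<Rightarrow> ('p, 'k::field) chain \<Rightarrow> ('p, 'k) chain" where
  "contraction n f = (\<lambda>(T, a). let p = first (active n T a) in
     if a \<in> box n \<and> active n T a \<noteq> {} \<and> p \<in> T
     then koszul_sign p (T - {p}) * f (T - {p}, a + single p 1) else 0)"

text \<open>
  Moves do not change the active set, hence not the least active variable \<open>p\<close> either. If \<open>p\<close> is
  outside \<open>T\<close>, only the move in \<open>p\<close> contributes to \<open>\<partial>h\<close>, and \<open>h\<partial>\<close> vanishes. If \<open>p\<close> is in \<open>T\<close>,
  the move in \<open>p\<close> contributes \<open>f (T, a)\<close> to \<open>h\<partial>\<close>, and every move in another variable \<open>q\<close> occurs in
  \<open>\<partial>h\<close> and in \<open>h\<partial>\<close> with opposite signs, because \<open>p\<close> comes before \<open>q\<close>.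
\<close>

lemma contraction_homotopy:
  fixes f :: "('p::finite, 'k::field) chain"
  assumes a: "a \<in> box n" and act: "active n T a \<noteq> {}"
  shows "koszul_diff (box n) (contraction n f) (T, a) + contraction n (koszul_diff (box n) f) (T, a) = f (T, a)"
proof -
  define p where "p = first (active n T a)"
  have p: "p \<in> active n T a"
    unfolding p_def by (rule first_in[OF act])
  have up: "contraction n f (insert q T, a - single q 1) =
      (if p \<in> insert q T then koszul_sign p (insert q T - {p}) * f (insert q T - {p}, a - single q 1 + single p 1) else 0)"
    if "q \<notin> T" "0 < lookup a q" for q
  proof -
    have "a - single q 1 \<in> box n"
      using order_ideal_box[of n] a unfolding order_ideal_def by blast
    then show ?thesis
      using act unfolding contraction_def by (simp add: active_move_up[OF that a, unfolded One_nat_def] p_def[symmetric] Let_def)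
  qed
  have 1: "koszul_diff (box n) (contraction n f) (T, a) =
      (\<Sum>q | q \<notin> T \<and> 0 < lookup a q. koszul_sign q T * (if p \<in> insert q T
        then koszul_sign p (insert q T - {p}) * f (insert q T - {p}, a - single q 1 + single p 1) else 0))"
    unfolding koszul_diff_def prod.case if_P[OF a] by (intro sum.cong refl) (subst up, auto)
  show ?thesis
  proof (cases "p \<in> T")
    case False
    then have ap: "0 < lookup a p"
      using p by (simp add: active_def)
    have "contraction n (koszul_diff (box n) f) (T, a) = 0"
      using False by (simp add: contraction_def p_def Let_def)
    moreover have "koszul_diff (box n) (contraction n f) (T, a) =
        (\<Sum>q | q \<notin> T \<and> 0 < lookup a q. if q = p then f (T, a) else 0)"
      unfolding 1
    proof (intro sum.cong refl)
      fix q
      have "koszul_sign p T * (koszul_sign p T * f (T, a)) = f (T, a)"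
        by (simp only: mult.assoc[symmetric] koszul_sign_square mult_1)
      with False show "koszul_sign q T * (if p \<in> insert q T
        then koszul_sign p (insert q T - {p}) * f (insert q T - {p}, a - single q 1 + single p 1) else 0) =
        (if q = p then f (T, a) else 0)"
        using minus_single_add[OF ap] by auto
    qed
    moreover have "\<dots> = f (T, a)"
      using False ap by simp
    ultimately show ?thesis
      by simp
  next
    case True
    then have ap: "enat (lookup a p) < n p"
      using p by (simp add: active_def)
    define T' where "T' = T - {p}"
    have T: "T = insert p T'" "p \<notin> T'"
      using True by (auto simp: T'_def)
    define A where "A = {q. q \<notin> T \<and> 0 < lookup a q}"
    have A: "{q. q \<notin> T' \<and> 0 < lookup (a + single p 1) q} = insert p A"
      unfolding A_def T lookup_add_single using T(2) by auto
    have pA: "p \<notin> A" using True by (simp add: A_def)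
    have s: "koszul_sign q T = - koszul_sign q T'" "koszul_sign p (insert q T') = koszul_sign p T'"
      if "q \<in> A" for q
    proof -
      have "q \<in> active n T a"
        using that by (simp add: A_def active_def)
      then have "to_nat p < to_nat q"
        using first_less[of q "active n T a"] pA that p_def by auto
      moreover have "q \<notin> T'"
        using that T by (auto simp: A_def)
      ultimately show "koszul_sign q T = - koszul_sign q T'" "koszul_sign p (insert q T') = koszul_sign p T'"
        using T by (simp_all add: koszul_sign_insert)
    qed
    have "contraction n (koszul_diff (box n) f) (T, a) =
        koszul_sign p T' * koszul_diff (box n) f (T', a + single p 1)"
      using True a act by (simp add: contraction_def p_def[symmetric] T'_def Let_def)
    also have "\<dots> = koszul_sign p T' *
        (\<Sum>q\<in>insert p A. koszul_sign q T' * f (insert q T', a + single p 1 - single q 1))"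
      unfolding koszul_diff_def prod.case if_P[OF box_move_down[OF a ap]] A ..
    also have "\<dots> = koszul_sign p T' * (koszul_sign p T' * f (T, a)) +
        (\<Sum>q\<in>A. koszul_sign p T' * koszul_sign q T' * f (insert q T', a + single p 1 - single q 1))"
      using pA by (simp add: T(1) distrib_left sum_distrib_left mult.assoc)
    also have "koszul_sign p T' * (koszul_sign p T' * f (T, a)) = f (T, a)"
      by (simp only: mult.assoc[symmetric] koszul_sign_square mult_1)
    also have "(\<Sum>q\<in>A. koszul_sign p T' * koszul_sign q T' * f (insert q T', a + single p 1 - single q 1)) =
        - koszul_diff (box n) (contraction n f) (T, a)"
      unfolding 1 A_def[symmetric] sum_negf[symmetric]
    proof (intro sum.cong refl)
      fix q assume q: "q \<in> A"
      have "insert q T - {p} = insert q T'"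
        using q pA T by auto
      moreover have "a + single p 1 - single q 1 = a - single q 1 + single p 1"
        using q pA by (intro poly_mapping_eqI)
          (auto simp: lookup_add lookup_minus lookup_single when_def A_def)
      ultimately show "koszul_sign p T' * koszul_sign q T' * f (insert q T', a + single p 1 - single q 1) =
          - (koszul_sign q T * (if p \<in> insert q T
              then koszul_sign p (insert q T - {p}) * f (insert q T - {p}, a - single q 1 + single p 1) else 0))"
        using True by (simp add: s[OF q])
    qed
    finally show ?thesis
      by simp
  qed
qed

section \<open>Cycles and boundaries of a monomial quotient\<close>

text \<open>
  The Koszul complex splits by the exterior degree \<open>i\<close> and the degree \<open>s\<close> of the monomial; the
  internal degree is \<open>j = i + s\<close>. The differential goes from \<open>(i + 1, s - 1)\<close> to \<open>(i, s)\<close>.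
\<close>

definition cells :: "('p::finite \<Rightarrow>\<^sub>0 nat) set \<Rightarrow> nat \<Rightarrow> nat \<Rightarrow> ('p set \<times> ('p \<Rightarrow>\<^sub>0 nat)) set" where
  "cells Q i s = {(T, a). card T = i \<and> a \<in> Q \<and> mon_degree a = s}"

text \<open>
  The source of the differential arriving at \<open>(i, s)\<close>, stated so that it is empty for \<open>s = 0\<close>.
\<close>

definition pre_cells :: "('p::finite \<Rightarrow>\<^sub>0 nat) set \<Rightarrow> nat \<Rightarrow> nat \<Rightarrow> ('p set \<times> ('p \<Rightarrow>\<^sub>0 nat)) set" where
  "pre_cells Q i s = {(T, a). card T = Suc i \<and> a \<in> Q \<and> Suc (mon_degree a) = s}"

definition koszul_cycles :: "('p::finite \<Rightarrow>\<^sub>0 nat) set \<Rightarrow> nat \<Rightarrow> nat \<Rightarrow> ('p, 'k::field) chain set" where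
  "koszul_cycles Q i s = {f \<in> supported (cells Q i s). koszul_diff Q f = 0}"

definition koszul_boundaries :: "('p::finite \<Rightarrow>\<^sub>0 nat) set \<Rightarrow> nat \<Rightarrow> nat \<Rightarrow> ('p, 'k::field) chain set" where
  "koszul_boundaries Q i s = koszul_diff Q ` supported (pre_cells Q i s)"

lemma pre_cells_Suc: "pre_cells Q i (Suc s) = cells Q (Suc i) s"
  by (simp add: pre_cells_def cells_def)

lemma pre_cells_0: "pre_cells Q i 0 = {}"
  by (simp add: pre_cells_def)

lemma finite_cells: "finite (cells Q i s)"
  by (rule finite_subset[of _ "UNIV \<times> {a. mon_degree a = s}"]) (auto simp: cells_def finite_mon_degree)

lemma Suc_mon_degree_minus_single: "0 < lookup a p \<Longrightarrow> Suc (mon_degree (a - single p 1)) = mon_degree a"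
  using arg_cong[OF minus_single_add, of a p mon_degree] unfolding mon_degree_add mon_degree_single by simp

lemma subspace_koszul_cycles: "fun_vs.subspace (koszul_cycles Q i s)"
proof -
  interpret f: Vector_Spaces.linear fun_scale fun_scale "koszul_diff Q"
    by (rule linear_koszul_diff)
  have "koszul_cycles Q i s = supported (cells Q i s) \<inter> {f. koszul_diff Q f = 0}"
    by (auto simp: koszul_cycles_def)
  then show ?thesis
    using fun_vs.subspace_inter[OF subspace_supported f.subspace_kernel] by metis
qed

lemma koszul_cycles_subset_span: "koszul_cycles Q i s \<subseteq> fun_vs.span (point_mass ` cells Q i s)"
  using supported_subset_span[OF finite_cells, of Q i s] unfolding koszul_cycles_def by blast

lemma subspace_koszul_boundaries: "fun_vs.subspace (koszul_boundaries Q i s)"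
proof -
  interpret f: Vector_Spaces.linear fun_scale fun_scale "koszul_diff Q"
    by (rule linear_koszul_diff)
  show ?thesis
    unfolding koszul_boundaries_def by (rule f.subspace_image[OF subspace_supported])
qed

lemma koszul_boundaries_subset_cycles:
  assumes Q: "order_ideal Q"
  shows "koszul_boundaries Q i s \<subseteq> koszul_cycles Q i s"
proof -
  have "koszul_diff Q f (T, a) = 0"
    if f: "f \<in> supported (pre_cells Q i s)" and Ta: "(T, a) \<notin> cells Q i s" for f :: "('a, 'b) chain" and T a
  proof (cases "a \<in> Q")
    case True
    have "f (insert p T, a - single p 1) = 0" if "p \<notin> T" "0 < lookup a p" for p
    proof -
      have "(insert p T, a - single p 1) \<notin> pre_cells Q i s"
        using Ta True Suc_mon_degree_minus_single[OF that(2)] that(1)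
        by (auto simp: cells_def pre_cells_def)
      then show ?thesis
        using f by (simp add: supported_def)
    qed
    then show ?thesis
      unfolding koszul_diff_def by simp
  qed (simp add: koszul_diff_def)
  then have "koszul_diff Q f \<in> supported (cells Q i s)"
    if "f \<in> supported (pre_cells Q i s)" for f :: "('a, 'b) chain"
    using that unfolding supported_def[of "cells Q i s"] by auto
  then show ?thesis
    using koszul_diff_square[OF Q] unfolding koszul_boundaries_def koszul_cycles_def by blast
qed

lemma card_cells_eq:
  fixes Q :: "('p::finite \<Rightarrow>\<^sub>0 nat) set"
  shows "card (cells Q (Suc i) s) =
    fun_vs.dim (koszul_boundaries Q i (Suc s) :: ('p, 'k::field) chain set) +
    fun_vs.dim (koszul_cycles Q (Suc i) s :: ('p, 'k) chain set)"
proof -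
  interpret vector_space_pair "fun_scale :: 'k \<Rightarrow> ('p, 'k) chain \<Rightarrow> _" "fun_scale :: 'k \<Rightarrow> ('p, 'k) chain \<Rightarrow> _" ..
  show ?thesis
    using rank_nullity[OF linear_koszul_diff[of Q] subspace_supported[of "cells Q (Suc i) s"]
        supported_subset_span[OF finite_cells] finite_imageI[OF finite_cells]]
    by (simp only: koszul_boundaries_def koszul_cycles_def pre_cells_Suc dim_supported[OF finite_cells])
qed

lemma koszul_boundaries_0: "koszul_boundaries Q i 0 = {0}"
proof -
  interpret f: Vector_Spaces.linear fun_scale fun_scale "koszul_diff Q"
    by (rule linear_koszul_diff)
  have "supported {} = {0 :: ('a, 'b) chain}"
    by (auto simp: supported_def)
  then show ?thesis
    by (simp only: koszul_boundaries_def pre_cells_0 image_insert image_empty f.zero)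
qed

lemma linear_restrict:
  "Vector_Spaces.linear fun_scale fun_scale (\<lambda>f x. if x \<in> A then f x else (0::'k::field))"
  unfolding Vector_Spaces.linear_iff by (auto simp: vector_space_fun_scale fun_scale_def)

definition inactive_cells :: "('p::finite \<Rightarrow> enat) \<Rightarrow> nat \<Rightarrow> nat \<Rightarrow> ('p set \<times> ('p \<Rightarrow>\<^sub>0 nat)) set" where
  "inactive_cells n i s = {(T, a) \<in> cells (box n) i s. active n T a = {}}"

lemma koszul_diff_inactive: "active n T a = {} \<Longrightarrow> koszul_diff Q f (T, a) = 0"
proof -
  assume "active n T a = {}"
  then have "{p. p \<notin> T \<and> 0 < lookup a p} = {}"
    unfolding active_def by (auto split: if_splits)
  then show ?thesis
    unfolding koszul_diff_def prod.case by (simp only: sum.empty if_cancel)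
qed

lemma koszul_diff_supported_inactive:
  fixes f :: "('p::finite, 'k::field) chain"
  assumes "f \<in> supported (inactive_cells n i s)"
  shows "koszul_diff (box n) f = 0"
proof (rule ext, clarify)
  fix T and a :: "'p \<Rightarrow>\<^sub>0 nat"
  have "f (insert p T, a - single p 1) = 0" if "p \<notin> T" "0 < lookup a p" "a \<in> box n" for p
  proof -
    have "p \<in> active n T a"
      using that by (simp add: active_def)
    then have "(insert p T, a - single p 1) \<notin> inactive_cells n i s"
      using active_move_up[OF that] by (auto simp: inactive_cells_def)
    then show ?thesis
      using assms by (simp add: supported_def)
  qed
  then show "koszul_diff (box n) f (T, a) = 0 (T, a)"
    unfolding koszul_diff_def by simp
qed

lemma contraction_supported:
  fixes f :: "('p::finite, 'k::field) chain"
  assumes "f \<in> supported (cells (box n) i s)"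
  shows "contraction n f \<in> supported (pre_cells (box n) i s)"
proof -
  have "contraction n f (T, a) = 0" if Ta: "(T, a) \<notin> pre_cells (box n) i s" for T a
  proof (cases "a \<in> box n \<and> first (active n T a) \<in> T")
    case True
    define p where "p = first (active n T a)"
    have "Suc (card (T - {p})) = card T"
      using True by (intro card_Suc_Diff1) (simp_all add: p_def)
    then have "(T - {p}, a + single p 1) \<notin> cells (box n) i s"
      using Ta True by (auto simp: pre_cells_def cells_def)
    then have "f (T - {p}, a + single p 1) = 0"
      using assms by (simp add: supported_def)
    then show ?thesis
      unfolding contraction_def prod.case Let_def p_def[symmetric] by simp
  next
    case False
    then show ?thesis
      unfolding contraction_def prod.case Let_def by (intro if_not_P) blast
  qed
  then show ?thesis
    by (auto simp: supported_def)
qed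

text \<open>
  By the homotopy, a cycle that vanishes at all inactive cells is a boundary, while the inactive
  cells themselves are cycles and receive nothing. So the inactive cells form a basis of the
  homology.
\<close>

lemma dim_koszul_cycles_box:
  fixes n :: "'p::finite \<Rightarrow> enat"
  shows "fun_vs.dim (koszul_cycles (box n) i s :: ('p, 'k::field) chain set) =
    fun_vs.dim (koszul_boundaries (box n) i s :: ('p, 'k) chain set) + card (inactive_cells n i s)"
proof -
  interpret vector_space_pair "fun_scale :: 'k \<Rightarrow> ('p, 'k) chain \<Rightarrow> _" "fun_scale :: 'k \<Rightarrow> ('p, 'k) chain \<Rightarrow> _" ..
  define \<pi> where "\<pi> = (\<lambda>(f :: ('p, 'k) chain) x. if x \<in> inactive_cells n i s then f x else 0)"
  have lin: "Vector_Spaces.linear fun_scale fun_scale \<pi>"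
    unfolding \<pi>_def by (rule linear_restrict)
  have fin: "finite (inactive_cells n i s)"
    by (rule finite_subset[OF _ finite_cells[of "box n" i s]]) (auto simp: inactive_cells_def)
  have sub: "supported (inactive_cells n i s) \<subseteq> (koszul_cycles (box n) i s :: ('p, 'k) chain set)"
  proof
    fix f :: "('p, 'k) chain" assume f: "f \<in> supported (inactive_cells n i s)"
    then have "f \<in> supported (cells (box n) i s)"
      by (auto simp: supported_def inactive_cells_def)
    with koszul_diff_supported_inactive[OF f] show "f \<in> koszul_cycles (box n) i s"
      by (simp add: koszul_cycles_def)
  qed
  have img: "\<pi> ` koszul_cycles (box n) i s = supported (inactive_cells n i s)"
  proof
    show "\<pi> ` koszul_cycles (box n) i s \<subseteq> supported (inactive_cells n i s)"
      by (auto simp: \<pi>_def supported_def)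
    show "supported (inactive_cells n i s) \<subseteq> \<pi> ` koszul_cycles (box n) i s"
    proof
      fix f :: "('p, 'k) chain" assume f: "f \<in> supported (inactive_cells n i s)"
      then have "f = \<pi> f"
        by (auto simp: \<pi>_def supported_def)
      with subsetD[OF sub f] show "f \<in> \<pi> ` koszul_cycles (box n) i s"
        by (rule rev_image_eqI[where f = \<pi> and x = f])
    qed
  qed
  have ker: "{f \<in> koszul_cycles (box n) i s. \<pi> f = 0} = koszul_boundaries (box n) i s"
  proof
    show "koszul_boundaries (box n) i s \<subseteq> {f \<in> koszul_cycles (box n) i s. \<pi> f = 0}"
    proof
      fix f :: "('p, 'k) chain" assume f: "f \<in> koszul_boundaries (box n) i s"
      then have "f \<in> koszul_cycles (box n) i s"
        using koszul_boundaries_subset_cycles[OF order_ideal_box] by blast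
      moreover have "f (T, a) = 0" if "(T, a) \<in> inactive_cells n i s" for T a
        using f that by (auto simp: koszul_boundaries_def inactive_cells_def koszul_diff_inactive)
      ultimately show "f \<in> {f \<in> koszul_cycles (box n) i s. \<pi> f = 0}"
        by (auto simp: \<pi>_def fun_eq_iff)
    qed
    show "{f \<in> koszul_cycles (box n) i s. \<pi> f = 0} \<subseteq> koszul_boundaries (box n) i s"
    proof
      fix f assume "f \<in> {f \<in> koszul_cycles (box n) i s. \<pi> f = 0}"
      then have sup: "f \<in> supported (cells (box n) i s)" and bd: "koszul_diff (box n) f = 0" and 0: "\<pi> f = 0"
        by (auto simp: koszul_cycles_def)
      have "f (T, a) = koszul_diff (box n) (contraction n f) (T, a)" for T a
      proof (cases "a \<in> box n")
        case box: True
        show ?thesis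
        proof (cases "active n T a = {}")
          case True
          have "f (T, a) = 0"
          proof (cases "(T, a) \<in> cells (box n) i s")
            case True
            then have "(T, a) \<in> inactive_cells n i s"
              using \<open>active n T a = {}\<close> by (simp add: inactive_cells_def)
            then show ?thesis
              using fun_cong[OF 0, of "(T, a)"] by (simp add: \<pi>_def)
          qed (use sup in \<open>simp add: supported_def\<close>)
          then show ?thesis
            using koszul_diff_inactive[OF True] by simp
        next
          case False
          have "contraction n (koszul_diff (box n) f) (T, a) = 0"
            unfolding bd by (simp add: contraction_def Let_def)
          with contraction_homotopy[OF box False, of f] show ?thesis
            by simp
        qed
      next
        case False
        then show ?thesis
          using sup by (simp add: koszul_diff_def supported_def cells_def)
      qed
      then have "f = koszul_diff (box n) (contraction n f)"
        by auto
      then show "f \<in> koszul_boundaries (box n) i s"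
        unfolding koszul_boundaries_def using contraction_supported[OF sup]
        by (rule image_eqI[where f = "koszul_diff (box n)" and x = "contraction n f"])
    qed
  qed
  show ?thesis
    using rank_nullity[OF lin subspace_koszul_cycles[of "box n" i s] koszul_cycles_subset_span
        finite_imageI[OF finite_cells]]
    unfolding img ker dim_supported[OF fin] by (simp only: add.commute)
qed

section \<open>Gluing monomial quotients\<close>

text \<open>
  The differential out of degree \<open>s\<close> only sees the monomials of degrees \<open>s\<close> and \<open>s + 1\<close>.
\<close>

lemma koszul_cycles_cong_low_degree:
  assumes Q: "\<And>a. mon_degree a \<le> Suc s \<Longrightarrow> a \<in> Q \<longleftrightarrow> a \<in> Q'"
  shows "koszul_cycles Q i s = koszul_cycles Q' i s"
proof -
  have cells: "cells Q i s = cells Q' i s"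
    using Q by (auto simp: cells_def)
  have "koszul_diff Q f (T, a) = koszul_diff Q' f (T, a)" if f: "f \<in> supported (cells Q i s)"
    for f :: "('a, 'b) chain" and T a
  proof (cases "mon_degree a \<le> Suc s")
    case True
    with Q show ?thesis
      by (simp add: koszul_diff_def)
  next
    case False
    have "f (insert p T, a - single p 1) = 0" if "0 < lookup a p" for p
    proof -
      have "(insert p T, a - single p 1) \<notin> cells Q i s"
        using Suc_mon_degree_minus_single[OF that] False by (auto simp: cells_def)
      then show ?thesis
        using f by (simp add: supported_def)
    qed
    then show ?thesis
      by (simp add: koszul_diff_def)
  qed
  then have "koszul_diff Q f = koszul_diff Q' f" if "f \<in> supported (cells Q i s)" for f :: "('a, 'b) chain"
    using that by auto
  then show ?thesis
    unfolding koszul_cycles_def cells[symmetric] by auto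
qed

text \<open>
  A differential of a restricted chain is the restriction of the differential, so a chain is a cycle
  for the union iff both restrictions are cycles. In degree \<open>s\<close> the two pieces share no monomial,
  which makes the sum direct, although they may share monomials of lower degree.
\<close>

lemma dim_koszul_cycles_Un:
  fixes Q1 Q2 :: "('p::finite \<Rightarrow>\<^sub>0 nat) set"
  assumes Q1: "order_ideal Q1" and Q2: "order_ideal Q2"
    and disj: "\<And>a. a \<in> Q1 \<Longrightarrow> a \<in> Q2 \<Longrightarrow> mon_degree a < s"
  shows "fun_vs.dim (koszul_cycles (Q1 \<union> Q2) i s :: ('p, 'k::field) chain set) =
    fun_vs.dim (koszul_cycles Q1 i s :: ('p, 'k) chain set) +
    fun_vs.dim (koszul_cycles Q2 i s :: ('p, 'k) chain set)"
proof -
  interpret vector_space_pair "fun_scale :: 'k \<Rightarrow> ('p, 'k) chain \<Rightarrow> _" "fun_scale :: 'k \<Rightarrow> ('p, 'k) chain \<Rightarrow> _" ..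
  define \<rho> where "\<rho> Q = (\<lambda>(f :: ('p, 'k) chain) x. if x \<in> UNIV \<times> Q then f x else 0)" for Q :: "('p \<Rightarrow>\<^sub>0 nat) set"
  have lin: "Vector_Spaces.linear fun_scale fun_scale (\<rho> Q)" for Q
    unfolding \<rho>_def by (rule linear_restrict)
  have restrict: "koszul_diff Q (\<rho> Q f) (T, a) = (if a \<in> Q then koszul_diff Q' f (T, a) else 0)"
    if "order_ideal Q" "Q \<subseteq> Q'" for Q Q' f T a
  proof (cases "a \<in> Q")
    case True
    then have "a - single p 1 \<in> Q" for p
      using that(1) by (simp add: order_ideal_def)
    with True that(2) show ?thesis
      by (auto simp: koszul_diff_def \<rho>_def)
  qed (simp add: koszul_diff_def)
  note r1 = restrict[OF Q1 Un_upper1[of Q1 Q2]] and r2 = restrict[OF Q2 Un_upper2[of Q2 Q1]]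
  have diff_iff: "koszul_diff (Q1 \<union> Q2) f = 0 \<longleftrightarrow> koszul_diff Q1 (\<rho> Q1 f) = 0 \<and> koszul_diff Q2 (\<rho> Q2 f) = 0"
    (is "?l \<longleftrightarrow> ?r") for f
  proof
    assume ?l
    then have "koszul_diff (Q1 \<union> Q2) f (T, a) = 0" for T a
      by simp
    then show ?r
      by (auto simp: fun_eq_iff r1 r2)
  next
    assume ?r
    then have "koszul_diff Q1 (\<rho> Q1 f) (T, a) = 0" "koszul_diff Q2 (\<rho> Q2 f) (T, a) = 0" for T a
      by simp_all
    then have "koszul_diff (Q1 \<union> Q2) f (T, a) = 0" if "a \<in> Q1 \<union> Q2" for T a
      using that by (metis Un_iff r1 r2)
    moreover have "koszul_diff (Q1 \<union> Q2) f (T, a) = 0" if "a \<notin> Q1 \<union> Q2" for T a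
      using that by (simp add: koszul_diff_def)
    ultimately show ?l
      by (auto simp: fun_eq_iff)
  qed
  have zero: "koszul_diff Q 0 = (0 :: ('p, 'k) chain)" for Q :: "('p \<Rightarrow>\<^sub>0 nat) set"
    by (auto simp: koszul_diff_def fun_eq_iff)
  have sup1: "\<rho> Q1 f = f" "\<rho> Q2 f = 0" if "f \<in> supported (cells Q1 i s)" for f
    using that disj by (fastforce simp: \<rho>_def supported_def cells_def)+
  have sup2: "\<rho> Q2 f = f" "\<rho> Q1 f = 0" if "f \<in> supported (cells Q2 i s)" for f
    using that disj by (fastforce simp: \<rho>_def supported_def cells_def)+
  have cells_Un: "supported (cells Q i s) \<subseteq> (supported (cells (Q1 \<union> Q2) i s) :: ('p, 'k) chain set)"
    if "Q \<subseteq> Q1 \<union> Q2" for Q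
    using that by (auto simp: supported_def cells_def)
  have img: "\<rho> Q1 ` koszul_cycles (Q1 \<union> Q2) i s = koszul_cycles Q1 i s"
  proof
    show "\<rho> Q1 ` koszul_cycles (Q1 \<union> Q2) i s \<subseteq> koszul_cycles Q1 i s"
    proof (rule image_subsetI)
      fix f :: "('p, 'k) chain" assume f: "f \<in> koszul_cycles (Q1 \<union> Q2) i s"
      then have "\<rho> Q1 f \<in> supported (cells Q1 i s)"
        by (auto simp: koszul_cycles_def \<rho>_def supported_def cells_def)
      moreover have "koszul_diff Q1 (\<rho> Q1 f) = 0"
        using f by (simp only: koszul_cycles_def mem_Collect_eq diff_iff)
      ultimately show "\<rho> Q1 f \<in> koszul_cycles Q1 i s"
        unfolding koszul_cycles_def by blast
    qed
    show "koszul_cycles Q1 i s \<subseteq> \<rho> Q1 ` koszul_cycles (Q1 \<union> Q2) i s"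
    proof
      fix f :: "('p, 'k) chain" assume f: "f \<in> koszul_cycles Q1 i s"
      then have "f \<in> supported (cells Q1 i s)" "koszul_diff Q1 f = 0"
        by (simp_all add: koszul_cycles_def)
      then have "f \<in> koszul_cycles (Q1 \<union> Q2) i s" "f = \<rho> Q1 f"
        using cells_Un[of Q1] unfolding koszul_cycles_def mem_Collect_eq diff_iff
        by (auto simp: sup1 zero)
      then show "f \<in> \<rho> Q1 ` koszul_cycles (Q1 \<union> Q2) i s"
        by (rule rev_image_eqI[where f = "\<rho> Q1" and x = f])
    qed
  qed
  have ker: "{f \<in> koszul_cycles (Q1 \<union> Q2) i s. \<rho> Q1 f = 0} = koszul_cycles Q2 i s"
  proof
    show "koszul_cycles Q2 i s \<subseteq> {f \<in> koszul_cycles (Q1 \<union> Q2) i s. \<rho> Q1 f = 0}"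
    proof
      fix f :: "('p, 'k) chain" assume f: "f \<in> koszul_cycles Q2 i s"
      then have "f \<in> supported (cells Q2 i s)" "koszul_diff Q2 f = 0"
        by (simp_all add: koszul_cycles_def)
      then show "f \<in> {f \<in> koszul_cycles (Q1 \<union> Q2) i s. \<rho> Q1 f = 0}"
        using cells_Un[of Q2] unfolding koszul_cycles_def mem_Collect_eq diff_iff
        by (auto simp: sup2 zero)
    qed
    show "{f \<in> koszul_cycles (Q1 \<union> Q2) i s. \<rho> Q1 f = 0} \<subseteq> koszul_cycles Q2 i s"
    proof
      fix f :: "('p, 'k) chain" assume f: "f \<in> {f \<in> koszul_cycles (Q1 \<union> Q2) i s. \<rho> Q1 f = 0}"
      then have sup: "f \<in> supported (cells (Q1 \<union> Q2) i s)" and 0: "\<rho> Q1 f = 0"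
        and bd: "koszul_diff Q2 (\<rho> Q2 f) = 0"
        by (simp_all only: koszul_cycles_def mem_Collect_eq diff_iff)
      have "f (T, a) = 0" if "(T, a) \<notin> cells Q2 i s" for T a
        using that sup fun_cong[OF 0, of "(T, a)"]
        by (auto simp: supported_def cells_def \<rho>_def split: if_splits)
      then have "f \<in> supported (cells Q2 i s)"
        by (auto simp: supported_def)
      then show "f \<in> koszul_cycles Q2 i s"
        using bd by (simp add: koszul_cycles_def sup2)
    qed
  qed
  show ?thesis
    using rank_nullity[OF lin[of Q1] subspace_koszul_cycles[of "Q1 \<union> Q2" i s] koszul_cycles_subset_span
        finite_imageI[OF finite_cells]]
    unfolding img ker .
qed

section \<open>The Koszul resolution\<close>

text \<open>
  The basis elements \<open>e\<^sub>T\<close> with \<open>T\<close> of size \<open>i\<close> have to be numbered; any numbering will do.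
\<close>

definition subset_enum :: "nat \<Rightarrow> nat \<Rightarrow> 'p::finite set" where
  "subset_enum i = (SOME e. bij_betw e {..<CARD('p) choose i} {T. card T = i})"

definition subset_index :: "nat \<Rightarrow> 'p::finite set \<Rightarrow> nat" where
  "subset_index i = inv_into {..<CARD('p) choose i} (subset_enum i)"

lemma card_subsets_of_card: "card {T :: 'p::finite set. card T = i} = CARD('p) choose i"
  using n_subsets[of "UNIV :: 'p set" i] by simp

lemma bij_betw_subset_enum:
  "bij_betw (subset_enum i) {..<CARD('p) choose i} {T :: 'p::finite set. card T = i}"
proof -
  have "\<exists>e. bij_betw e {..<CARD('p) choose i} {T :: 'p set. card T = i}"
    using ex_bij_betw_nat_finite[of "{T :: 'p set. card T = i}"]
    by (simp add: card_subsets_of_card atLeast0LessThan)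
  then show ?thesis
    unfolding subset_enum_def by (rule someI_ex)
qed

lemma card_subset_enum: "b < CARD('p::finite) choose i \<Longrightarrow> card (subset_enum i b :: 'p set) = i"
  using bij_betwE[OF bij_betw_subset_enum[where ?'p = 'p, of i]] by simp

lemma subset_index_enum:
  "b < CARD('p::finite) choose i \<Longrightarrow> subset_index i (subset_enum i b :: 'p set) = b"
  unfolding subset_index_def by (rule bij_betw_inv_into_left[OF bij_betw_subset_enum]) simp

lemma subset_enum_index: "card (T :: 'p::finite set) = i \<Longrightarrow> subset_enum i (subset_index i T) = T"
  unfolding subset_index_def by (rule bij_betw_inv_into_right[OF bij_betw_subset_enum]) simp

lemma subset_index_less: "card (T :: 'p::finite set) = i \<Longrightarrow> subset_index i T < CARD('p) choose i"
  using bij_betwE[OF bij_betw_inv_into[OF bij_betw_subset_enum[where ?'p = 'p, of i]]]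
  by (simp add: subset_index_def)

definition koszul_complex :: "('p::finite, 'k::field) augmented_complex" where
  "koszul_complex = \<lparr>rank = \<lambda>i. CARD('p) choose i, shift = \<lambda>i b. int i,
     diff = \<lambda>i c b. \<Sum>p\<in>- subset_enum i c.
       if subset_enum (Suc i) b = insert p (subset_enum i c)
       then const (koszul_sign p (subset_enum i c)) * var p else 0,
     aug = \<lambda>b. 1\<rparr>"

lemma koszul_complex_simps [simp]:
  "rank (koszul_complex :: ('p::finite, 'k::field) augmented_complex) i = CARD('p) choose i"
  "shift (koszul_complex :: ('p::finite, 'k::field) augmented_complex) i b = int i"
  "aug (koszul_complex :: ('p::finite, 'k::field) augmented_complex) b = 1"
  by (simp_all add: koszul_complex_def)

lemma lookup_var_mult: "lookup (var p * f) a = (if 0 < lookup a p then lookup f (a - single p 1) else 0)"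
proof -
  have "lookup (var p * f) a = (\<Sum>q. lookup f q when a = single p 1 + q)"
    unfolding var_def lookup_mult lookup_single when_mult mult_1 by (rule Sum_any_when_equal')
  also have "\<dots> = (if 0 < lookup a p then lookup f (a - single p 1) else 0)"
  proof (cases "0 < lookup a p")
    case True
    have "a = single p 1 + q \<longleftrightarrow> q = a - single p 1" for q
      using minus_single_add[OF True] by (metis add.commute add_diff_cancel_left')
    then show ?thesis
      using True by simp
  next
    case False
    have "a \<noteq> single p 1 + q" for q
    proof
      assume "a = single p 1 + q"
      then have "lookup a p = 1 + lookup q p"
        by (simp add: lookup_add)
      with False show False
        by simp
    qed
    with False show ?thesis
      by simp
  qed
  finally show ?thesis .
qed

text \<open>The class of a vector modulo the ideal of the monomials outside \<open>Q\<close>, as a chain.\<close>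

definition vec_chain :: "('p::finite \<Rightarrow>\<^sub>0 nat) set \<Rightarrow> nat \<Rightarrow> (nat \<Rightarrow> ('p, 'k::field) mpoly) \<Rightarrow> ('p, 'k) chain" where
  "vec_chain Q i v = (\<lambda>(T, a). if card T = i \<and> a \<in> Q then lookup (v (subset_index i T)) a else 0)"

lemma boundary_koszul:
  fixes v :: "nat \<Rightarrow> ('p::finite, 'k::field) mpoly"
  assumes "card T = i"
  shows "boundary koszul_complex (Suc i) v (subset_index i T) =
    (\<Sum>p\<in>- T. const (koszul_sign p T) * (var p * v (subset_index (Suc i) (insert p T))))"
proof -
  let ?m = "CARD('p) choose Suc i"
  have "boundary koszul_complex (Suc i) v (subset_index i T) =
      (\<Sum>b<?m. (\<Sum>p\<in>- T. if subset_enum (Suc i) b = insert p T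
        then const (koszul_sign p T) * var p else 0) * v b)"
    using subset_index_less[OF assms] by (simp add: koszul_complex_def subset_enum_index[OF assms] cong: if_cong)
  also have "\<dots> = (\<Sum>p\<in>- T. \<Sum>b<?m. if subset_enum (Suc i) b = insert p T
        then const (koszul_sign p T) * (var p * v b) else 0)"
    unfolding sum_distrib_right by (subst sum.swap) (intro sum.cong refl, simp add: mult.assoc)
  also have "\<dots> = (\<Sum>p\<in>- T. const (koszul_sign p T) * (var p * v (subset_index (Suc i) (insert p T))))"
  proof (intro sum.cong refl)
    fix p assume "p \<in> - T"
    then have card: "card (insert p T) = Suc i"
      using assms by simp
    have "subset_enum (Suc i) b = insert p T \<longleftrightarrow> b = subset_index (Suc i) (insert p T)" if "b < ?m" for b
      using subset_index_enum[where ?'p = 'p, OF that] subset_enum_index[OF card] by metis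
    then have "(\<Sum>b<?m. if subset_enum (Suc i) b = insert p T
        then const (koszul_sign p T) * (var p * v b) else 0) =
      (\<Sum>b<?m. if b = subset_index (Suc i) (insert p T)
        then const (koszul_sign p T) * (var p * v b) else 0)"
      by (intro sum.cong refl) simp
    also have "\<dots> = const (koszul_sign p T) * (var p * v (subset_index (Suc i) (insert p T)))"
      using subset_index_less[OF card] by simp
    finally show "(\<Sum>b<?m. if subset_enum (Suc i) b = insert p T
        then const (koszul_sign p T) * (var p * v b) else 0) =
      const (koszul_sign p T) * (var p * v (subset_index (Suc i) (insert p T)))" .
  qed
  finally show ?thesis .
qed

text \<open>
  This translates the matrices of the complex into the differential of chains.
\<close>

lemma vec_chain_boundary:
  fixes v :: "nat \<Rightarrow> ('p::finite, 'k::field) mpoly"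
  assumes Q: "order_ideal Q"
  shows "vec_chain Q i (boundary koszul_complex (Suc i) v) = koszul_diff Q (vec_chain Q (Suc i) v)"
proof (rule ext, clarify)
  fix T and a :: "'p \<Rightarrow>\<^sub>0 nat"
  show "vec_chain Q i (boundary koszul_complex (Suc i) v) (T, a) = koszul_diff Q (vec_chain Q (Suc i) v) (T, a)"
  proof (cases "a \<in> Q")
    case a: True
    then have aQ: "a - single p 1 \<in> Q" for p
      using Q by (simp add: order_ideal_def)
    show ?thesis
    proof (cases "card T = i")
      case True
      have "vec_chain Q i (boundary koszul_complex (Suc i) v) (T, a) =
          (\<Sum>p\<in>- T. koszul_sign p T * (if 0 < lookup a p
            then lookup (v (subset_index (Suc i) (insert p T))) (a - single p 1) else 0))"
        using a True unfolding vec_chain_def prod.case boundary_koszul[OF True]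
        by (simp only: lookup_sum lookup_const_mult lookup_var_mult conj_absorb if_True simp_thms)
      also have "\<dots> = (\<Sum>p | p \<notin> T \<and> 0 < lookup a p.
          koszul_sign p T * lookup (v (subset_index (Suc i) (insert p T))) (a - single p 1))"
        by (rule sum.mono_neutral_cong_right) auto
      also have "\<dots> = koszul_diff Q (vec_chain Q (Suc i) v) (T, a)"
        using a True aQ unfolding koszul_diff_def vec_chain_def by (auto intro!: sum.cong)
      finally show ?thesis .
    next
      case False
      then show ?thesis
        by (auto simp: vec_chain_def koszul_diff_def intro!: sum.neutral)
    qed
  qed (simp add: vec_chain_def koszul_diff_def)
qed

lemma vec_chain_UNIV_inject:
  fixes v w :: "nat \<Rightarrow> ('p::finite, 'k::field) mpoly"
  assumes "v \<in> free_module koszul_complex i" "w \<in> free_module koszul_complex i"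
    and eq: "vec_chain UNIV i v = vec_chain UNIV i w"
  shows "v = w"
proof (rule ext, rule poly_mapping_eqI)
  fix b a
  show "lookup (v b) a = lookup (w b) a"
  proof (cases "b < CARD('p) choose i")
    case True
    then show ?thesis
      using fun_cong[OF eq, of "(subset_enum i b, a)"]
      by (simp add: vec_chain_def card_subset_enum subset_index_enum)
  next
    case False
    then show ?thesis
      using assms(1,2) by (simp add: free_module_def)
  qed
qed

text \<open>
  The third conclusion bounds the support of the vector, from which its degree is read off.
\<close>

lemma vec_chain_exists:
  fixes g :: "('p::finite, 'k::field) chain"
  assumes fin: "\<And>T. finite {a. g (T, a) \<noteq> 0}" and sup: "\<And>T a. g (T, a) \<noteq> 0 \<Longrightarrow> card T = i \<and> a \<in> Q"
  obtains v where "v \<in> free_module koszul_complex i" "vec_chain Q i v = g"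
    "\<And>b a. a \<in> keys (v b) \<Longrightarrow> b < CARD('p) choose i \<and> g (subset_enum i b, a) \<noteq> 0"
proof -
  define v :: "nat \<Rightarrow> ('p, 'k) mpoly" where
    "v b = (if b < CARD('p) choose i then Abs_poly_mapping (\<lambda>a. g (subset_enum i b, a)) else 0)" for b
  have v: "lookup (v b) a = (if b < CARD('p) choose i then g (subset_enum i b, a) else 0)" for b a
    using fin[of "subset_enum i b"] by (simp add: v_def)
  show thesis
  proof
    show "v \<in> free_module koszul_complex i"
      by (simp add: free_module_def v_def)
    show "vec_chain Q i v = g"
    proof (rule ext, clarify)
      fix T a
      show "vec_chain Q i v (T, a) = g (T, a)"
        using sup[of T a] by (auto simp: vec_chain_def v subset_index_less subset_enum_index)
    qed
    show "b < CARD('p) choose i \<and> g (subset_enum i b, a) \<noteq> 0" if "a \<in> keys (v b)" for b a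
      using that by (simp add: in_keys_iff v split: if_splits)
  qed
qed

lemma box_infinity: "box (\<lambda>p. \<infinity>) = UNIV"
  by (simp add: box_def)

lemma order_ideal_UNIV: "order_ideal UNIV"
  by (simp add: order_ideal_def)

lemma active_infinity: "active (\<lambda>p. \<infinity>) T a = {} \<longleftrightarrow> T = {} \<and> a = 0"
  by (auto simp: active_def poly_mapping_eq_iff fun_eq_iff split: if_splits)

lemma finite_contraction_support:
  fixes g :: "('p::finite, 'k::field) chain"
  assumes "\<And>T. finite {a. g (T, a) \<noteq> 0}"
  shows "finite {a. contraction n g (T, a) \<noteq> 0}"
proof (rule finite_subset)
  show "{a. contraction n g (T, a) \<noteq> 0} \<subseteq> (\<Union>p. (\<lambda>a. a - single p 1) ` {a. g (T - {p}, a) \<noteq> 0})"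
  proof
    fix a assume "a \<in> {a. contraction n g (T, a) \<noteq> 0}"
    then obtain p where "g (T - {p}, a + single p 1) \<noteq> 0"
      by (auto simp: contraction_def Let_def split: if_splits)
    moreover have "a = a + single p 1 - single p 1"
      by simp
    ultimately show "a \<in> (\<Union>p. (\<lambda>a. a - single p 1) ` {a. g (T - {p}, a) \<noteq> 0})"
      by blast
  qed
qed (use assms in auto)

lemma finite_vec_chain_support: "finite {a. vec_chain Q i v (T, a) \<noteq> 0}"
  by (rule finite_subset[of _ "keys (v (subset_index i T))"])
    (auto simp: vec_chain_def in_keys_iff split: if_splits)

text \<open>
  The contraction for the unbounded box gives the preimage. It applies to every basis element except
  the unit \<open>(\<emptyset>, 0)\<close>, where the coefficient of the cycle is zero: by the augmentation if
  \<open>i = 0\<close>, and because the exterior degree is wrong otherwise.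
\<close>

lemma koszul_exact:
  fixes v :: "nat \<Rightarrow> ('p::finite, 'k::field) mpoly"
  assumes v: "v \<in> free_module koszul_complex i"
    and cyc: "if i = 0 then constant_coeff (v 0) = 0 else boundary koszul_complex i v = 0"
  shows "v \<in> boundary koszul_complex (Suc i) ` free_module koszul_complex (Suc i)"
proof -
  define g where "g = vec_chain UNIV i v"
  have g_card: "card T = i" if "g (T, a) \<noteq> 0" for T a
    using that by (auto simp: g_def vec_chain_def split: if_splits)
  have dg: "koszul_diff UNIV g = 0"
  proof (cases i)
    case 0
    have "g (insert p T, a) = 0" for p T a
      using g_card[of "insert p T" a] 0 by auto
    then show ?thesis
      by (auto simp: koszul_diff_def fun_eq_iff)
  next
    case (Suc n)
    then have "koszul_diff UNIV g = vec_chain UNIV n (boundary koszul_complex i v)"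
      by (simp only: g_def vec_chain_boundary[OF order_ideal_UNIV])
    also have "\<dots> = 0"
      using cyc Suc by (auto simp: vec_chain_def fun_eq_iff simp del: boundary.simps)
    finally show ?thesis .
  qed
  have fin: "finite {a. contraction (\<lambda>p. \<infinity>) g (T, a) \<noteq> 0}" for T
    unfolding g_def by (intro finite_contraction_support finite_vec_chain_support)
  have sup: "card T = Suc i \<and> a \<in> UNIV" if "contraction (\<lambda>p. \<infinity>) g (T, a) \<noteq> 0" for T a
  proof -
    obtain p where "p \<in> T" "g (T - {p}, a + single p 1) \<noteq> 0"
      using \<open>contraction (\<lambda>p. \<infinity>) g (T, a) \<noteq> 0\<close> by (auto simp: contraction_def Let_def split: if_splits)
    then show ?thesis
      using g_card card_Suc_Diff1[of T p] by fastforce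
  qed
  obtain w where w: "w \<in> free_module koszul_complex (Suc i)"
    "vec_chain UNIV (Suc i) w = contraction (\<lambda>p. \<infinity>) g"
    using vec_chain_exists[OF fin sup] by metis
  have "vec_chain UNIV i (boundary koszul_complex (Suc i) w) = g"
  proof (rule ext, clarify)
    fix T a
    show "vec_chain UNIV i (boundary koszul_complex (Suc i) w) (T, a) = g (T, a)"
    proof (cases "active (\<lambda>p. \<infinity>) T a = {}")
      case False
      have "contraction (\<lambda>p. \<infinity>) (koszul_diff UNIV g) (T, a) = 0"
        unfolding dg by (simp add: contraction_def Let_def)
      with contraction_homotopy[of a "\<lambda>p. \<infinity>" T g] False show ?thesis
        by (simp add: vec_chain_boundary[OF order_ideal_UNIV] w(2) box_infinity del: boundary.simps)
    next
      case True
      then have Ta: "T = {}" "a = 0"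
        by (simp_all add: active_infinity)
      have "g (T, a) = 0"
      proof (cases "i = 0")
        case True
        have "subset_index 0 ({} :: 'p set) = 0"
          using subset_index_less[of "{} :: 'p set" 0] by simp
        with True cyc show ?thesis
          by (simp add: g_def vec_chain_def Ta constant_coeff_def)
      next
        case False
        then show ?thesis
          using g_card[of T a] Ta by auto
      qed
      with koszul_diff_inactive[OF True] show ?thesis
        by (simp only: vec_chain_boundary[OF order_ideal_UNIV])
    qed
  qed
  then have "v = boundary koszul_complex (Suc i) w"
    using v by (intro vec_chain_UNIV_inject[of v i]) (auto simp: g_def free_module_def)
  with w(1) show ?thesis
    by blast
qed

theorem koszul_resolution: "graded_free_resolution (koszul_complex :: ('p::finite, 'k::field) augmented_complex)"
proof -
  let ?K = "koszul_complex :: ('p, 'k) augmented_complex"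
  have diff: "diff ?K i c b \<in> homogeneous (shift ?K (Suc i) b - shift ?K i c)" for i c b
    using homogeneous_mult[OF homogeneous_const homogeneous_var]
    by (auto simp: koszul_complex_def intro!: homogeneous_sum)
  have aug: "augmentation ?K v = constant_coeff (v 0)" for v
    by (simp add: augmentation_def)
  have square: "boundary ?K i (boundary ?K (Suc i) w) = 0" for i w
  proof (cases i)
    case (Suc n)
    have "vec_chain UNIV n (boundary ?K (Suc n) (boundary ?K (Suc (Suc n)) w)) = vec_chain UNIV n 0"
      unfolding vec_chain_boundary[OF order_ideal_UNIV] koszul_diff_square[OF order_ideal_UNIV]
      by (auto simp: vec_chain_def fun_eq_iff)
    then show ?thesis
      unfolding Suc by (intro vec_chain_UNIV_inject[of _ n]) (auto simp: free_module_def)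
  qed (simp add: zero_fun_def)
  have aug_bd: "constant_coeff (boundary ?K 1 w 0) = 0" for w
  proof -
    have "subset_index 0 ({} :: 'p set) = 0"
      using subset_index_less[of "{} :: 'p set" 0] by simp
    then have "constant_coeff (boundary ?K 1 w 0) = vec_chain UNIV 0 (boundary ?K (Suc 0) w) ({}, 0)"
      by (simp add: vec_chain_def constant_coeff_def del: boundary.simps)
    also have "\<dots> = 0"
      unfolding vec_chain_boundary[OF order_ideal_UNIV] by (simp add: koszul_diff_def)
    finally show ?thesis .
  qed
  have bd_free: "boundary ?K (Suc i) w \<in> free_module ?K i" for i w
    by (simp add: free_module_def)
  have "augmentation ?K ` free_module ?K 0 = UNIV"
  proof -
    have "x \<in> augmentation ?K ` free_module ?K 0" for x
      by (rule image_eqI[of _ _ "\<lambda>b. if b = 0 then const x else 0"])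
        (simp_all add: aug free_module_def constant_coeff_def const_def)
    then show ?thesis
      by blast
  qed
  moreover have "{v \<in> free_module ?K 0. augmentation ?K v = 0} = boundary ?K 1 ` free_module ?K 1"
  proof
    show "{v \<in> free_module ?K 0. augmentation ?K v = 0} \<subseteq> boundary ?K 1 ` free_module ?K 1"
      using koszul_exact[of _ 0] by (auto simp: aug simp del: boundary.simps)
    show "boundary ?K 1 ` free_module ?K 1 \<subseteq> {v \<in> free_module ?K 0. augmentation ?K v = 0}"
      using aug_bd bd_free[of 0] by (auto simp: aug simp del: boundary.simps)
  qed
  moreover have "{v \<in> free_module ?K i. boundary ?K i v = (\<lambda>c. 0)} = boundary ?K (Suc i) ` free_module ?K (Suc i)"
    if "1 \<le> i" for i
  proof
    show "{v \<in> free_module ?K i. boundary ?K i v = (\<lambda>c. 0)} \<subseteq> boundary ?K (Suc i) ` free_module ?K (Suc i)"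
      using koszul_exact[of _ i] that by (auto simp: zero_fun_def simp del: boundary.simps)
    show "boundary ?K (Suc i) ` free_module ?K (Suc i) \<subseteq> {v \<in> free_module ?K i. boundary ?K i v = (\<lambda>c. 0)}"
      using square bd_free[of i] by (auto simp: zero_fun_def simp del: boundary.simps)
  qed
  ultimately show ?thesis
    using diff unfolding graded_free_resolution_def by simp
qed

section \<open>Tor of a monomial quotient\<close>

text \<open>
  For \<open>Q\<close> closed under division, this is the ideal generated by the monomials outside \<open>Q\<close>.
\<close>

definition monomial_ideal :: "('p \<Rightarrow>\<^sub>0 nat) set \<Rightarrow> ('p, 'k::field) mpoly set" where
  "monomial_ideal Q = {f. \<forall>a\<in>keys f. a \<notin> Q}"

lemma order_ideal_minus: 
  fixes Q :: "('p::finite \<Rightarrow>\<^sub>0 nat) set"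
  assumes Q: "order_ideal Q"
  shows "a + b \<in> Q \<Longrightarrow> a \<in> Q"
proof (induction "mon_degree b" arbitrary: b)
  case 0
  then have "b = 0"
    by (intro poly_mapping_eqI) (simp add: mon_degree_def)
  with 0 show ?case
    by simp
next
  case (Suc n)
  then have "mon_degree b \<noteq> 0"
    by simp
  then obtain p where p: "0 < lookup b p"
    by (auto simp: mon_degree_def)
  have "a + b - single p 1 \<in> Q"
    using Q Suc.prems by (simp add: order_ideal_def)
  moreover have "a + b - single p 1 = a + (b - single p 1)"
    using p by (intro poly_mapping_eqI) (auto simp add: lookup_add lookup_minus lookup_single when_def)
  moreover have "n = mon_degree (b - single p 1)"
    using Suc_mon_degree_minus_single[OF p] Suc.hyps(2) by simp
  ultimately show ?case
    using Suc.hyps(1) by metis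
qed

lemma is_ideal_monomial_ideal:
  fixes Q :: "('p::finite \<Rightarrow>\<^sub>0 nat) set"
  assumes Q: "order_ideal Q"
  shows "is_ideal (monomial_ideal Q :: ('p, 'k::field) mpoly set)"
  unfolding is_ideal_def monomial_ideal_def
proof (intro conjI ballI allI; clarify)
  fix f g :: "('p, 'k) mpoly" and a
  show "a \<in> keys (f + g) \<Longrightarrow> \<forall>a\<in>keys f. a \<notin> Q \<Longrightarrow> \<forall>a\<in>keys g. a \<notin> Q \<Longrightarrow> a \<in> Q \<Longrightarrow> False"
    using keys_add[of f g] by blast
  assume f: "\<forall>a\<in>keys f. a \<notin> Q" and "a \<in> keys (g * f)" "a \<in> Q"
  then obtain b c where "a = c + b" "c \<in> keys f"
    using keys_mult[of g f] by (auto simp: add.commute)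
  then show False
    using order_ideal_minus[OF Q] f \<open>a \<in> Q\<close> by blast
qed simp

lemma vec_chain_eq_0_iff:
  fixes v :: "nat \<Rightarrow> ('p::finite, 'k::field) mpoly"
  assumes v: "v \<in> free_module koszul_complex i"
  shows "vec_chain Q i v = 0 \<longleftrightarrow> (\<forall>b. v b \<in> monomial_ideal Q)"
proof
  assume 0: "vec_chain Q i v = 0"
  show "\<forall>b. v b \<in> monomial_ideal Q"
  proof
    fix b
    show "v b \<in> monomial_ideal Q"
    proof (cases "b < CARD('p) choose i")
      case True
      have "lookup (v b) a = 0" if "a \<in> Q" for a
        using fun_cong[OF 0, of "(subset_enum i b, a)"] that True
        by (simp add: vec_chain_def card_subset_enum subset_index_enum)
      then show ?thesis
        by (auto simp: monomial_ideal_def in_keys_iff)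
    next
      case False
      with v show ?thesis
        by (simp add: free_module_def monomial_ideal_def)
    qed
  qed
next
  assume "\<forall>b. v b \<in> monomial_ideal Q"
  then show "vec_chain Q i v = 0"
    by (fastforce simp: vec_chain_def monomial_ideal_def in_keys_iff fun_eq_iff)
qed

lemma vec_chain_add: "vec_chain Q i (u + v) = vec_chain Q i u + vec_chain Q i v"
  by (auto simp: vec_chain_def lookup_add fun_eq_iff)

lemma vec_chain_diff: "vec_chain Q i (u - v) = vec_chain Q i u - vec_chain Q i v"
  by (auto simp: vec_chain_def lookup_minus fun_eq_iff)

lemma linear_vec_chain: "Vector_Spaces.linear vec_scale fun_scale (vec_chain Q i)"
  unfolding Vector_Spaces.linear_iff
  by (intro conjI vector_space_vec_scale vector_space_fun_scale allI vec_chain_add)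
    (auto simp: vec_chain_def vec_scale_def fun_scale_def fun_eq_iff)

lemma vec_chain_supported:
  fixes v :: "nat \<Rightarrow> ('p::finite, 'k::field) mpoly"
  assumes v: "v \<in> free_module_deg koszul_complex i (int i + int s)"
  shows "vec_chain Q i v \<in> supported (cells Q i s)"
proof -
  have "mon_degree a = s" if "vec_chain Q i v (T, a) \<noteq> 0" for T a
  proof -
    have T: "card T = i" and "a \<in> keys (v (subset_index i T))"
      using that by (auto simp: vec_chain_def in_keys_iff split: if_splits)
    then have "int (mon_degree a) = int s"
      using v subset_index_less[OF T] by (simp add: free_module_deg_def homogeneous_def)
    then show ?thesis
      by simp
  qed
  then have "vec_chain Q i v (T, a) = 0" if "(T, a) \<notin> cells Q i s" for T a
    using that by (fastforce simp: cells_def vec_chain_def)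
  then show ?thesis
    by (auto simp: supported_def)
qed

lemma vec_chain_lift:
  fixes g :: "('p::finite, 'k::field) chain"
  assumes g: "g \<in> supported (cells Q i s)"
  obtains v where "v \<in> free_module_deg koszul_complex i (int i + int s)" "vec_chain Q i v = g"
proof -
  have sup: "card T = i \<and> a \<in> Q" "mon_degree a = s" if "g (T, a) \<noteq> 0" for T a
    using g that by (auto simp: supported_def cells_def)
  have fin: "finite {a. g (T, a) \<noteq> 0}" for T
    by (rule finite_subset[OF _ finite_mon_degree[of s]]) (use sup(2) in auto)
  obtain v where v: "v \<in> free_module koszul_complex i" "vec_chain Q i v = g"
    "\<And>b a. a \<in> keys (v b) \<Longrightarrow> b < CARD('p) choose i \<and> g (subset_enum i b, a) \<noteq> 0"
    using vec_chain_exists[OF fin sup(1)] by metis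
  have "v \<in> free_module_deg koszul_complex i (int i + int s)"
    using v(1) v(3) sup(2) by (auto simp: free_module_deg_def homogeneous_def)
  then show thesis
    using v(2) by (rule that)
qed

lemma vec_chain_supported_pre:
  fixes v :: "nat \<Rightarrow> ('p::finite, 'k::field) mpoly"
  assumes v: "v \<in> free_module_deg koszul_complex (Suc i) (int i + int s)"
  shows "vec_chain Q (Suc i) v \<in> supported (pre_cells Q i s)"
proof (cases s)
  case 0
  have "vec_chain Q (Suc i) v (T, a) = 0" for T a
  proof (rule ccontr)
    assume "vec_chain Q (Suc i) v (T, a) \<noteq> 0"
    then have T: "card T = Suc i" and "a \<in> keys (v (subset_index (Suc i) T))"
      by (auto simp: vec_chain_def in_keys_iff split: if_splits)
    then have "int (mon_degree a) = - 1"
      using v subset_index_less[OF T] 0 by (simp add: free_module_deg_def homogeneous_def)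
    then show False
      by simp
  qed
  then show ?thesis
    by (auto simp: supported_def)
next
  case (Suc t)
  then show ?thesis
    using vec_chain_supported[of v "Suc i" t] v by (simp add: pre_cells_Suc add.commute add.left_commute)
qed

lemma vec_chain_lift_pre:
  fixes g :: "('p::finite, 'k::field) chain"
  assumes g: "g \<in> supported (pre_cells Q i s)"
  obtains v where "v \<in> free_module_deg koszul_complex (Suc i) (int i + int s)" "vec_chain Q (Suc i) v = g"
proof (cases s)
  case 0
  then have "g = 0"
    using g by (auto simp: supported_def pre_cells_0 fun_eq_iff)
  then show thesis
    by (intro that[of 0] free_module_deg_0) (auto simp: vec_chain_def fun_eq_iff)
next
  case (Suc t)
  then have g': "g \<in> supported (cells Q (Suc i) t)"
    using g by (simp add: pre_cells_Suc)
  obtain v where "v \<in> free_module_deg koszul_complex (Suc i) (int (Suc i) + int t)" "vec_chain Q (Suc i) v = g"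
    by (rule vec_chain_lift[OF g'])
  moreover have "int (Suc i) + int t = int i + int s"
    using Suc by simp
  ultimately show thesis
    using that by (simp only:)
qed

text \<open>
  Forgetting the coefficients outside \<open>Q\<close> has exactly the vectors with entries in the ideal as its
  kernel. So it maps cycles modulo the ideal onto the cycles of the quotient, and a vector is a
  boundary modulo the ideal iff its image is a boundary.
\<close>

theorem tor_dim_koszul:
  fixes Q :: "('p::finite \<Rightarrow>\<^sub>0 nat) set"
  assumes Q: "order_ideal Q"
  shows "tor_dim (koszul_complex :: ('p, 'k::field) augmented_complex) (monomial_ideal Q) (Suc i) (int (Suc i) + int s) =
    fun_vs.dim (koszul_cycles Q (Suc i) s :: ('p, 'k) chain set) -
    fun_vs.dim (koszul_boundaries Q (Suc i) s :: ('p, 'k) chain set)"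
proof -
  interpret vector_space_pair "vec_scale :: 'k \<Rightarrow> (nat \<Rightarrow> ('p, 'k) mpoly) \<Rightarrow> _"
    "fun_scale :: 'k \<Rightarrow> ('p, 'k) chain \<Rightarrow> _" ..
  let ?K = "koszul_complex :: ('p, 'k) augmented_complex" and ?j = "int (Suc i) + int s"
  let ?I = "monomial_ideal Q :: ('p, 'k) mpoly set"
  let ?Z = "tor_cycles ?K ?I (Suc i) ?j" and ?B = "tor_boundaries ?K ?I (Suc i) ?j"
  let ?f = "vec_chain Q (Suc i) :: (nat \<Rightarrow> ('p, 'k) mpoly) \<Rightarrow> _"
  note F = koszul_resolution[where ?'p = 'p and ?'k = 'k]
  note I = is_ideal_monomial_ideal[OF Q, where ?'k = 'k]
  note hom = graded_hom_boundary[OF F]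
  obtain S where S: "finite S" "?Z \<subseteq> vec_vs.span S"
    by (rule finite_span_tor_cycles[OF F I])
  have cyc_iff: "v \<in> ?Z \<longleftrightarrow> v \<in> free_module_deg ?K (Suc i) ?j \<and> koszul_diff Q (?f v) = 0" for v
    unfolding tor_cycles_def vec_chain_boundary[OF Q, symmetric]
      vec_chain_eq_0_iff[OF graded_hom_in_free_module[OF hom]] by simp
  have img: "?f ` ?Z \<subseteq> koszul_cycles Q (Suc i) s"
    using vec_chain_supported[of _ "Suc i" s Q] by (auto simp only: cyc_iff koszul_cycles_def)
  have bd_img: "?f (boundary ?K (Suc (Suc i)) w) \<in> koszul_boundaries Q (Suc i) s"
    if "w \<in> free_module_deg ?K (Suc (Suc i)) ?j" for w
    unfolding vec_chain_boundary[OF Q] koszul_boundaries_def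
    by (intro imageI vec_chain_supported_pre that)
  have B: "{z \<in> ?Z. ?f z \<in> koszul_boundaries Q (Suc i) s} = ?B"
  proof
    show "?B \<subseteq> {z \<in> ?Z. ?f z \<in> koszul_boundaries Q (Suc i) s}"
    proof
      fix z assume z: "z \<in> ?B"
      then obtain w u where wu: "z = boundary ?K (Suc (Suc i)) w + u"
        "w \<in> free_module_deg ?K (Suc (Suc i)) ?j" "u \<in> free_module_deg ?K (Suc i) ?j" "\<forall>b. u b \<in> ?I"
        by (rule tor_boundariesE)
      have "?f u = 0"
        using wu(4) vec_chain_eq_0_iff[OF free_module_degD[OF wu(3)]] by blast
      then have "?f z = ?f (boundary ?K (Suc (Suc i)) w)"
        by (simp only: wu(1) vec_chain_add add_0_right)
      with bd_img[OF wu(2)] subsetD[OF tor_boundaries_subset_cycles[OF F I] z]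
      show "z \<in> {z \<in> ?Z. ?f z \<in> koszul_boundaries Q (Suc i) s}"
        by (simp only: mem_Collect_eq simp_thms)
    qed
    show "{z \<in> ?Z. ?f z \<in> koszul_boundaries Q (Suc i) s} \<subseteq> ?B"
    proof
      fix z assume "z \<in> {z \<in> ?Z. ?f z \<in> koszul_boundaries Q (Suc i) s}"
      then have z: "z \<in> free_module_deg ?K (Suc i) ?j" and "?f z \<in> koszul_boundaries Q (Suc i) s"
        by (simp_all only: cyc_iff mem_Collect_eq)
      then obtain g where g: "g \<in> supported (pre_cells Q (Suc i) s)" "?f z = koszul_diff Q g"
        unfolding koszul_boundaries_def by blast
      obtain w where w: "w \<in> free_module_deg ?K (Suc (Suc i)) ?j" "vec_chain Q (Suc (Suc i)) w = g"
        by (rule vec_chain_lift_pre[OF g(1)])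
      define u where "u = z - boundary ?K (Suc (Suc i)) w"
      have u: "u \<in> free_module_deg ?K (Suc i) ?j"
        unfolding u_def by (rule free_module_deg_diff[OF z graded_hom_in_deg[OF hom w(1)]])
      have "?f u = 0"
        by (simp only: u_def vec_chain_diff vec_chain_boundary[OF Q] w(2) g(2) diff_self)
      then have uI: "u b \<in> ?I" for b
        using vec_chain_eq_0_iff[OF free_module_degD[OF u]] by blast
      have "z = boundary ?K (Suc (Suc i)) w + u"
        by (simp only: u_def add_diff_cancel_left' diff_add_cancel add.commute[of "boundary _ _ _"])
      with tor_boundariesI[OF w(1) u uI] show "z \<in> ?B"
        by (simp only:)
    qed
  qed
  have surj: "\<exists>z\<in>?Z. z' - ?f z \<in> koszul_boundaries Q (Suc i) s" if z': "z' \<in> koszul_cycles Q (Suc i) s" for z'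
  proof -
    have sup: "z' \<in> supported (cells Q (Suc i) s)" and bd: "koszul_diff Q z' = 0"
      using z' by (simp_all add: koszul_cycles_def)
    obtain v where v: "v \<in> free_module_deg ?K (Suc i) ?j" "?f v = z'"
      by (rule vec_chain_lift[OF sup])
    have "v \<in> ?Z"
      unfolding cyc_iff v(2) using v(1) bd by blast
    moreover have "z' - ?f v \<in> koszul_boundaries Q (Suc i) s"
      unfolding v(2) diff_self by (rule fun_vs.subspace_0[OF subspace_koszul_boundaries])
    ultimately show ?thesis
      by (intro bexI[of _ v])
  qed
  show ?thesis
    unfolding tor_dim_def
    by (rule dim_subquotient_eq[OF linear_vec_chain subspace_tor_cycles[OF F I] S(2,1)
          subspace_koszul_cycles koszul_cycles_subset_span finite_imageI[OF finite_cells]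
          subspace_koszul_boundaries koszul_boundaries_subset_cycles[OF Q] img B surj])
qed

text \<open>
  The generators in homological degree \<open>i\<close> have degree \<open>i\<close>, so there is nothing below.
\<close>

lemma tor_dim_below_diagonal:
  assumes "j < int i"
  shows "tor_dim (koszul_complex :: ('p::finite, 'k::field) augmented_complex) I i j = 0"
proof -
  have "v = 0" if v: "v \<in> free_module_deg (koszul_complex :: ('p, 'k) augmented_complex) i j" for v
  proof (rule ext)
    fix b
    have "a \<notin> keys (v b)" if "b < CARD('p) choose i" for a
    proof
      assume "a \<in> keys (v b)"
      then have "int (mon_degree a) = j - int i"
        using v that by (simp add: free_module_deg_def homogeneous_def)
      with assms show False
        by simp
    qed
    then have "v b = 0" if "b < CARD('p) choose i"
      using that by (intro poly_mapping_eqI) (simp add: in_keys_iff)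
    then show "v b = 0 b"
      using free_module_degD[OF v] by (cases "b < CARD('p) choose i") (auto simp: free_module_def)
  qed
  then have "tor_cycles (koszul_complex :: ('p, 'k) augmented_complex) I i j \<subseteq> vec_vs.span {}"
    by (auto simp: tor_cycles_def)
  then have "vec_vs.dim (tor_cycles (koszul_complex :: ('p, 'k) augmented_complex) I i j) \<le>
      card ({} :: (nat \<Rightarrow> ('p, 'k) mpoly) set)"
    by (rule vec_vs.dim_le_card) simp
  then show ?thesis
    by (simp add: tor_dim_def)
qed

theorem graded_betti_koszul:
  fixes I :: "('p::finite, 'k::field) mpoly set"
  assumes "is_ideal I"
  shows "graded_betti I (Suc i) j = tor_dim koszul_complex I (Suc i) j"
  unfolding graded_betti_def
  by (rule tor_dim_independent[OF someI[of graded_free_resolution, OF koszul_resolution] koszul_resolution assms])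

section \<open>The ideal of a linear space\<close>

definition line_bound :: "'p set \<Rightarrow> 'p \<Rightarrow> enat" where
  "line_bound l p = (if p \<in> l then 1 else 0)"

definition squarefree_exponent :: "'p::finite set \<Rightarrow> 'p \<Rightarrow>\<^sub>0 nat" where
  "squarefree_exponent S = Abs_poly_mapping (\<lambda>p. if p \<in> S then 1 else 0)"

lemma lookup_squarefree_exponent: "lookup (squarefree_exponent S) p = (if p \<in> S then 1 else 0)"
  by (simp add: squarefree_exponent_def)

lemma inj_squarefree_exponent: "inj squarefree_exponent"
proof (rule injI)
  fix S T :: "'a set" assume "squarefree_exponent S = squarefree_exponent T"
  then have "lookup (squarefree_exponent S) p = lookup (squarefree_exponent T) p" for p
    by simp
  then have "p \<in> S \<longleftrightarrow> p \<in> T" for p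
    unfolding lookup_squarefree_exponent by (metis zero_neq_one)
  then show "S = T"
    by blast
qed

lemma mon_degree_squarefree_exponent: "mon_degree (squarefree_exponent S) = card S"
  by (simp add: mon_degree_def lookup_squarefree_exponent flip: sum.inter_restrict)

lemma box_line_bound: "box (line_bound l) = squarefree_exponent ` Pow l"
proof
  show "squarefree_exponent ` Pow l \<subseteq> box (line_bound l)"
    by (auto simp: box_def line_bound_def lookup_squarefree_exponent zero_enat_def one_enat_def)
  show "box (line_bound l) \<subseteq> squarefree_exponent ` Pow l"
  proof
    fix a assume a: "a \<in> box (line_bound l)"
    have le: "lookup a p \<le> (if p \<in> l then 1 else 0)" for p
      using a by (auto simp: box_def line_bound_def zero_enat_def one_enat_def split: if_splits)
    have "a = squarefree_exponent {p. 0 < lookup a p}"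
    proof (rule poly_mapping_eqI)
      fix p
      show "lookup a p = lookup (squarefree_exponent {p. 0 < lookup a p}) p"
        using le[of p] by (auto simp: lookup_squarefree_exponent split: if_splits)
    qed
    moreover have "{p. 0 < lookup a p} \<subseteq> l"
    proof
      fix p assume "p \<in> {p. 0 < lookup a p}"
      then show "p \<in> l"
        using le[of p] by (auto split: if_splits)
    qed
    ultimately show "a \<in> squarefree_exponent ` Pow l"
      by blast
  qed
qed

text \<open>
  The exponents of the monomials that do not vanish modulo the ideal of the linear space: they are
  squarefree and supported on a common line.
\<close>

definition face_exponents :: "'p::finite set set \<Rightarrow> ('p \<Rightarrow>\<^sub>0 nat) set" where
  "face_exponents L = (\<Union>l\<in>L. box (line_bound l))"

lemma order_ideal_face_exponents: "order_ideal (face_exponents L)"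
  unfolding order_ideal_def face_exponents_def
proof (intro ballI allI)
  fix a p assume "a \<in> (\<Union>l\<in>L. box (line_bound l))"
  then obtain l where "l \<in> L" "a \<in> box (line_bound l)"
    by (rule UN_E)
  then show "a - single p 1 \<in> (\<Union>l\<in>L. box (line_bound l))"
    using order_ideal_box[of "line_bound l"] unfolding order_ideal_def by (intro UN_I) auto
qed

lemma face_exponents_eq: "face_exponents L = squarefree_exponent ` incidence_complex L"
  unfolding face_exponents_def box_line_bound incidence_complex_def by auto

lemma prod_var: "(\<Prod>p\<in>S. var p) = (single (squarefree_exponent S) 1 :: ('p::finite, 'k::field) mpoly)"
proof (induction S rule: finite_induct[OF finite])
  case 1
  have "squarefree_exponent {} = (0 :: 'p \<Rightarrow>\<^sub>0 nat)"
    by (intro poly_mapping_eqI) (simp add: lookup_squarefree_exponent)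
  then show ?case
    by (simp add: single_one)
next
  case (2 p S)
  have "single p 1 + squarefree_exponent S = squarefree_exponent (insert p S)"
    using 2(2) by (intro poly_mapping_eqI)
      (auto simp: lookup_add lookup_single lookup_squarefree_exponent when_def)
  then show ?case
    using 2 by (simp add: var_def mult_single)
qed

lemma module_mult: "module ((*) :: 'a::comm_ring_1 \<Rightarrow> 'a \<Rightarrow> 'a)"
  by unfold_locales (simp_all add: distrib_left distrib_right mult.assoc)

lemma is_ideal_ideal_generated: "is_ideal (ideal_generated G)"
proof -
  interpret module "(*) :: ('a, 'b) mpoly \<Rightarrow> _"
    by (rule module_mult)
  show ?thesis
    unfolding is_ideal_def ideal_generated_def using span_zero span_add span_scale by blast
qed

lemma ideal_generated_base: "g \<in> G \<Longrightarrow> g \<in> ideal_generated G"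
  unfolding ideal_generated_def by (rule module.span_base[OF module_mult])

lemma ideal_generated_minimal:
  assumes "is_ideal I" "G \<subseteq> I"
  shows "ideal_generated G \<subseteq> I"
  unfolding ideal_generated_def
  by (rule module.span_minimal[OF module_mult assms(2)])
    (use assms(1) in \<open>simp add: module.subspace_def[OF module_mult] is_ideal_def\<close>)

lemma sum_single_keys: "(\<Sum>a\<in>keys f. single a (lookup f a)) = f"
  by (rule poly_mapping_eqI) (simp add: lookup_sum lookup_single when_def in_keys_iff)

lemma var_square: "var p ^ 2 = single (single p 2) 1"
  by (simp add: var_def power2_eq_square mult_single numeral_2_eq_2 flip: single_add)

text \<open>
  A monomial vanishing in the quotient is either divisible by a square of a variable, hence in
  the second ideal, or squarefree with a nonface as support, hence in the first.
\<close>

theorem I_Delta_monomial: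
  fixes L :: "'p::finite set set"
  shows "(I_Delta L :: ('p, 'k::field) mpoly set) = monomial_ideal (face_exponents L)"
proof
  let ?M = "monomial_ideal (face_exponents L) :: ('p, 'k) mpoly set"
  let ?S1 = "stanley_reisner_ideal (incidence_complex L) :: ('p, 'k) mpoly set"
  let ?S2 = "squares_ideal :: ('p, 'k) mpoly set"
  have M: "is_ideal ?M"
    by (rule is_ideal_monomial_ideal[OF order_ideal_face_exponents])
  have S1: "is_ideal ?S1" and S2: "is_ideal ?S2"
    unfolding stanley_reisner_ideal_def squares_ideal_def by (rule is_ideal_ideal_generated)+
  have "?S1 \<subseteq> ?M"
    unfolding stanley_reisner_ideal_def
  proof (rule ideal_generated_minimal[OF M], clarify)
    fix S assume "S \<notin> incidence_complex L"
    then have "squarefree_exponent S \<notin> face_exponents L"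
      unfolding face_exponents_eq by (simp add: inj_image_mem_iff[OF inj_squarefree_exponent])
    then show "(\<Prod>p\<in>S. var p) \<in> ?M"
      unfolding prod_var by (simp add: monomial_ideal_def)
  qed
  moreover have "?S2 \<subseteq> ?M"
    unfolding squares_ideal_def
  proof (rule ideal_generated_minimal[OF M], clarify)
    fix p :: 'p
    have "single p 2 \<notin> face_exponents L"
    proof
      assume "single p 2 \<in> face_exponents L"
      then obtain S where "single p 2 = squarefree_exponent S"
        by (auto simp: face_exponents_eq)
      then have "lookup (single p (2 :: nat)) p = lookup (squarefree_exponent S) p"
        by simp
      then show False
        by (simp add: lookup_squarefree_exponent split: if_splits)
    qed
    then show "var p ^ 2 \<in> ?M"
      unfolding var_square by (simp add: monomial_ideal_def)
  qed
  ultimately show "I_Delta L \<subseteq> ?M"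
    using M unfolding I_Delta_def is_ideal_def by (auto elim!: set_plus_elim)
  show "?M \<subseteq> I_Delta L"
  proof
    fix f :: "('p, 'k) mpoly" assume f: "f \<in> ?M"
    have monomial: "single a c \<in> ?S1 \<or> single a c \<in> ?S2" if a: "a \<notin> face_exponents L" for a :: "'p \<Rightarrow>\<^sub>0 nat" and c :: 'k
    proof (cases "\<exists>p. 2 \<le> lookup a p")
      case True
      then obtain p where p: "2 \<le> lookup a p" ..
      have "a - single p 2 + single p 2 = a"
        using p by (intro poly_mapping_eqI) (auto simp: lookup_add lookup_minus lookup_single when_def)
      then have "single a c = single (a - single p 2) c * var p ^ 2"
        by (simp add: var_square mult_single)
      moreover have "var p ^ 2 \<in> ?S2"
        unfolding squares_ideal_def by (intro ideal_generated_base rangeI)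
      ultimately show ?thesis
        using S2 by (simp add: is_ideal_def)
    next
      case False
      define S where "S = {p. 0 < lookup a p}"
      have aS: "a = squarefree_exponent S"
      proof (rule poly_mapping_eqI)
        fix p
        have "lookup a p < 2"
          using False by (simp add: not_le)
        then show "lookup a p = lookup (squarefree_exponent S) p"
          by (auto simp: lookup_squarefree_exponent S_def)
      qed
      then have "S \<notin> incidence_complex L"
        using a by (auto simp: face_exponents_eq)
      then have "(\<Prod>p\<in>S. var p) \<in> ?S1"
        unfolding stanley_reisner_ideal_def by (intro ideal_generated_base) blast
      moreover have "single a c = const c * (\<Prod>p\<in>S. var p)"
        by (simp add: prod_var aS const_def mult_single)
      ultimately show ?thesis
        using S1 by (simp add: is_ideal_def)
    qed
    have "(\<Sum>a\<in>A. single a (c a)) \<in> ?S1 + ?S2" if "finite A" "A \<inter> face_exponents L = {}"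
      for A and c :: "('p \<Rightarrow>\<^sub>0 nat) \<Rightarrow> 'k"
      using that
    proof (induction A rule: finite_induct)
      case empty
      have "0 + 0 \<in> ?S1 + ?S2"
        using S1 S2 by (intro set_plus_intro) (simp_all add: is_ideal_def)
      then show ?case
        by simp
    next
      case (insert a A)
      then obtain x y where xy: "x \<in> ?S1" "y \<in> ?S2" "(\<Sum>a\<in>A. single a (c a)) = x + y"
        by (auto elim: set_plus_elim)
      have "single a (c a) + x + y \<in> ?S1 + ?S2" if "single a (c a) \<in> ?S1"
        using that xy S1 by (intro set_plus_intro) (simp_all add: is_ideal_def)
      moreover have "x + (single a (c a) + y) \<in> ?S1 + ?S2" if "single a (c a) \<in> ?S2"
        using that xy S2 by (intro set_plus_intro) (simp_all add: is_ideal_def)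
      ultimately show ?case
        using monomial[of a "c a"] insert xy(3) by (auto simp: add_ac)
    qed
    from this[of "keys f" "lookup f"] f show "f \<in> I_Delta L"
      unfolding I_Delta_def sum_single_keys by (auto simp: monomial_ideal_def)
  qed
qed

section \<open>Counting\<close>

lemma card_line_degree: "card {a \<in> box (line_bound l). mon_degree a = s} = card (l :: 'p::finite set) choose s"
proof -
  have "{a \<in> box (line_bound l). mon_degree a = s} = squarefree_exponent ` {S. S \<subseteq> l \<and> card S = s}"
    by (auto simp: box_line_bound mon_degree_squarefree_exponent)
  then show ?thesis
    by (simp add: card_image inj_on_subset[OF inj_squarefree_exponent] n_subsets)
qed

lemma card_cells: "card (cells (Q :: ('p::finite \<Rightarrow>\<^sub>0 nat) set) i s) = (CARD('p) choose i) * card {a \<in> Q. mon_degree a = s}"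
proof -
  have "cells Q i s = {T. card T = i} \<times> {a \<in> Q. mon_degree a = s}"
    by (auto simp: cells_def)
  then show ?thesis
    by (simp add: card_cartesian_product card_subsets_of_card)
qed

lemma active_line_bound:
  assumes "S \<subseteq> l"
  shows "active (line_bound l) T (squarefree_exponent S) = {} \<longleftrightarrow> T \<inter> l = S"
  using assms by (auto simp: active_def line_bound_def lookup_squarefree_exponent zero_enat_def one_enat_def
      split: if_splits)

text \<open>
  A squarefree monomial \<open>x\<^sup>S\<close> on the line is inert together with \<open>e\<^sub>T\<close> iff \<open>T\<close> contains \<open>S\<close> and no further
  point of the line. So \<open>S\<close> is chosen among the points of the line and \<open>T - S\<close> among the others.
\<close>

lemma card_inactive_cells:
  fixes l :: "'p::finite set"
  shows "int (card (inactive_cells (line_bound l) i s)) =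
    binom (card l) (int s) * binom (CARD('p) - card l) (int i - int s)"
proof (cases "s \<le> i")
  case True
  define A where "A = {S. S \<subseteq> l \<and> card S = s} \<times> {S. S \<subseteq> - l \<and> card S = i - s}"
  define f :: "'p set \<times> 'p set \<Rightarrow> 'p set \<times> ('p \<Rightarrow>\<^sub>0 nat)"
    where "f = (\<lambda>(S, S'). (S \<union> S', squarefree_exponent S))"
  have "inj_on f A"
    by (auto simp: inj_on_def f_def A_def inj_eq[OF inj_squarefree_exponent])
  moreover have "f ` A = inactive_cells (line_bound l) i s"
  proof
    show "f ` A \<subseteq> inactive_cells (line_bound l) i s"
    proof (rule image_subsetI)
      fix x assume "x \<in> A"
      then obtain S S' where x: "x = (S, S')" "S \<subseteq> l" "card S = s" "S' \<subseteq> - l" "card S' = i - s"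
        by (auto simp: A_def)
      have "card (S \<union> S') = i"
        using x True by (subst card_Un_disjoint) auto
      moreover have "(S \<union> S') \<inter> l = S"
        using x by auto
      ultimately show "f x \<in> inactive_cells (line_bound l) i s"
        using x by (simp add: f_def inactive_cells_def cells_def box_line_bound active_line_bound
            mon_degree_squarefree_exponent)
    qed
    show "inactive_cells (line_bound l) i s \<subseteq> f ` A"
    proof
      fix x assume "x \<in> inactive_cells (line_bound l) i s"
      then obtain T S where x: "x = (T, squarefree_exponent S)" "S \<subseteq> l" "card S = s" "card T = i" "T \<inter> l = S"
        by (auto simp: inactive_cells_def cells_def box_line_bound active_line_bound
            mon_degree_squarefree_exponent)
      have "card (T - S) = i - s"
        using x by (subst card_Diff_subset) auto
      with x have "x = f (S, T - S)" "(S, T - S) \<in> A"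
        by (auto simp: f_def A_def)
      then show "x \<in> f ` A"
        by blast
    qed
  qed
  ultimately have "card (inactive_cells (line_bound l) i s) = card A"
    using card_image by metis
  also have "\<dots> = (card l choose s) * ((CARD('p) - card l) choose (i - s))"
    by (simp add: A_def card_cartesian_product n_subsets Compl_eq_Diff_UNIV card_Diff_subset)
  finally show ?thesis
    using True by (simp add: binom_def nat_diff_distrib)
next
  case False
  have "inactive_cells (line_bound l) i s = {}"
  proof (rule ccontr)
    assume "inactive_cells (line_bound l) i s \<noteq> {}"
    then obtain T S where x: "card S = s" "card T = i" "T \<inter> l = S"
      by (auto simp: inactive_cells_def cells_def box_line_bound active_line_bound
          mon_degree_squarefree_exponent)
    then have "s \<le> i"
      by (metis card_mono finite inf_le1)
    with False show False
      by simp
  qed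
  with False show ?thesis
    by (simp add: binom_def)
qed

section \<open>Dimensions for a single line\<close>

text \<open>
  The type argument fixes the field, which is not determined by the other arguments.
\<close>

abbreviation cycle_dim :: "'k::field itself \<Rightarrow> ('p::finite \<Rightarrow>\<^sub>0 nat) set \<Rightarrow> nat \<Rightarrow> nat \<Rightarrow> int" where
  "cycle_dim _ Q i s \<equiv> int (fun_vs.dim (koszul_cycles Q i s :: ('p, 'k) chain set))"

abbreviation boundary_dim :: "'k::field itself \<Rightarrow> ('p::finite \<Rightarrow>\<^sub>0 nat) set \<Rightarrow> nat \<Rightarrow> nat \<Rightarrow> int" where
  "boundary_dim _ Q i s \<equiv> int (fun_vs.dim (koszul_boundaries Q i s :: ('p, 'k) chain set))"

lemma boundary_dim_0: "boundary_dim TYPE('k::field) Q i 0 = 0"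
  unfolding koszul_boundaries_0 using fun_vs.dim_le_card[of "{0 :: ('a, 'k) chain}" "{}"] by simp

text \<open>
  Rank and nullity: all dimensions of boundaries can be expressed by those of cycles.
\<close>

lemma boundary_dim_Suc:
  "boundary_dim TYPE('k::field) Q i (Suc s) = int (card (cells Q (Suc i) s)) - cycle_dim TYPE('k) Q (Suc i) s"
  using card_cells_eq[where ?'k = 'k, of Q i s] by simp

lemma tor_dim_koszul_int:
  fixes Q :: "('p::finite \<Rightarrow>\<^sub>0 nat) set"
  assumes Q: "order_ideal Q"
  shows "int (tor_dim (koszul_complex :: ('p, 'k::field) augmented_complex) (monomial_ideal Q) (Suc i) (int (Suc i) + int s)) =
    cycle_dim TYPE('k) Q (Suc i) s - boundary_dim TYPE('k) Q (Suc i) s"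
proof -
  have "fun_vs.dim (koszul_boundaries Q (Suc i) s :: ('p, 'k) chain set) \<le>
      fun_vs.dim (koszul_cycles Q (Suc i) s :: ('p, 'k) chain set)"
    by (rule fun_vs.dim_mono_of_finite_span[OF koszul_boundaries_subset_cycles[OF Q]
          koszul_cycles_subset_span finite_imageI[OF finite_cells]])
  then show ?thesis
    unfolding tor_dim_koszul[OF Q] by (rule of_nat_diff)
qed

lemma cycle_dim_0: "cycle_dim TYPE('k::field) Q 0 s = int (card (cells Q 0 s))"
proof -
  have "koszul_diff Q f = 0" if "f \<in> supported (cells Q 0 s)" for f :: "('a, 'k) chain"
  proof -
    have "f (insert p T, a) = 0" for p T a
      using that by (simp add: supported_def cells_def)
    then show ?thesis
      by (auto simp: koszul_diff_def fun_eq_iff)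
  qed
  then have "koszul_cycles Q 0 s = (supported (cells Q 0 s) :: ('a, 'k) chain set)"
    by (auto simp: koszul_cycles_def)
  then show ?thesis
    by (simp only: dim_supported[OF finite_cells])
qed

lemma cycle_dim_line_0:
  fixes l :: "'p::finite set"
  shows "cycle_dim TYPE('k::field) (box (line_bound l)) i 0 = binom (CARD('p) - card l) (int i)"
  using boundary_dim_0[where ?'k = 'k, of "box (line_bound l)" i] card_inactive_cells[of l i 0]
  by (simp add: dim_koszul_cycles_box binom_def)

text \<open>
  A recursion over \<open>s\<close>: the cycles are the boundaries and the inactive cells together, and the
  dimension of the boundaries is given by the cycles in degree \<open>s\<close>.
\<close>

lemma cycle_dim_line_Suc:
  fixes l :: "'p::finite set"
  shows "cycle_dim TYPE('k::field) (box (line_bound l)) i (Suc s) =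
    int (card (cells (box (line_bound l)) (Suc i) s)) - cycle_dim TYPE('k) (box (line_bound l)) (Suc i) s +
    binom (card l) (int (Suc s)) * binom (CARD('p) - card l) (int i - int (Suc s))"
  unfolding dim_koszul_cycles_box[where i = i and s = "Suc s"] of_nat_add boundary_dim_Suc
    card_inactive_cells ..

lemma int_card_cells_line:
  "int (card (cells (box (line_bound (l :: 'p::finite set))) i s)) = binom CARD('p) (int i) * binom (card l) (int s)"
  by (simp add: card_cells card_line_degree binom_def)

lemma cycle_dim_line_1:
  fixes l :: "'p::finite set"
  shows "cycle_dim TYPE('k::field) (box (line_bound l)) i 1 =
    binom CARD('p) (int i + 1) - binom (CARD('p) - card l) (int i + 1) +
    int (card l) * binom (CARD('p) - card l) (int i - 1)"
  using cycle_dim_line_Suc[where ?'k = 'k, of l i 0] cycle_dim_line_0[where ?'k = 'k, of l "Suc i"]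
  by (simp add: int_card_cells_line binom_def[of _ 0] binom_def[of _ 1] add.commute)

lemma cycle_dim_line_2:
  fixes l :: "'p::finite set"
  shows "cycle_dim TYPE('k::field) (box (line_bound l)) i 2 =
    int (card l) * binom CARD('p) (int i + 1) - binom CARD('p) (int i + 2)
    + binom (CARD('p) - card l) (int i + 2) - int (card l) * binom (CARD('p) - card l) (int i)
    + binom (card l) 2 * binom (CARD('p) - card l) (int i - 2)"
  using cycle_dim_line_Suc[where ?'k = 'k, of l i 1] cycle_dim_line_1[where ?'k = 'k, of l "Suc i"]
  by (simp add: int_card_cells_line binom_def[of _ 1] numeral_2_eq_2 add.commute algebra_simps)

text \<open>
  For \<open>i = 1\<close> it is shorter to count from the other end of the complex: everything in exterior
  degree 0 is a cycle, and the differential from \<open>(1, 2)\<close> to \<open>(0, 3)\<close> is onto, as no cell of type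
  \<open>(0, 3)\<close> is inactive.
\<close>

lemma cycle_dim_line_1_2:
  fixes l :: "'p::finite set"
  shows "cycle_dim TYPE('k::field) (box (line_bound l)) 1 2 =
    int CARD('p) * binom (card l) 2 - binom (card l) 3"
proof -
  have "card (inactive_cells (line_bound l) 0 3) = 0"
    using card_inactive_cells[of l 0 3] by (simp add: binom_def)
  then have "boundary_dim TYPE('k) (box (line_bound l)) 0 3 = int (card (cells (box (line_bound l)) 0 3))"
    using dim_koszul_cycles_box[where ?'k = 'k, of "line_bound l" 0 3] cycle_dim_0[where ?'k = 'k, of "box (line_bound l)" 3]
    by simp
  moreover have "boundary_dim TYPE('k) (box (line_bound l)) 0 (Suc 2) =
      int (card (cells (box (line_bound l)) (Suc 0) 2)) - cycle_dim TYPE('k) (box (line_bound l)) (Suc 0) 2"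
    by (rule boundary_dim_Suc)
  ultimately show ?thesis
    by (simp add: int_card_cells_line binom_def)
qed

section \<open>Linear spaces\<close>

lemma sum_over_lines:
  fixes L :: "'p::finite set set" and g :: "nat \<Rightarrow> int"
  assumes "\<And>k. k < m \<Longrightarrow> int (num_lines L k) * g k = 0"
  shows "(\<Sum>l\<in>L. g (card l)) = (\<Sum>k=m..CARD('p). int (num_lines L k) * g k)"
proof -
  have "(\<Sum>l\<in>L. g (card l)) = (\<Sum>k\<in>{..CARD('p)}. \<Sum>l | l \<in> L \<and> card l = k. g (card l))"
    by (rule sum.group[symmetric]) (auto intro: card_mono)
  also have "\<dots> = (\<Sum>k\<in>{..CARD('p)}. int (num_lines L k) * g k)"
    by (intro sum.cong refl) (simp add: num_lines_def)
  also have "\<dots> = (\<Sum>k=m..CARD('p). int (num_lines L k) * g k)"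
  proof (rule sum.mono_neutral_right)
    show "\<forall>k\<in>{..CARD('p)} - {m..CARD('p)}. int (num_lines L k) * g k = 0"
    proof
      fix k assume "k \<in> {..CARD('p)} - {m..CARD('p)}"
      then have "k < m"
        by auto
      then show "int (num_lines L k) * g k = 0"
        by (rule assms)
    qed
  qed auto
  finally show ?thesis .
qed

context
  fixes L :: "'p::finite set set"
  assumes lin: "linear_space UNIV L" and d2: "2 \<le> CARD('p)"
begin

lemma card_line_ge_2: "l \<in> L \<Longrightarrow> 2 \<le> card l"
  using lin by (simp add: linear_space_def)

lemma num_lines_small: "k < 2 \<Longrightarrow> num_lines L k = 0"
  using card_line_ge_2 by (fastforce simp: num_lines_def)

text \<open>
  Two points determine a line, so two lines share at most one point.
\<close>

lemma common_face_small:
  assumes "l \<in> L" "l' \<in> L" "l \<noteq> l'" "a \<in> box (line_bound l)" "a \<in> box (line_bound l')"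
  shows "mon_degree a < 2"
proof -
  obtain S where S: "a = squarefree_exponent S" "S \<subseteq> l" "S \<subseteq> l'"
    using assms(4,5) by (auto simp: box_line_bound dest: injD[OF inj_squarefree_exponent])
  have "\<not> 2 \<le> card S"
  proof
    assume "2 \<le> card S"
    then obtain p q where "p \<in> S" "q \<in> S" "p \<noteq> q"
      by (auto simp: card_le_Suc_iff numeral_2_eq_2)
    moreover have "\<exists>!l. l \<in> L \<and> p \<in> l \<and> q \<in> l"
      using lin \<open>p \<noteq> q\<close> by (simp add: linear_space_def)
    ultimately show False
      using S(2,3) assms(1-3) by (metis subsetD)
  qed
  then show ?thesis
    by (simp add: S(1) mon_degree_squarefree_exponent)
qed

text \<open>
  Any two points lie on a line, so every squarefree monomial of degree at most 2 is a face: up to this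
  degree a linear space looks like a single line through all points.
\<close>

lemma face_exponents_low_degree:
  assumes "mon_degree a \<le> 2"
  shows "a \<in> face_exponents L \<longleftrightarrow> a \<in> box (line_bound UNIV)"
proof -
  have "S \<in> incidence_complex L" if S: "card S \<le> 2" for S :: "'p set"
  proof -
    obtain S' where S': "S \<subseteq> S'" "card S' = 2"
      using exists_subset_between[of S 2 UNIV] S d2 by auto
    then obtain p q where pq: "S' = {p, q}" "p \<noteq> q"
      by (auto simp: card_2_iff)
    then obtain l where "l \<in> L" "p \<in> l" "q \<in> l"
      using lin unfolding linear_space_def by blast
    then show ?thesis
      using S' pq by (auto simp: incidence_complex_def)
  qed
  then show ?thesis
    using assms by (auto simp: face_exponents_eq box_line_bound mon_degree_squarefree_exponent)
qed

text \<open>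
  Beyond degree 1 a monomial belongs to at most one line, so the cycles add up.
\<close>

lemma lines_glue:
  assumes "finite M" "M \<subseteq> L" "2 \<le> s"
  shows "cycle_dim TYPE('k::field) (face_exponents M) i s = (\<Sum>l\<in>M. cycle_dim TYPE('k) (box (line_bound l)) i s)"
  using assms
proof (induction M rule: finite_induct)
  case empty
  have "card (cells {} i s) = 0"
    by (simp add: cells_def)
  then have "fun_vs.dim (koszul_cycles {} i s :: ('p, 'k) chain set) \<le> 0"
    using fun_vs.dim_le_card[OF koszul_cycles_subset_span[of "{}" i s, where ?'b = 'k]]
    by (simp add: cells_def)
  then show ?case
    by (simp add: face_exponents_def)
next
  case (insert l M)
  have "face_exponents (insert l M) = box (line_bound l) \<union> face_exponents M"
    by (simp add: face_exponents_def)
  moreover have "mon_degree a < s" if a: "a \<in> box (line_bound l)" "a \<in> face_exponents M" for a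
  proof -
    obtain l' where l': "l' \<in> M" "a \<in> box (line_bound l')"
      using a(2) by (auto simp: face_exponents_def)
    then have "mon_degree a < 2"
      using a(1) insert.prems(1) insert.hyps(2) by (intro common_face_small[of l l']) auto
    with \<open>2 \<le> s\<close> show ?thesis
      by simp
  qed
  ultimately show ?case
    using insert dim_koszul_cycles_Un[OF order_ideal_box order_ideal_face_exponents,
        of "line_bound l" M s i, where ?'k = 'k] by simp
qed

lemma cycle_dim_lines: "2 \<le> s \<Longrightarrow>
    cycle_dim TYPE('k::field) (face_exponents L) i s = (\<Sum>l\<in>L. cycle_dim TYPE('k) (box (line_bound l)) i s)"
  by (rule lines_glue) auto

lemma card_cells_lines:
  assumes "2 \<le> s"
  shows "card (cells (face_exponents L) i s) = (\<Sum>l\<in>L. card (cells (box (line_bound l)) i s))"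
proof -
  have "cells (face_exponents L) i s = (\<Union>l\<in>L. cells (box (line_bound l)) i s)"
    by (auto simp: cells_def face_exponents_def)
  then show ?thesis
  proof (simp only:, intro card_UN_disjoint ballI impI)
    fix l l' assume l: "l \<in> L" "l' \<in> L" "l \<noteq> l'"
    have False if "(T, a) \<in> cells (box (line_bound l)) i s" "(T, a) \<in> cells (box (line_bound l')) i s" for T a
      using that common_face_small[OF l, of a] assms by (simp add: cells_def)
    then show "cells (box (line_bound l)) i s \<inter> cells (box (line_bound l')) i s = {}"
      by auto
  qed (simp_all add: finite_cells)
qed

lemma cycle_dim_low:
  assumes "s \<le> 1"
  shows "cycle_dim TYPE('k::field) (face_exponents L) i s = cycle_dim TYPE('k) (box (line_bound (UNIV :: 'p set))) i s"
  using assms by (subst koszul_cycles_cong_low_degree[of s _ "box (line_bound UNIV)"])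
    (simp_all add: face_exponents_low_degree)

lemma card_cells_low:
  assumes "s \<le> 2"
  shows "card (cells (face_exponents L) i s) = card (cells (box (line_bound (UNIV :: 'p set))) i s)"
proof -
  have "cells (face_exponents L) i s = cells (box (line_bound UNIV)) i s"
    using face_exponents_low_degree assms by (auto simp: cells_def)
  then show ?thesis
    by (rule arg_cong)
qed

text \<open>
  The two descriptions of the cells overlap in degree 2, where they count the pairs of points in two
  ways.
\<close>

lemma sum_pairs_of_lines: "(\<Sum>l\<in>L. binom (card l) 2) = binom CARD('p) 2"
  using card_cells_lines[of 2 0] card_cells_low[of 2 0]
  by (simp add: card_cells card_line_degree binom_def flip: of_nat_sum)

lemma graded_betti_eq:
  assumes "1 \<le> i"
  shows "int (graded_betti (I_Delta L :: ('p, 'k::field) mpoly set) i (int i + int s)) =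
    cycle_dim TYPE('k) (face_exponents L) i s - boundary_dim TYPE('k) (face_exponents L) i s"
proof -
  obtain n where n: "i = Suc n"
    using assms by (cases i) auto
  show ?thesis
    unfolding n I_Delta_monomial graded_betti_koszul[OF is_ideal_monomial_ideal[OF order_ideal_face_exponents]]
    by (rule tor_dim_koszul_int[OF order_ideal_face_exponents])
qed

lemma graded_betti_below:
  assumes "1 \<le> i" "j < int i"
  shows "graded_betti (I_Delta L :: ('p, 'k::field) mpoly set) i j = 0"
proof -
  obtain n where n: "i = Suc n"
    using assms by (cases i) auto
  show ?thesis
    using assms(2)
    unfolding n I_Delta_monomial graded_betti_koszul[OF is_ideal_monomial_ideal[OF order_ideal_face_exponents]]
    by (rule tor_dim_below_diagonal)
qed

lemma graded_betti_diagonal: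
  assumes "1 \<le> i"
  shows "graded_betti (I_Delta L :: ('p, 'k::field) mpoly set) i (int i) = 0"
  using graded_betti_eq[OF assms, where ?'k = 'k, of 0] cycle_dim_low[where ?'k = 'k, of 0 i]
    cycle_dim_line_0[where ?'k = 'k, of "UNIV :: 'p set" i]
    boundary_dim_0[where ?'k = 'k, of "face_exponents L" i] assms
  by (simp add: binom_def)

text \<open>
  Up to \<open>s = 1\<close>, cycles and boundaries are those of a single line through all points.
\<close>

lemma graded_betti_linear_strand:
  assumes "1 \<le> i"
  shows "int (graded_betti (I_Delta L :: ('p, 'k::field) mpoly set) i (int i + 1)) = (if i = 1 then int CARD('p) else 0)"
proof -
  have "int (graded_betti (I_Delta L :: ('p, 'k) mpoly set) i (int i + 1)) =
      cycle_dim TYPE('k) (box (line_bound (UNIV :: 'p set))) i (Suc 0) -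
      (int (card (cells (box (line_bound (UNIV :: 'p set))) (Suc i) 0)) -
        cycle_dim TYPE('k) (box (line_bound (UNIV :: 'p set))) (Suc i) 0)"
    using graded_betti_eq[OF assms, where ?'k = 'k, of "Suc 0"]
    unfolding boundary_dim_Suc cycle_dim_low[OF zero_le] cycle_dim_low[OF eq_refl[OF One_nat_def[symmetric]]] card_cells_low[OF zero_le]
    by simp
  also have "\<dots> = binom CARD('p) 1 * binom 0 (int i - 1)"
    unfolding cycle_dim_line_Suc by simp
  finally show ?thesis
    using assms by (auto simp: binom_def)
qed

text \<open>
  For \<open>s = 2\<close> the cycles are added up over the lines, while the boundaries come from degree 1
  and are those of a single line through all points.
\<close>

lemma graded_betti_2_strand:
  assumes "1 \<le> i"
  shows "int (graded_betti (I_Delta L :: ('p, 'k::field) mpoly set) i (int i + 2)) =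
    (\<Sum>l\<in>L. cycle_dim TYPE('k) (box (line_bound l)) i 2) + binom CARD('p) (int i + 2)
      - int CARD('p) * binom CARD('p) (int i + 1)"
proof -
  have "int (graded_betti (I_Delta L :: ('p, 'k) mpoly set) i (int i + int 2)) =
      cycle_dim TYPE('k) (face_exponents L) i 2 - boundary_dim TYPE('k) (face_exponents L) i (Suc 1)"
    using graded_betti_eq[OF assms, where ?'k = 'k, of 2] by (simp only: Suc_1)
  also have "\<dots> = (\<Sum>l\<in>L. cycle_dim TYPE('k) (box (line_bound l)) i 2) -
      (int (card (cells (box (line_bound (UNIV :: 'p set))) (Suc i) 1)) -
        cycle_dim TYPE('k) (box (line_bound (UNIV :: 'p set))) (Suc i) 1)"
    unfolding boundary_dim_Suc cycle_dim_low[OF order_refl] card_cells_low[OF one_le_numeral] cycle_dim_lines[OF order_refl] ..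
  finally show ?thesis
    using assms unfolding cycle_dim_line_1 int_card_cells_line
    by (simp add: binom_def nat_add_distrib)
qed

text \<open>
  For \<open>s \<ge> 3\<close> the cycles and the boundaries are both added up over the lines, so the homology is
  the sum of the homologies of the lines.
\<close>

lemma graded_betti_high_strands:
  assumes "1 \<le> i" "3 \<le> s"
  shows "int (graded_betti (I_Delta L :: ('p, 'k::field) mpoly set) i (int i + int s)) =
    (\<Sum>l\<in>L. binom (card l) (int s) * binom (CARD('p) - card l) (int i - int s))"
proof -
  obtain t where t: "s = Suc t" "2 \<le> t"
    using assms(2) by (cases s) auto
  have "2 \<le> s"
    using assms(2) by simp
  have "int (graded_betti (I_Delta L :: ('p, 'k) mpoly set) i (int i + int s)) =
      (\<Sum>l\<in>L. cycle_dim TYPE('k) (box (line_bound l)) i s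
        - (int (card (cells (box (line_bound l)) (Suc i) t)) - cycle_dim TYPE('k) (box (line_bound l)) (Suc i) t))"
    unfolding graded_betti_eq[OF assms(1)] cycle_dim_lines[OF \<open>2 \<le> s\<close>]
    unfolding t(1) boundary_dim_Suc cycle_dim_lines[OF t(2)] card_cells_lines[OF t(2)] of_nat_sum
      sum_subtractf ..
  also have "\<dots> = (\<Sum>l\<in>L. binom (card l) (int s) * binom (CARD('p) - card l) (int i - int s))"
    unfolding t(1) cycle_dim_line_Suc by (intro sum.cong refl) simp
  finally show ?thesis .
qed

end

lemma binom_eq_0: "int k < b \<Longrightarrow> binom k b = 0"
  by (simp add: binom_def binomial_eq_0_iff)

theorem theorem3p4:
  fixes L :: "'p::finite set set"
    and I :: "('p, 'k::field) mpoly set"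
    and d :: nat
  assumes "linear_space (UNIV :: 'p set) L"
    and "d = card (UNIV :: 'p set)"
    and "d \<ge> 2"
    and "I = I_Delta L"
  shows "(\<forall>j. int (graded_betti I 1 j) =
           (if j = 2 then int d
            else if j = 3 then binom d 3 - (\<Sum>k=3..d. binom k 3 * int (num_lines L k))
            else 0)) \<and>
         (\<forall>i\<ge>2. \<forall>j. j \<le> int i + 1 \<longrightarrow> graded_betti I i j = 0) \<and>
         (\<forall>i\<ge>2. int (graded_betti I i (int i + 2)) =
           binom d (int i + 2) - int d * binom d (int i + 1) + binom d 2 * binom (d - 2) (int i)
           + (\<Sum>k=2..d. int (num_lines L k) *
                (binom (d - k) (int i + 2) - int k * binom (d - k) (int i)
                  + binom k 2 * binom (d - k) (int i - 2)))
           + (\<Sum>k=2..d. int (num_lines L k) *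
                (- binom d (int i + 2) + int k * binom d (int i + 1)
                  - binom k 2 * binom (d - 2) (int i)))) \<and>
         (\<forall>i\<ge>2. \<forall>j\<ge>int i + 3. int (graded_betti I i j) =
           (\<Sum>k=nat (j - int i)..d.
              binom k (j - int i) * binom (d - k) (2 * int i - j) * int (num_lines L k)))"
proof (intro conjI allI impI)
  note lin = assms(1) and d = assms(2) and I = assms(4)
  have d2: "2 \<le> card (UNIV :: 'p set)"
    using assms(2,3) by simp
  note strand2 = graded_betti_2_strand[OF lin d2, where ?'k = 'k, folded I d]
  note high = graded_betti_high_strands[OF lin d2, where ?'k = 'k, folded I d]
  note sum_lines = sum_over_lines[of _ L, folded d]
  have pairs: "(\<Sum>l\<in>L. binom (card l) 2) = binom d 2"
    using sum_pairs_of_lines[OF lin d2] d by simp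
  show "int (graded_betti I 1 j) = (if j = 2 then int d
      else if j = 3 then binom d 3 - (\<Sum>k=3..d. binom k 3 * int (num_lines L k)) else 0)" for j
  proof -
    consider "j < 1" | "j = 1" | "j = 2" | "j = 3" | "4 \<le> j"
      by linarith
    then show ?thesis
    proof cases
      case 1
      then show ?thesis
        using graded_betti_below[OF lin d2, where ?'k = 'k, of 1 j] I by simp
    next
      case 2
      then show ?thesis
        using graded_betti_diagonal[OF lin d2, where ?'k = 'k, of 1] I by simp
    next
      case 3
      then show ?thesis
        using graded_betti_linear_strand[OF lin d2, where ?'k = 'k, of 1] I d by simp
    next
      case 4
      have "(\<Sum>l\<in>L. cycle_dim TYPE('k) (box (line_bound l)) 1 2) = int d * binom d 2 - (\<Sum>l\<in>L. binom (card l) 3)"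
        by (simp only: cycle_dim_line_1_2 sum_subtractf sum_distrib_left[symmetric] pairs d[symmetric])
      moreover have "(\<Sum>l\<in>L. binom (card l) 3) = (\<Sum>k=3..d. int (num_lines L k) * binom k 3)"
        by (rule sum_lines) (simp add: binom_eq_0)
      ultimately show ?thesis
        using 4 strand2[of 1] by (simp add: mult.commute)
    next
      case 5
      define s where "s = nat (j - 1)"
      have "j = int 1 + int s" "3 \<le> s"
        using 5 by (simp_all add: s_def)
      moreover have "binom a (int 1 - int s) = 0" for a
        using \<open>3 \<le> s\<close> by (simp add: binom_def)
      ultimately show ?thesis
        using high[of 1 s] 5 by simp
    qed
  qed
  fix i :: nat assume i: "2 \<le> i"
  show "graded_betti I i j = 0" if j: "j \<le> int i + 1" for j
  proof -
    consider "j < int i" | "j = int i" | "j = int i + 1"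
      using j by linarith
    then show ?thesis
    proof cases
      case 1
      then show ?thesis
        using graded_betti_below[OF lin d2, where ?'k = 'k, of i j] i I by simp
    next
      case 2
      then show ?thesis
        using graded_betti_diagonal[OF lin d2, where ?'k = 'k, of i] i I by simp
    next
      case 3
      then show ?thesis
        using graded_betti_linear_strand[OF lin d2, where ?'k = 'k, of i] i I by simp
    qed
  qed
  show "int (graded_betti I i (int i + 2)) =
      binom d (int i + 2) - int d * binom d (int i + 1) + binom d 2 * binom (d - 2) (int i)
      + (\<Sum>k=2..d. int (num_lines L k) *
           (binom (d - k) (int i + 2) - int k * binom (d - k) (int i)
             + binom k 2 * binom (d - k) (int i - 2)))
      + (\<Sum>k=2..d. int (num_lines L k) *
           (- binom d (int i + 2) + int k * binom d (int i + 1)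
             - binom k 2 * binom (d - 2) (int i)))"
  proof -
    \<comment> \<open>A and B are the summands of the two given sums; their sum at card l is the dimension of the cycles for l.\<close>
    define A where "A k = binom (d - k) (int i + 2) - int k * binom (d - k) (int i)
             + binom k 2 * binom (d - k) (int i - 2)" for k
    define B where "B k = - binom d (int i + 2) + int k * binom d (int i + 1)
             - binom k 2 * binom (d - 2) (int i)" for k
    have small: "int (num_lines L k) * x = 0" if "k < 2" for x k
      using num_lines_small[OF lin d2 that] by simp
    have A: "(\<Sum>l\<in>L. A (card l)) = (\<Sum>k=2..d. int (num_lines L k) * A k)"
      and B: "(\<Sum>l\<in>L. B (card l)) = (\<Sum>k=2..d. int (num_lines L k) * B k)"
      by (rule sum_lines, erule small)+
    have AB: "(\<Sum>k=2..d. int (num_lines L k) * A k) + (\<Sum>k=2..d. int (num_lines L k) * B k) =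
        (\<Sum>l\<in>L. A (card l) + B (card l))"
      unfolding sum.distrib A B ..
    also have "\<dots> = (\<Sum>l\<in>L. cycle_dim TYPE('k) (box (line_bound l)) i 2 - binom (card l) 2 * binom (d - 2) (int i))"
      unfolding A_def B_def cycle_dim_line_2 d[symmetric] by (intro sum.cong refl) simp
    also have "\<dots> = (\<Sum>l\<in>L. cycle_dim TYPE('k) (box (line_bound l)) i 2) - binom d 2 * binom (d - 2) (int i)"
      by (simp only: sum_subtractf sum_distrib_right[symmetric] pairs)
    finally show ?thesis
      using strand2[of i] i unfolding A_def B_def by simp
  qed
  show "int (graded_betti I i j) = (\<Sum>k=nat (j - int i)..d.
      binom k (j - int i) * binom (d - k) (2 * int i - j) * int (num_lines L k))"
    if "int i + 3 \<le> j" for j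
  proof -
    define s where "s = nat (j - int i)"
    have s: "3 \<le> s" "j = int i + int s" "j - int i = int s" "2 * int i - j = int i - int s"
      using that by (simp_all add: s_def)
    have "int (graded_betti I i j) = (\<Sum>l\<in>L. binom (card l) (int s) * binom (d - card l) (int i - int s))"
      unfolding s(2) using i s(1) by (intro high) simp_all
    also have "\<dots> = (\<Sum>k=s..d. int (num_lines L k) * (binom k (int s) * binom (d - k) (int i - int s)))"
      by (rule sum_lines) (simp add: binom_eq_0)
    finally show ?thesis
      unfolding s(3,4) nat_int by (simp add: mult_ac)
  qed
qed

end
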